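(* Let $u$ be an $x_2$-monotone global solution of the obstacle problem in $\mathbb{R}^2$. Then its coincidence set is a paraboloid: there exists $\gamma>0$ such that $$\{u=0\}=\gamma P:=\{(y_1,y_2)\in\mathbb{R}^2:\ y_2\ge 0,\ -\sqrt{\gamma y_2}\le y_1\le \sqrt{\gamma y_2}\}.$$
   Context: A global solution of the obstacle problem in $\mathbb{R}^2$ is a function $u\in C^{1,1}_{\mathrm{loc}}(\mathbb{R}^2)$ with $u\ge 0$ and $\Delta u=\chi_{\{u>0\}}$ a.e. in $\mathbb{R}^2$; its coincidence set is $\mathcal{C}=\{u=0\}$. Such a solution is called $x_2$-monotone if: (i) $r^{-2}u(rx)\to \tfrac12 x_1^2$ as $r\to\infty$ (in $C^{1,\alpha}_{\mathrm{loc}}(\mathbb{R}^2)$); (ii) $\partial_2 u\le 0$ in $\mathbb{R}^2$; (iii) $\mathcal{C}\cap\{x_2\le 0\}=\{0\}$; (iv) $\mathcal{C}$ has non-empty interior. *)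

theory Defs
  imports "HOL-Analysis.Analysis"
begin

definition grad :: "(real \<times> real \<Rightarrow> real) \<Rightarrow> real \<times> real \<Rightarrow> real \<times> real" where
  "grad u x = (frechet_derivative u (at x) (1, 0), frechet_derivative u (at x) (0, 1))"

definition laplacian :: "(real \<times> real \<Rightarrow> real) \<Rightarrow> real \<times> real \<Rightarrow> real" where
  "laplacian u x = fst (frechet_derivative (grad u) (at x) (1, 0))
                 + snd (frechet_derivative (grad u) (at x) (0, 1))"

definition C11_loc :: "(real \<times> real \<Rightarrow> real) \<Rightarrow> bool" where
  "C11_loc u \<longleftrightarrow> (\<forall>x. u differentiable (at x)) \<and>
     (\<forall>K. compact K \<longrightarrow> (\<exists>L. \<forall>x\<in>K. \<forall>y\<in>K. dist (grad u x) (grad u y) \<le> L * dist x y))"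

definition global_solution :: "(real \<times> real \<Rightarrow> real) \<Rightarrow> bool" where
  "global_solution u \<longleftrightarrow> C11_loc u \<and> (\<forall>x. 0 \<le> u x) \<and>
     (AE x in lebesgue. grad u differentiable (at x) \<and>
        laplacian u x = (if u x > 0 then 1 else 0))"

definition rescale :: "real \<Rightarrow> (real \<times> real \<Rightarrow> real) \<Rightarrow> real \<times> real \<Rightarrow> real" where
  "rescale r u x = u (r *\<^sub>R x) / r\<^sup>2"

definition C1alpha_loc_tendsto ::
  "real \<Rightarrow> (real \<Rightarrow> real \<times> real \<Rightarrow> real) \<Rightarrow> (real \<times> real \<Rightarrow> real) \<Rightarrow> bool" where
  "C1alpha_loc_tendsto \<alpha> f g \<longleftrightarrow>
     (\<forall>K. compact K \<longrightarrow> (\<forall>\<epsilon>>0. eventually (\<lambda>r.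
        (\<forall>x\<in>K. \<bar>f r x - g x\<bar> \<le> \<epsilon> \<and> norm (grad (f r) x - grad g x) \<le> \<epsilon>) \<and>
        (\<forall>x\<in>K. \<forall>y\<in>K. x \<noteq> y \<longrightarrow>
            norm ((grad (f r) x - grad g x) - (grad (f r) y - grad g y)) \<le> \<epsilon> * dist x y powr \<alpha>))
      at_top))"

definition x2_monotone :: "(real \<times> real \<Rightarrow> real) \<Rightarrow> bool" where
  "x2_monotone u \<longleftrightarrow>
     (\<exists>\<alpha>. 0 < \<alpha> \<and> \<alpha> < 1 \<and>
        C1alpha_loc_tendsto \<alpha> (\<lambda>r. rescale r u) (\<lambda>x. (fst x)\<^sup>2 / 2)) \<and>
     (\<forall>x. snd (grad u x) \<le> 0) \<and>
     {x. u x = 0} \<inter> {x. snd x \<le> 0} = {0} \<and>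
     interior {x. u x = 0} \<noteq> {}"

end

theory Submission
  imports Defs "HOL-Complex_Analysis.Complex_Analysis"
begin

text \<open>
  Write \<open>z = x\<^sub>1 + \<i> x\<^sub>2\<close>, let \<open>\<Omega> = {u > 0}\<close> and \<open>F = 2 (x\<^sub>1 - \<partial>\<^sub>1u) + 2 \<i> \<partial>\<^sub>2u\<close>. Since \<open>\<Delta>u = 1\<close> in \<open>\<Omega>\<close>,
  \<open>F\<close> is holomorphic there; moreover \<open>Im F \<le> 0\<close>, and \<open>F = 2 x\<^sub>1\<close> on the coincidence set, which is closed
  under moving upwards. Comparison with a quadratic barrier bounds the depth of the fjords of \<open>\<Omega>\<close>, so any
  two far away points of \<open>\<Omega>\<close> can be joined far away. By Koebe's lemma on arcs the Riemann map of the
  simply connected set \<open>\<Omega>\<close> therefore has a limit at infinity, which gives a conformal map \<open>\<Psi>\<close> of the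
  upper half plane onto \<open>\<Omega>\<close> that stays bounded near each finite boundary point.

  The imaginary parts of \<open>B = - F \<circ> \<Psi>\<close> and of \<open>Q = - \<i> (\<Psi> + B / 2)\<close> vanish on the real axis, so both
  functions extend to entire functions that are real on the real axis. The Schwarz lemma, applied to
  \<open>B + \<i>\<close> and to a square root of \<open>\<Psi>\<close> (\<open>\<Omega>\<close> lies in a slit plane), bounds their growth: \<open>B\<close> is linear
  and \<open>Q\<close> is quadratic. Hence \<open>z = \<i> q(v) - v / 2\<close> with \<open>v = - F(z)\<close> and a real quadratic polynomial
  \<open>q\<close>. On the boundary \<open>v = - 2 x\<^sub>1\<close> and \<open>x\<^sub>2 = q(- 2 x\<^sub>1)\<close>, and the coincidence set meets
  \<open>{x\<^sub>2 \<le> 0}\<close> only in the origin, so \<open>q(v) = c v\<^sup>2\<close> with \<open>c > 0\<close>.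
\<close>

section \<open>Koebe's lemma on arcs\<close>

text \<open>The free boundary is not known to be a curve, so \<open>\<Psi>\<close> cannot be assumed
  to have boundary values. The substitute is weak: a continuous real function that vanishes on the
  coincidence set, composed with \<open>\<Psi>\<close>, tends to 0 at every real point. Two such
  functions are enough: where \<open>U\<close> vanishes, \<open>F z\<close> is real and
  \<open>z - F z / 2\<close> is purely imaginary.

  The single limit at infinity matters because otherwise finite real points could also be sent to
  infinity, and the extended functions could be singular there.

  The normalization of \<open>F\<close> makes it the complex derivative of a function with real part
  x1^2 - 2 u, which is harmonic because x1^2 and 2 u both have Laplacian 2.

  The degrees come from the target domains. \<open>B\<close> takes values in a closed half plane,
  which allows linear growth. \<open>\<Omega>\<close> omits the upward ray from the origin, a square
  root takes this slit plane to a half plane, and so \<open>\<Psi>\<close> is the square of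
  something of linear growth.\<close>

text \<open>Lift \<open>p\<close> to an argument \<open>\<phi>\<close>. A chord is at most as long
  as the change of argument, so endpoints further apart than \<open>2 * pi / real k\<close> force
  \<open>k\<close> times the argument through a full turn, and the intermediate value theorem finds
  the direction \<open>e\<close> on the way.\<close>

lemma circle_path_hits_root:
  fixes p :: "real \<Rightarrow> complex"
  assumes p: "path p" and norm_p: "\<And>t. t \<in> {0..1} \<Longrightarrow> norm (p t) = 1"
    and "k > 0" and far: "2 * pi / real k < dist (p 0) (p 1)" and e: "norm e = 1"
  shows "\<exists>t\<in>{0..1}. p t ^ k = e"
proof (rule ccontr)
  assume no: "\<not> ?thesis"
  have cont: "continuous_on {0..1} p" using p by (simp add: path_def)
  obtain g where contg: "continuous_on {0..1} g" and g: "\<And>t. t \<in> {0..1} \<Longrightarrow> p t = exp (g t)"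
    using continuous_logarithm_on_contractible[OF cont]
    by (metis convex_imp_contractible convex_real_interval(5) norm_eq_zero norm_p zero_neq_one)
  define \<phi> where "\<phi> = (\<lambda>t. Im (g t))"
  have Re_g: "Re (g t) = 0" if "t \<in> {0..1}" for t
    using norm_p[OF that] g[OF that] by simp
  have g_eq: "g t = \<i> * of_real (\<phi> t)" if "t \<in> {0..1}" for t
    using Re_g[OF that] by (simp add: \<phi>_def complex_eq_iff)
  define \<beta> where "\<beta> = Arg e"
  have e_eq: "e = exp (\<i> * of_real \<beta>)"
    using e Arg_eq[of e] by (cases "e = 0") (auto simp: \<beta>_def)
  \<comment> \<open>An integer value of \<open>y\<close> at \<open>t\<close> means that
    \<open>p t ^ k = e\<close>.\<close>
  define y where "y = (\<lambda>t. (real k * \<phi> t - \<beta>) / (2 * pi))"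
  have conty: "continuous_on {0..1} y"
    unfolding y_def \<phi>_def by (intro continuous_intros contg) auto
  have noint: "y t \<noteq> of_int m" if "t \<in> {0..1}" for t m
  proof
    assume "y t = of_int m"
    hence "real k * \<phi> t = \<beta> + 2 * pi * of_int m" by (simp add: y_def field_simps)
    moreover have "p t ^ k = exp (\<i> * of_real (real k * \<phi> t))"
      using g[OF that] g_eq[OF that] by (simp add: exp_of_nat_mult[symmetric] mult_ac)
    ultimately have "p t ^ k = exp (\<i> * of_real (\<beta> + 2 * pi * of_int m))" by simp
    also have "\<dots> = e"
      using exp_integer_2pi_plus1 by (simp add: e_eq distrib_left exp_add mult_ac flip: of_int_def)
    finally show False using no that by blast
  qed
  have step: "\<bar>y 0 - y 1\<bar> < 1"
  proof (rule ccontr)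
    assume "\<not> ?thesis"
    then consider "y 0 + 1 \<le> y 1" | "y 1 + 1 \<le> y 0" by linarith
    then obtain m :: int where "(y 0 \<le> of_int m \<and> of_int m \<le> y 1) \<or> (y 1 \<le> of_int m \<and> of_int m \<le> y 0)"
      by cases (meson ceiling_le_iff le_of_int_ceiling of_int_ceiling_le_add_one order_trans)+
    then have "\<exists>t\<in>{0..1}. y t = of_int m"
      using IVT'[of y 0 "of_int m" 1] IVT2'[of y 1 "of_int m" 0] conty by fastforce
    thus False using noint by blast
  qed
  have "dist (p 0) (p 1) = norm (exp (\<i> * of_real (\<phi> 0 - \<phi> 1)) - 1)"
  proof -
    have "p 0 - p 1 = exp (\<i> * of_real (\<phi> 1)) * (exp (\<i> * of_real (\<phi> 0 - \<phi> 1)) - 1)"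
      using g[of 0] g[of 1] g_eq[of 0] g_eq[of 1] by (simp add: algebra_simps flip: exp_add)
    thus ?thesis by (simp add: dist_norm norm_mult)
  qed
  also have "\<dots> \<le> \<bar>\<phi> 0 - \<phi> 1\<bar>"
    using abs_sin_x_le_abs_x[of "(\<phi> 0 - \<phi> 1) / 2"] unfolding dist_exp_i_1 by simp
  also have "\<dots> = 2 * pi / real k * \<bar>y 0 - y 1\<bar>"
    using \<open>k > 0\<close> by (simp add: y_def diff_divide_distrib[symmetric] abs_mult right_diff_distrib[symmetric])
  also have "\<dots> \<le> 2 * pi / real k" using step \<open>k > 0\<close> by (simp add: field_simps)
  finally show False using far by simp
qed

section \<open>Dihedral symmetrization\<close>

text \<open>The modulus of the symmetrization is invariant under the dihedral group of order \<open>2 k\<close>, hence a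
  function of \<open>|z|\<close> and \<open>Re ((sgn z)\<^sup>k)\<close> only. In these coordinates a path crossing a sector of angle
  \<open>\<pi> / k\<close> separates the origin from the circle.\<close>
definition symmetrization :: "nat \<Rightarrow> (complex \<Rightarrow> complex) \<Rightarrow> complex \<Rightarrow> complex" where
  "symmetrization k g z = (\<Prod>\<zeta> | \<zeta> ^ k = 1. g (\<zeta> * z) * cnj (g (cnj (\<zeta> * z))))"

lemma norm_unity_root: "0 < k \<Longrightarrow> (\<zeta>::complex) ^ k = 1 \<Longrightarrow> norm \<zeta> = 1"
  by (metis norm_ge_zero norm_one norm_power power_eq_1_iff of_nat_0_less_iff zero_less_iff_neq_zero)

lemma holomorphic_symmetrization:
  assumes g: "g holomorphic_on ball 0 1" and k: "0 < k"
  shows "symmetrization k g holomorphic_on ball 0 1"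
proof -
  have "(\<lambda>z. g (\<zeta> * z)) holomorphic_on ball 0 1" if "\<zeta> ^ k = 1" for \<zeta>
    using norm_unity_root[OF k that]
    by (intro holomorphic_on_compose_gen[OF _ g, unfolded o_def] holomorphic_intros) (auto simp: norm_mult)
  moreover have "(\<lambda>z. cnj (g (cnj (\<zeta> * z)))) holomorphic_on ball 0 1" if "\<zeta> ^ k = 1" for \<zeta>
  proof -
    have "(cnj \<circ> g \<circ> cnj) holomorphic_on ball 0 1"
      using g by (intro holomorphic_on_compose_cnj_cnj) (auto elim: holomorphic_on_subset)
    then have "(cnj \<circ> g \<circ> cnj) \<circ> (\<lambda>z. \<zeta> * z) holomorphic_on ball 0 1"
      using norm_unity_root[OF k that]
      by (intro holomorphic_on_compose_gen[where t = "ball 0 1" and g = "cnj \<circ> g \<circ> cnj"] holomorphic_intros \<open>cnj \<circ> g \<circ> cnj holomorphic_on ball 0 1\<close>)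
        (auto simp: norm_mult)
    then show ?thesis by (simp add: o_def)
  qed
  ultimately show ?thesis
    unfolding symmetrization_def by (intro holomorphic_intros) auto
qed

lemma norm_symmetrization:
  "norm (symmetrization k g z) = (\<Prod>\<zeta> | \<zeta> ^ k = 1. norm (g (\<zeta> * z)) * norm (g (cnj (\<zeta> * z))))"
  by (simp add: symmetrization_def norm_mult flip: prod_norm)

lemma norm_symmetrization_rotate:
  assumes "0 < k" "\<omega> ^ k = 1"
  shows "norm (symmetrization k g (\<omega> * z)) = norm (symmetrization k g z)"
proof -
  have "\<omega> \<noteq> 0" using assms by (auto simp: power_0_left)
  have bij: "bij_betw (\<lambda>\<zeta>. \<zeta> * \<omega>) {\<zeta>. \<zeta> ^ k = 1} {\<zeta>. \<zeta> ^ k = 1}"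
    by (rule bij_betwI[where g = "\<lambda>\<zeta>. \<zeta> / \<omega>"]) (use assms \<open>\<omega> \<noteq> 0\<close> in \<open>auto simp: power_mult_distrib power_divide\<close>)
  show ?thesis
    unfolding norm_symmetrization
    by (subst prod.reindex_bij_betw[OF bij, symmetric]) (simp add: mult.assoc)
qed

lemma norm_symmetrization_cnj:
  "norm (symmetrization k g (cnj z)) = norm (symmetrization k g z)"
proof -
  have bij: "bij_betw cnj {\<zeta>. \<zeta> ^ k = 1} {\<zeta>. \<zeta> ^ k = 1}"
    by (rule bij_betwI[where g = cnj]) (auto simp flip: complex_cnj_power)
  show ?thesis
    unfolding norm_symmetrization
    by (subst prod.reindex_bij_betw[OF bij, symmetric]) (simp add: mult.commute)
qed

text \<open>Keep only \<open>g z\<close> from the factor of the root 1; everything else is bounded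
  by 1. Hence smallness of \<open>g\<close> passes to the symmetrization, while
  \<open>symmetrization_0\<close> preserves a nonzero value at the origin.\<close>

lemma norm_symmetrization_le:
  assumes k: "0 < k" and z: "norm z < 1" and g: "\<And>z. norm z < 1 \<Longrightarrow> norm (g z) \<le> 1"
  shows "norm (symmetrization k g z) \<le> norm (g z)"
proof -
  have fin: "finite {\<zeta>::complex. \<zeta> ^ k = 1}" using k by (simp add: finite_roots_unity)
  let ?f = "\<lambda>\<zeta>. norm (g (\<zeta> * z)) * norm (g (cnj (\<zeta> * z)))"
  have le1: "?f \<zeta> \<le> 1" if "\<zeta> ^ k = 1" for \<zeta>
    using norm_unity_root[OF k that] z by (intro mult_le_one g) (auto simp: norm_mult)
  have "norm (symmetrization k g z) = ?f 1 * (\<Prod>\<zeta>\<in>{\<zeta>. \<zeta> ^ k = 1} - {1}. ?f \<zeta>)"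
    unfolding norm_symmetrization by (rule prod.remove[OF fin]) simp
  also have "\<dots> \<le> ?f 1 * 1"
    by (intro mult_left_mono prod_le_1) (auto intro!: le1[simplified])
  also have "\<dots> \<le> norm (g z) * 1 * 1" using g[of "cnj z"] z by (intro mult_right_mono) (auto intro!: mult_left_le)
  finally show ?thesis by simp
qed

lemma symmetrization_0: "0 < k \<Longrightarrow> symmetrization k g 0 = 0 \<longleftrightarrow> g 0 = 0"
  unfolding symmetrization_def
  by (subst prod_zero_iff) (auto simp: finite_roots_unity intro: exI[of _ 1])

text \<open>Two points of the unit circle with the same real part are equal or conjugate. Hence
  \<open>z'\<close> is a root of unity times \<open>z\<close> or times \<open>cnj z\<close>, and the
  modulus is invariant under both moves.\<close>

lemma norm_symmetrization_eqI:
  assumes k: "0 < k" and norms: "norm z = norm z'" and "z \<noteq> 0"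
    and re: "Re (sgn z ^ k) = Re (sgn z' ^ k)"
  shows "norm (symmetrization k g z) = norm (symmetrization k g z')"
proof -
  have "z' \<noteq> 0" using assms by auto
  have n1: "norm (sgn z ^ k) = 1" "norm (sgn z' ^ k) = 1"
    using \<open>z \<noteq> 0\<close> \<open>z' \<noteq> 0\<close> by (simp_all add: norm_power norm_sgn)
  have "(Im (sgn z ^ k))\<^sup>2 = (Im (sgn z' ^ k))\<^sup>2"
    using n1 re by (simp add: cmod_def)
  then have "Im (sgn z ^ k) = Im (sgn z' ^ k) \<or> Im (sgn z ^ k) = - Im (sgn z' ^ k)"
    by (simp add: power2_eq_iff)
  then have "sgn z' ^ k = sgn z ^ k \<or> sgn z' ^ k = cnj (sgn z ^ k)"
    using re by (auto simp: complex_eq_iff simp del: complex_cnj_power)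
  moreover have z'eq: "z' = of_real (norm z) * sgn z'" and zeq: "z = of_real (norm z) * sgn z"
    using \<open>z' \<noteq> 0\<close> \<open>z \<noteq> 0\<close> norms by (simp_all add: sgn_eq)
  moreover have "sgn z \<noteq> 0" using \<open>z \<noteq> 0\<close> by (simp add: sgn_zero_iff)
  moreover have ?thesis if "sgn z' ^ k = sgn z ^ k"
  proof -
    have "(sgn z' / sgn z) ^ k = 1" using that \<open>sgn z \<noteq> 0\<close> by (simp add: power_divide)
    from norm_symmetrization_rotate[OF k this, of g z]
    show ?thesis using z'eq zeq \<open>sgn z \<noteq> 0\<close>
      by (metis (no_types, lifting) mult.left_commute nonzero_mult_div_cancel_right times_divide_eq_left)
  qed
  moreover have ?thesis if "sgn z' ^ k = cnj (sgn z ^ k)"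
  proof -
    have "(sgn z' / cnj (sgn z)) ^ k = 1" using that \<open>sgn z \<noteq> 0\<close> by (simp add: power_divide)
    from norm_symmetrization_rotate[OF k this, of g "cnj z"]
    have "norm (symmetrization k g (sgn z' / cnj (sgn z) * cnj z)) = norm (symmetrization k g z)"
      by (simp add: norm_symmetrization_cnj)
    moreover have "cnj z = of_real (norm z) * cnj (sgn z)" using zeq
      by (metis complex_cnj_complex_of_real complex_cnj_mult)
    then have "sgn z' / cnj (sgn z) * cnj z = z'"
      using z'eq \<open>sgn z \<noteq> 0\<close> by (metis (no_types, lifting) complex_cnj_zero_iff mult.commute mult.left_commute nonzero_mult_div_cancel_right times_divide_eq_left)
    ultimately show ?thesis by simp
  qed
  ultimately show ?thesis by blast
qed

lemma dist_sgn: "z \<noteq> 0 \<Longrightarrow> dist (sgn z) z = \<bar>1 - norm z\<bar>" for z :: complex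
proof -
  assume "z \<noteq> 0"
  then have "sgn z - z = of_real (1 - norm z) * sgn z" by (simp add: field_simps sgn_eq)
  then show ?thesis using \<open>z \<noteq> 0\<close> by (metis dist_norm mult.right_neutral norm_mult norm_of_real norm_sgn)
qed

text \<open>Suppose \<open>g 0\<close> is nonzero. By the maximum modulus principle the component of
  the origin in a superlevel set of the symmetrization reaches beyond the arc. In the coordinates
  \<open>norm z\<close> and \<open>Re (sgn z ^ k)\<close>, a path inside this component and a piece
  of the arc cross a rectangle in transverse directions, so they meet (\<open>fashoda\<close>), and
  there the modulus is both large and small. The conclusion at the origin suffices for a
  contradiction when the function has no zeros.\<close>

theorem Koebe_arcs_lemma:
  assumes g: "g holomorphic_on ball 0 1" and g_le: "\<And>z. norm z < 1 \<Longrightarrow> norm (g z) \<le> 1"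
    and d: "d > 0"
    and arcs: "\<And>r \<epsilon>. r < 1 \<Longrightarrow> 0 < \<epsilon> \<Longrightarrow>
      \<exists>\<gamma>. path \<gamma> \<and> path_image \<gamma> \<subseteq> ball 0 1 - cball 0 r \<and>
        (\<forall>z\<in>path_image \<gamma>. norm (g z) \<le> \<epsilon>) \<and> d \<le> dist (pathstart \<gamma>) (pathfinish \<gamma>)"
  shows "g 0 = 0"
proof (rule ccontr)
  assume "g 0 \<noteq> 0"
  \<comment> \<open>Twice the \<open>k\<close> required for endpoints at distance \<open>d\<close>:
    up to half of \<open>d\<close> may be lost when the arc is projected radially to the
    circle.\<close>
  obtain k :: nat where k: "4 * pi / d < real k" using reals_Archimedean2 by blast
  then have k0: "0 < k" using d by (smt (verit) divide_pos_pos of_nat_0_less_iff pi_gt_zero)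
  have kd: "2 * pi / real k < d / 2" using k d k0 by (simp add: field_simps)
  define S where "S = symmetrization k g"
  have holS: "S holomorphic_on ball 0 1" unfolding S_def by (rule holomorphic_symmetrization[OF g k0])
  have S0: "S 0 \<noteq> 0" using \<open>g 0 \<noteq> 0\<close> symmetrization_0[OF k0] by (simp add: S_def)
  define \<epsilon> where "\<epsilon> = norm (S 0) / 2"
  have \<epsilon>: "0 < \<epsilon>" "\<epsilon> < norm (S 0)" using S0 by (auto simp: \<epsilon>_def)
  \<comment> \<open>The bound \<open>1 - d / 8\<close> makes the projection move each point by at
    most \<open>d / 8\<close>; the bound \<open>1/2\<close> keeps the arc away from the
    origin.\<close>
  define r where "r = max (1/2) (1 - d / 8)"
  have r: "1/2 \<le> r" "1 - d / 8 \<le> r" "r < 1" using d by (auto simp: r_def)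
  obtain \<gamma> where \<gamma>: "path \<gamma>" "path_image \<gamma> \<subseteq> ball 0 1 - cball 0 r"
    and g\<gamma>: "\<And>z. z \<in> path_image \<gamma> \<Longrightarrow> norm (g z) \<le> \<epsilon>" and d\<gamma>: "d \<le> dist (pathstart \<gamma>) (pathfinish \<gamma>)"
    using arcs[OF r(3) \<epsilon>(1)] by blast
  have \<gamma>_in: "r < norm (\<gamma> t)" "norm (\<gamma> t) < 1" if "t \<in> {0..1}" for t
    using \<gamma>(2) that by (auto simp: path_image_def image_subset_iff not_le)
  then have \<gamma>_nz: "\<gamma> t \<noteq> 0" if "t \<in> {0..1}" for t using that r by fastforce
  have cont\<gamma>: "continuous_on {0..1} \<gamma>" using \<gamma>(1) by (simp add: path_def)
  define p where "p = (\<lambda>t. sgn (\<gamma> t))"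
  have path_p: "path p"
    unfolding path_def p_def by (intro continuous_intros cont\<gamma>) (use \<gamma>_nz in auto)
  have near: "dist (p t) (\<gamma> t) \<le> d / 8" if "t \<in> {0..1}" for t
    using dist_sgn[OF \<gamma>_nz[OF that]] \<gamma>_in[OF that] r by (simp add: p_def)
  have "d \<le> dist (\<gamma> 0) (\<gamma> 1)" using d\<gamma> by (simp add: pathstart_def pathfinish_def)
  then have "d / 2 \<le> dist (p 0) (p 1)"
    using near[of 0] near[of 1] d dist_triangle[of "\<gamma> 0" "\<gamma> 1" "p 0"] dist_triangle[of "p 0" "\<gamma> 1" "p 1"]
    by (simp add: dist_commute)
  with kd have far: "2 * pi / real k < dist (p 0) (p 1)" by simp
  have np: "norm (p t) = 1" if "t \<in> {0..1}" for t using \<gamma>_nz[OF that] by (simp add: p_def norm_sgn)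
  obtain t1 where t1: "t1 \<in> {0..1}" "p t1 ^ k = -1"
    using circle_path_hits_root[OF path_p np k0 far, of "-1"] by auto
  obtain t2 where t2: "t2 \<in> {0..1}" "p t2 ^ k = 1"
    using circle_path_hits_root[OF path_p np k0 far, of "1"] by auto
  have "compact (path_image \<gamma>)" using \<gamma>(1) by (rule compact_path_image)
  then obtain z1 where z1: "z1 \<in> path_image \<gamma>" "\<And>z. z \<in> path_image \<gamma> \<Longrightarrow> norm z \<le> norm z1"
    using continuous_attains_sup[of "path_image \<gamma>" norm] path_image_nonempty[of \<gamma>]
    by (metis continuous_on_norm_id)
  define R where "R = (1 + norm z1) / 2"
  have z1lt: "norm z1 < 1" "r < norm z1" using \<gamma>(2) z1(1) by auto
  then have R: "norm z1 < R" "R < 1" "r < R" by (auto simp: R_def)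
  define X where "X = {z \<in> ball 0 1. \<epsilon> < norm (S z)}"
  have openX: "open X"
  proof -
    have "continuous_on (ball 0 1) (\<lambda>z. norm (S z))"
      by (intro continuous_intros holomorphic_on_imp_continuous_on holS)
    then have "open (ball 0 1 \<inter> (\<lambda>z. norm (S z)) -` {\<epsilon><..})"
      by (rule continuous_open_preimage) auto
    moreover have "X = ball 0 1 \<inter> (\<lambda>z. norm (S z)) -` {\<epsilon><..}" by (auto simp: X_def)
    ultimately show ?thesis by simp
  qed
  define V where "V = connected_component_set X 0"
  have openV: "open V" unfolding V_def using openX by (rule open_connected_component)
  have V0: "0 \<in> V" using \<epsilon> by (simp add: V_def X_def)
  have VX: "V \<subseteq> X" unfolding V_def by (rule connected_component_subset)
  have connV: "connected V" unfolding V_def by simp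
  \<comment> \<open>Otherwise the closure of \<open>V\<close> is a compact part of the disc and
    \<open>norm (S z) \<le> \<epsilon>\<close> on the frontier, although the modulus at the origin
    is \<open>2 * \<epsilon>\<close>.\<close>
  have "\<exists>w\<in>V. R \<le> norm w"
  proof (rule ccontr)
    assume "\<not> ?thesis"
    then have "V \<subseteq> ball 0 R" by (auto simp: not_le)
    then have clV: "closure V \<subseteq> cball 0 R" by (meson ball_subset_cball closed_cball closure_minimal order_trans)
    also have "\<dots> \<subseteq> ball 0 1" using R by auto
    finally have clV1: "closure V \<subseteq> ball 0 1" .
    have "norm (S 0) \<le> \<epsilon>"
    proof (rule maximum_modulus_frontier[where S = V and f = S and B = \<epsilon> and \<xi> = 0])
      show "S holomorphic_on interior V" "continuous_on (closure V) S"
        using clV1 interior_subset[of V] closure_subset[of V] holS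
        by (meson holomorphic_on_subset holomorphic_on_imp_continuous_on subset_trans)+
      show "bounded V" using clV bounded_cball bounded_subset closure_subset by blast
      show "norm (S z) \<le> \<epsilon>" if "z \<in> frontier V" for z
      proof (rule ccontr)
        assume "\<not> ?thesis"
        moreover have "z \<in> closure V" "z \<notin> V" using that openV by (auto simp: frontier_def interior_open)
        ultimately have "z \<in> X" using clV1 by (auto simp: X_def)
        then have "open (connected_component_set X z)" "z \<in> connected_component_set X z"
          using openX open_connected_component by auto
        then obtain y where "y \<in> V" "y \<in> connected_component_set X z"
          using \<open>z \<in> closure V\<close> by (metis closure_iff_nhds_not_empty disjoint_iff subset_refl)
        then have "z \<in> V" unfolding V_def
          by (metis connected_component_eq connected_component_refl_eq \<open>z \<in> X\<close> mem_Collect_eq)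
        with \<open>z \<notin> V\<close> show False by simp
      qed
    qed (rule V0)
    with \<epsilon> show False by simp
  qed
  then obtain w1 where w1: "w1 \<in> V" "R \<le> norm w1" by blast
  obtain e where e: "e > 0" "ball 0 e \<subseteq> V" using openV V0 open_contains_ball by blast
  \<comment> \<open>The path has to avoid the origin, where \<open>sgn\<close> is discontinuous, so
    it starts at a nonzero point of \<open>V\<close> of modulus at most \<open>r\<close>.\<close>
  define w0 :: complex where "w0 = of_real (min (e / 2) (r / 2))"
  have nw0: "norm w0 = min (e / 2) (r / 2)" unfolding w0_def using e r by (simp add: norm_of_real)
  have w0: "w0 \<in> V - {0}" "norm w0 \<le> r"
    using nw0 e r by (auto intro!: subsetD[OF e(2)] simp: min_def split: if_splits)
  have "path_connected (V - {0})"
    using connected_open_delete[OF openV connV] openV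
    by (metis DIM_complex connected_open_path_connected open_delete order_refl)
  moreover have "w1 \<in> V - {0}" using w1 R r by auto
  ultimately obtain \<mu> where \<mu>: "path \<mu>" "path_image \<mu> \<subseteq> V - {0}" "pathstart \<mu> = w0" "pathfinish \<mu> = w1"
    using w0(1) unfolding path_connected_def by blast
  have \<mu>_nz: "\<mu> t \<noteq> 0" "\<mu> t \<in> V" if "t \<in> {0..1}" for t
    using \<mu>(2) that by (auto simp: path_image_def image_subset_iff)
  \<comment> \<open>\<open>Re (p t ^ k)\<close> is -1 at \<open>t1\<close> and 1 at
    \<open>t2\<close>, so this piece joins the bottom of the rectangle to its top.\<close>
  define \<nu> where "\<nu> = subpath t1 t2 \<gamma>"
  have path_\<nu>: "path \<nu>" unfolding \<nu>_def using \<gamma>(1) t1(1) t2(1) by (rule path_subpath)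
  have \<nu>_sub: "path_image \<nu> \<subseteq> path_image \<gamma>" unfolding \<nu>_def using t1(1) t2(1) by (rule path_image_subpath_subset)
  then have \<nu>_in: "\<nu> t \<in> path_image \<gamma>" if "t \<in> {0..1}" for t using that by (auto simp: path_image_def)
  then have \<nu>_in': "r < norm (\<nu> t)" "norm (\<nu> t) < R" if "t \<in> {0..1}" for t
    using \<gamma>(2) z1(2) R that by fastforce+
  then have \<nu>_nz: "\<nu> t \<noteq> 0" if "t \<in> {0..1}" for t using that r by fastforce
  \<comment> \<open>Clamping the modulus to \<open>{r..R}\<close> keeps the curve in the rectangle.
    At a meeting point the clamp is inactive, because \<open>norm (\<nu> t)\<close> lies strictly
    between \<open>r\<close> and \<open>R\<close>.\<close>
  define x where "x = (\<lambda>t. vector [max r (min R (norm (\<mu> t))), Re (sgn (\<mu> t) ^ k)] :: real^2)"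
  define y where "y = (\<lambda>t. vector [norm (\<nu> t), Re (sgn (\<nu> t) ^ k)] :: real^2)"
  have Re_le: "- 1 \<le> Re (sgn z ^ k) \<and> Re (sgn z ^ k) \<le> 1" for z :: complex
  proof -
    have "norm (sgn z ^ k) \<le> 1" by (simp add: norm_power norm_sgn power_le_one)
    then show ?thesis using abs_Re_le_cmod[of "sgn z ^ k"] by linarith
  qed
  have cont\<mu>: "continuous_on {0..1} \<mu>" and cont\<nu>: "continuous_on {0..1} \<nu>"
    using \<mu>(1) path_\<nu> by (auto simp: path_def)
  have cont_vec: "continuous_on {0..1} (\<lambda>t. vector [f t, h t] :: real^2)"
    if "continuous_on {0..1} f" "continuous_on {0..1} h" for f h :: "real \<Rightarrow> real"
  proof -
    have "(\<lambda>t. vector [f t, h t] :: real^2) = (\<lambda>t. f t *\<^sub>R axis 1 1 + h t *\<^sub>R axis 2 1)"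
      by (auto simp: vec_eq_iff forall_2 axis_def fun_eq_iff)
    then show ?thesis using that by (simp only:) (intro continuous_intros)
  qed
  have "path x" unfolding path_def x_def
    by (intro cont_vec continuous_intros cont\<mu>) (use \<mu>_nz in auto)
  moreover have "path y" unfolding path_def y_def
    by (intro cont_vec continuous_intros cont\<nu>) (use \<nu>_nz in auto)
  moreover have "path_image x \<subseteq> cbox (vector [r, -1]) (vector [R, 1])"
    using Re_le R by (auto simp: path_image_def x_def mem_box_cart forall_2)
  moreover have "path_image y \<subseteq> cbox (vector [r, -1]) (vector [R, 1])"
    using Re_le \<nu>_in' by (force simp: path_image_def y_def mem_box_cart forall_2)
  moreover have "pathstart x $ 1 = (vector [r, -1] :: real^2) $ 1"
    using \<mu>(3) w0 R by (simp add: pathstart_def x_def)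
  moreover have "pathfinish x $ 1 = (vector [R, 1] :: real^2) $ 1"
    using \<mu>(4) w1 R by (simp add: pathfinish_def x_def)
  moreover have "pathstart y $ 2 = (vector [r, -1] :: real^2) $ 2"
    using t1 by (simp add: pathstart_def y_def \<nu>_def subpath_def p_def)
  moreover have "pathfinish y $ 2 = (vector [R, 1] :: real^2) $ 2"
    using t2 by (simp add: pathfinish_def y_def \<nu>_def subpath_def p_def)
  ultimately obtain q where "q \<in> path_image x" "q \<in> path_image y" by (rule fashoda)
  then obtain s t where st: "s \<in> {0..1}" "t \<in> {0..1}" "x s = y t" by (auto simp: path_image_def)
  then have "max r (min R (norm (\<mu> s))) = norm (\<nu> t)" "Re (sgn (\<mu> s) ^ k) = Re (sgn (\<nu> t) ^ k)"
    by (auto simp: x_def y_def vec_eq_iff forall_2)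
  moreover from this have "norm (\<mu> s) = norm (\<nu> t)" using \<nu>_in'[OF st(2)] by linarith
  ultimately have "norm (S (\<mu> s)) = norm (S (\<nu> t))"
    unfolding S_def using norm_symmetrization_eqI[OF k0] \<mu>_nz[OF st(1)] by blast
  also have "\<dots> \<le> norm (g (\<nu> t))"
    unfolding S_def using \<nu>_in'[OF st(2)] R g_le by (intro norm_symmetrization_le k0) auto
  also have "\<dots> \<le> \<epsilon>" using g\<gamma> \<nu>_in st(2) by blast
  finally show False using \<mu>_nz(2)[OF st(1)] VX by (auto simp: X_def)
qed

section \<open>Holomorphic functions on the half plane\<close>

text \<open>A bound for the derivative on a convex set makes the primitive Lipschitz, so
  \<open>G\<close> has a limit at \<open>t\<close> even if \<open>q\<close> has none.\<close>

lemma primitive_boundary_limit: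
  fixes G q :: "complex \<Rightarrow> complex"
  assumes A: "convex A" and G: "\<And>w. w \<in> A \<Longrightarrow> (G has_field_derivative q w) (at w)"
    and t: "t islimpt A" and e: "e > 0" and M: "\<And>w. w \<in> A \<Longrightarrow> dist t w < e \<Longrightarrow> norm (q w) \<le> M"
  obtains l where "(G \<longlongrightarrow> l) (at t within A)"
    "\<And>w. w \<in> A \<Longrightarrow> dist t w < e \<Longrightarrow> dist (G w) l \<le> M * dist w t"
proof -
  let ?X = "A \<inter> ball t e"
  have lip: "dist (G x) (G y) \<le> M * dist x y" if "x \<in> ?X" "y \<in> ?X" for x y
    unfolding dist_norm
    by (rule field_differentiable_bound[where S = ?X and f' = q])
      (use that A M in \<open>auto intro!: convex_Int DERIV_subset[OF G]\<close>)
  obtain y0 where "y0 \<in> ?X" using t e by (auto simp: islimpt_approachable dist_commute)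
  then have "0 \<le> M" using order_trans[OF norm_ge_zero[of "q y0"] M[of y0]] by simp
  have "uniformly_continuous_on ?X G"
    using lip \<open>0 \<le> M\<close>
    by (intro lipschitz_on_uniformly_continuous[of M]) (auto simp: lipschitz_on_def)
  moreover have tX: "t islimpt ?X"
  proof (rule islimptI)
    fix T assume "t \<in> T" "open T"
    then have "t \<in> T \<inter> ball t e" "open (T \<inter> ball t e)" using e by auto
    then obtain y where "y \<in> A" "y \<in> T \<inter> ball t e" "y \<noteq> t" using t by (meson islimptE)
    then show "\<exists>y\<in>?X. y \<in> T \<and> y \<noteq> t" by auto
  qed
  ultimately obtain l where l: "(G \<longlongrightarrow> l) (at t within ?X)"
    using uniformly_continuous_on_extension_at_closure by (metis islimpt_in_closure limpt_of_closure closure_def UnI2 mem_Collect_eq)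
  have eq: "at t within ?X = at t within A"
    by (rule at_within_nhd[where S = "ball t e"]) (use e in auto)
  have "dist (G w) l \<le> M * dist w t" if "w \<in> A" "dist t w < e" for w
  proof (rule tendsto_le)
    show "at t within ?X \<noteq> bot" using tX by (simp add: trivial_limit_within)
    show "((\<lambda>y. dist (G w) (G y)) \<longlongrightarrow> dist (G w) l) (at t within ?X)"
      by (intro tendsto_intros l)
    show "((\<lambda>y. M * dist w y) \<longlongrightarrow> M * dist w t) (at t within ?X)" by (intro tendsto_intros)
    show "\<forall>\<^sub>F y in at t within ?X. dist (G w) (G y) \<le> M * dist w y"
      using that by (auto simp: eventually_at_filter intro!: lip always_eventually)
  qed
  with l show ?thesis using that by (simp add: eq)
qed

lemma islimpt_halfplane: "complex_of_real t islimpt {w. 0 < Im w}" "complex_of_real t islimpt {w. Im w < 0}"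
proof -
  have "\<exists>x'\<in>{w. 0 < Im w}. x' \<noteq> of_real t \<and> dist x' (of_real t) < e" if "e > 0" for e
    using that by (intro bexI[of _ "Complex t (e / 2)"]) (auto simp: dist_norm cmod_def complex_eq_iff)
  then show "complex_of_real t islimpt {w. 0 < Im w}" by (auto simp: islimpt_approachable)
  have "\<exists>x'\<in>{w. Im w < 0}. x' \<noteq> of_real t \<and> dist x' (of_real t) < e" if "e > 0" for e
    using that by (intro bexI[of _ "Complex t (- e / 2)"]) (auto simp: dist_norm cmod_def complex_eq_iff)
  then show "complex_of_real t islimpt {w. Im w < 0}" by (auto simp: islimpt_approachable)
qed

text \<open>Boundary values of \<open>q\<close> and \<open>q2\<close> are not given, only that the
  difference at mirror points tends to 0. Their primitives do extend to the axis, with boundary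
  values that differ by a constant. After a shift they glue to a continuous function that is
  holomorphic off the axis, hence entire, and its derivative is \<open>h\<close>.\<close>

lemma holomorphic_glue_halfplanes:
  assumes q: "q holomorphic_on {w. 0 < Im w}" and q2: "q2 holomorphic_on {w. Im w < 0}"
    and bd: "\<And>t. \<exists>e>0. \<exists>M. \<forall>w. 0 < Im w \<longrightarrow> dist (of_real t) w < e \<longrightarrow> norm (q w) \<le> M"
    and bd2: "\<And>t. \<exists>e>0. \<exists>M. \<forall>w. Im w < 0 \<longrightarrow> dist (of_real t) w < e \<longrightarrow> norm (q2 w) \<le> M"
    and lim: "\<And>t. ((\<lambda>w. q w - q2 (cnj w)) \<longlongrightarrow> 0) (at (of_real t) within {w. 0 < Im w})"
  obtains h where "h holomorphic_on UNIV" "\<And>w. 0 < Im w \<Longrightarrow> h w = q w" "\<And>w. Im w < 0 \<Longrightarrow> h w = q2 w"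
proof -
  let ?U = "{w. 0 < Im w}" and ?D = "{w. Im w < 0}"
  have cvx: "convex ?U" "convex ?D" "open ?U" "open ?D"
    by (auto simp: convex_halfspace_Im_gt convex_halfspace_Im_lt open_halfspace_Im_gt open_halfspace_Im_lt)
  obtain G where G: "\<And>w. w \<in> ?U \<Longrightarrow> (G has_field_derivative q w) (at w)"
    using holomorphic_convex_primitive'[of ?U q] q cvx by (metis at_within_open)
  obtain G2 where G2: "\<And>w. w \<in> ?D \<Longrightarrow> (G2 has_field_derivative q2 w) (at w)"
    using holomorphic_convex_primitive'[of ?D q2] q2 cvx by (metis at_within_open)
  have "\<exists>l e M. e > 0 \<and> (G \<longlongrightarrow> l) (at (of_real t) within ?U) \<and>
      (\<forall>w. 0 < Im w \<longrightarrow> dist (of_real t) w < e \<longrightarrow> dist (G w) l \<le> M * dist w (of_real t))" for t :: real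
  proof -
    obtain e M where e: "e > 0" and M: "\<And>w. w \<in> ?U \<Longrightarrow> dist (of_real t) w < e \<Longrightarrow> norm (q w) \<le> M"
      using bd[of t] by auto
    show ?thesis
      by (rule primitive_boundary_limit[OF cvx(1) G islimpt_halfplane(1)[of t] e M]) (use e in blast)+
  qed
  then obtain l e M where
    l: "\<And>t. e t > 0" "\<And>t. (G \<longlongrightarrow> l t) (at (of_real t) within ?U)"
      "\<And>t w. 0 < Im w \<Longrightarrow> dist (of_real t) w < e t \<Longrightarrow> dist (G w) (l t) \<le> M t * dist w (of_real t)"
    by metis
  have "\<exists>l e M. e > 0 \<and> (G2 \<longlongrightarrow> l) (at (of_real t) within ?D) \<and>
      (\<forall>w. Im w < 0 \<longrightarrow> dist (of_real t) w < e \<longrightarrow> dist (G2 w) l \<le> M * dist w (of_real t))" for t :: real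
  proof -
    obtain e M where e: "e > 0" and M: "\<And>w. w \<in> ?D \<Longrightarrow> dist (of_real t) w < e \<Longrightarrow> norm (q2 w) \<le> M"
      using bd2[of t] by auto
    show ?thesis
      by (rule primitive_boundary_limit[OF cvx(2) G2 islimpt_halfplane(2)[of t] e M]) (use e in blast)+
  qed
  then obtain l2 e2 M2 where
    l2: "\<And>t. e2 t > 0" "\<And>t. (G2 \<longlongrightarrow> l2 t) (at (of_real t) within ?D)"
      "\<And>t w. Im w < 0 \<Longrightarrow> dist (of_real t) w < e2 t \<Longrightarrow> dist (G2 w) (l2 t) \<le> M2 t * dist w (of_real t)"
    by metis
  have shift: "filterlim (\<lambda>y. Complex t y) (at (of_real t) within ?U) (at_right 0)" for t
    by (auto simp: filterlim_at eventually_at_filter complex_eq_iff intro!: tendsto_eq_intros tendsto_Complex)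
  have lU: "((\<lambda>y. G (Complex t y)) \<longlongrightarrow> l t) (at_right 0)" for t
    using filterlim_compose[OF l(2) shift] .
  have shift2: "filterlim (\<lambda>y. Complex t (- y)) (at (of_real t) within ?D) (at_right 0)" for t
    by (auto simp: filterlim_at eventually_at_filter complex_eq_iff intro!: tendsto_eq_intros tendsto_Complex)
  have lD: "((\<lambda>y. G2 (Complex t (- y))) \<longlongrightarrow> l2 t) (at_right 0)" for t
    using filterlim_compose[OF l2(2) shift2] .
  \<comment> \<open>To see that \<open>D\<close> has derivative 0, compare \<open>G\<close> at
    height \<open>s\<close> with \<open>G2\<close> at height \<open>-s\<close>. The horizontal
    derivative of the difference is the difference of \<open>q\<close> and \<open>q2\<close> at
    mirror points, which is small near \<open>t\<close>; then let \<open>s\<close> tend to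
    0.\<close>
  define D where "D = (\<lambda>t. l t - l2 t)"
  have "(D has_vector_derivative 0) (at t)" for t
    unfolding has_vector_derivative_def
  proof (rule has_derivativeI)
    show "bounded_linear (\<lambda>x. x *\<^sub>R (0::complex))" by (simp add: bounded_linear_zero)
    show "((\<lambda>y. (D y - D t - (y - t) *\<^sub>R 0) /\<^sub>R norm (y - t)) \<longlongrightarrow> 0) (at t)"
    proof (rule tendstoI)
      fix \<eta> :: real assume "\<eta> > 0"
      from tendstoD[OF lim[of t], of "\<eta> / 2"] \<open>\<eta> > 0\<close> obtain d where d: "d > 0"
        "\<And>w. 0 < Im w \<Longrightarrow> dist w (of_real t) < d \<Longrightarrow> norm (q w - q2 (cnj w)) < \<eta> / 2"
        by (force simp: eventually_at)
      have bound: "norm (D y - D t) \<le> \<eta> / 2 * \<bar>y - t\<bar>" if "\<bar>y - t\<bar> < d / 2" for y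
      proof (rule tendsto_le)
        show "at_right (0::real) \<noteq> bot" by simp
        show "((\<lambda>s. norm ((G (Complex y s) - G2 (Complex y (-s))) - (G (Complex t s) - G2 (Complex t (-s)))))
           \<longlongrightarrow> norm (D y - D t)) (at_right 0)"
          unfolding D_def by (intro tendsto_intros lU lD)
        show "((\<lambda>s::real. \<eta> / 2 * \<bar>y - t\<bar>) \<longlongrightarrow> \<eta> / 2 * \<bar>y - t\<bar>) (at_right 0)" by simp
        have "norm ((G (Complex y s) - G2 (Complex y (-s))) - (G (Complex t s) - G2 (Complex t (-s)))) \<le> \<eta> / 2 * \<bar>y - t\<bar>"
          if s: "0 < s" "s < d / 2" for s
        proof -
          let ?S = "{min t y..max t y}"
          let ?f = "\<lambda>x. G (Complex x s) - G2 (Complex x (-s))"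
          let ?f' = "\<lambda>x. q (Complex x s) - q2 (Complex x (-s))"
          have der: "(?f has_vector_derivative ?f' x) (at x within ?S)" for x
          proof -
            have "((\<lambda>x. Complex x c) has_vector_derivative 1) (at x within ?S)" for c
              by (auto simp: Complex_eq intro!: derivative_eq_intros)
            from field_vector_diff_chain_within[OF this[of s] DERIV_subset[OF G]]
              field_vector_diff_chain_within[OF this[of "-s"] DERIV_subset[OF G2]]
            show ?thesis using s by (auto intro!: has_vector_derivative_diff simp: o_def)
          qed
          have small: "norm (?f' x) \<le> \<eta> / 2" if "x \<in> ?S" for x
          proof -
            have "dist (Complex x s) (of_real t) \<le> \<bar>x - t\<bar> + \<bar>s\<bar>"
              using cmod_le[of "Complex x s - of_real t"] by (simp add: dist_norm)
            also have "\<dots> < d" using that s \<open>\<bar>y - t\<bar> < d / 2\<close> by (auto simp: min_def max_def split: if_splits)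
            finally show ?thesis using d(2)[of "Complex x s"] s by (simp add: cnj.code less_imp_le)
          qed
          have "norm (?f y - ?f t) \<le> \<eta> / 2 * norm (y - t)"
          proof (rule differentiable_bound[where S = ?S])
            show "(?f has_derivative (\<lambda>h. h *\<^sub>R ?f' x)) (at x within ?S)" for x
              using der by (simp add: has_vector_derivative_def)
            show "onorm (\<lambda>h. h *\<^sub>R ?f' x) \<le> \<eta> / 2" if "x \<in> ?S" for x
              by (rule onorm_le) (use mult_left_mono[OF small[OF that] abs_ge_zero] in \<open>simp add: mult.commute\<close>)
          qed auto
          then show ?thesis by simp
        qed
        then show "\<forall>\<^sub>F s in at_right 0. norm ((G (Complex y s) - G2 (Complex y (-s))) - (G (Complex t s) - G2 (Complex t (-s)))) \<le> \<eta> / 2 * \<bar>y - t\<bar>"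
          using d(1) by (auto simp: eventually_at_right_field intro!: exI[of _ "d/2"])
      qed
      show "\<forall>\<^sub>F y in at t. dist ((D y - D t - (y - t) *\<^sub>R 0) /\<^sub>R norm (y - t)) 0 < \<eta>"
        unfolding eventually_at
      proof (intro exI[of _ "d/2"] conjI ballI impI)
        fix y assume "y \<noteq> t \<and> dist y t < d / 2"
        then have "norm (D y - D t) / \<bar>y - t\<bar> \<le> \<eta> / 2" "y \<noteq> t"
          using bound[of y] by (auto simp: dist_real_def divide_le_eq)
        moreover have "dist ((D y - D t - (y - t) *\<^sub>R 0) /\<^sub>R norm (y - t)) 0 = norm (D y - D t) / \<bar>y - t\<bar>"
          by (simp add: divide_inverse_commute)
        ultimately show "dist ((D y - D t - (y - t) *\<^sub>R 0) /\<^sub>R norm (y - t)) 0 < \<eta>"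
          using \<open>\<eta> > 0\<close> by linarith
      qed (use d in auto)
    qed
  qed
  then obtain c where "\<And>t. D t = c"
    using has_vector_derivative_zero_constant[of UNIV D] by auto
  then have lc: "l t = l2 t + c" for t by (simp add: D_def algebra_simps)
  define f where "f = (\<lambda>w. if 0 < Im w then G w else if Im w < 0 then G2 w + c else l (Re w))"
  have fU: "(f has_field_derivative q w) (at w)" if "0 < Im w" for w
    using that by (intro has_field_derivative_transform_within_open[OF G cvx(3)]) (auto simp: f_def)
  have fD: "(f has_field_derivative q2 w) (at w)" if "Im w < 0" for w
  proof -
    have "((\<lambda>w. G2 w + c) has_field_derivative q2 w) (at w)"
      using DERIV_add[OF G2 DERIV_const[of c]] that by simp
    then show ?thesis
      by (rule has_field_derivative_transform_within_open[OF _ cvx(4)]) (use that in \<open>auto simp: f_def\<close>)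
  qed
  have ll: "dist (l s) (l t) \<le> M t * \<bar>s - t\<bar>" if "\<bar>s - t\<bar> < e t" for s t
  proof (rule tendsto_le)
    show "at_right (0::real) \<noteq> bot" by simp
    show "((\<lambda>y. dist (G (Complex s y)) (l t)) \<longlongrightarrow> dist (l s) (l t)) (at_right 0)"
      by (intro tendsto_intros lU)
    have lim_d: "((\<lambda>y. dist (Complex s y) (of_real t)) \<longlongrightarrow> \<bar>s - t\<bar>) (at_right 0)"
      by (auto intro!: tendsto_eq_intros tendsto_Complex simp: dist_norm cmod_def)
    then show "((\<lambda>y. M t * dist (Complex s y) (of_real t)) \<longlongrightarrow> M t * \<bar>s - t\<bar>) (at_right 0)"
      by (intro tendsto_intros)
    have "\<forall>\<^sub>F y in at_right 0. dist (Complex s y) (of_real t) < e t"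
      using order_tendstoD(2)[OF lim_d that] .
    moreover have "\<forall>\<^sub>F y::real in at_right 0. 0 < y" by (simp add: eventually_at_right_less)
    ultimately show "\<forall>\<^sub>F y in at_right 0. dist (G (Complex s y)) (l t) \<le> M t * dist (Complex s y) (of_real t)"
      by eventually_elim (rule l(3), simp_all add: dist_commute)
  qed
  have "isCont f (of_real t)" for t
  proof -
    define K where "K = \<bar>M t\<bar> + \<bar>M2 t\<bar>"
    define \<delta> where "\<delta> = min (e t) (e2 t)"
    have "\<delta> > 0" using l(1) l2(1) by (simp add: \<delta>_def)
    have near: "dist (f w) (f (of_real t)) \<le> K * dist w (of_real t)" if "dist (of_real t) w < \<delta>" for w
    proof -
      have K: "M t * dist w (of_real t) \<le> K * dist w (of_real t)" "M2 t * dist w (of_real t) \<le> K * dist w (of_real t)"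
        unfolding K_def by (intro mult_right_mono; simp)+
      consider "0 < Im w" | "Im w < 0" | "Im w = 0" by linarith
      then show ?thesis
      proof cases
        case 1 then show ?thesis using l(3)[of w t] that K(1) by (simp add: f_def \<delta>_def)
      next
        case 2 then show ?thesis using l2(3)[of w t] that K(2) by (simp add: f_def \<delta>_def lc)
      next
        case 3
        then have w: "w = of_real (Re w)" by (simp add: complex_eq_iff)
        then have "dist w (of_real t) = \<bar>Re w - t\<bar>" by (metis dist_of_real dist_real_def)
        then show ?thesis using 3 ll[of "Re w" t] that K(1) by (simp add: f_def \<delta>_def dist_commute)
      qed
    qed
    have "((\<lambda>w. dist (f w) (f (of_real t))) \<longlongrightarrow> 0) (at (of_real t))"
    proof (rule tendsto_sandwich[of "\<lambda>_. 0"])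
      show "\<forall>\<^sub>F w in at (of_real t). dist (f w) (f (of_real t)) \<le> K * dist w (of_real t)"
        using near \<open>\<delta> > 0\<close> by (auto simp: eventually_at dist_commute intro!: exI[of _ \<delta>])
      show "((\<lambda>w. K * dist w (of_real t)) \<longlongrightarrow> 0) (at (of_real t))"
        by (auto intro!: tendsto_eq_intros)
    qed auto
    then show ?thesis unfolding isCont_def by (subst tendsto_dist_iff)
  qed
  then have "isCont f w" for w
  proof -
    consider "0 < Im w" | "Im w < 0" | "w = of_real (Re w)" by (force simp: complex_eq_iff)
    then show ?thesis using DERIV_isCont fU fD \<open>\<And>t. isCont f (of_real t)\<close> by cases (blast, blast, metis)
  qed
  then have contf: "continuous_on UNIV f" by (simp add: continuous_at_imp_continuous_on)
  have holf: "f holomorphic_on UNIV"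
    by (rule holomorphic_on_paste_across_line[where d = \<i> and k = 0])
       (use contf fU fD in \<open>auto simp: holomorphic_on_open open_halfspace_Im_gt open_halfspace_Im_lt\<close>)
  show ?thesis
  proof (rule that[of "deriv f"])
    show "deriv f holomorphic_on UNIV" using holf by (intro holomorphic_deriv) auto
  qed (use fU fD in \<open>auto intro: DERIV_imp_deriv\<close>)
qed

text \<open>\<open>exp (\<i> g)\<close> is bounded near the real axis even where no bound for \<open>g\<close> is known, and its modulus
  tends to 1, so it can be glued to its reflection.\<close>
lemma entire_extension_of_vanishing_Im:
  assumes g: "g holomorphic_on {w. 0 < Im w}"
    and lim: "\<And>t. ((\<lambda>w. Im (g w)) \<longlongrightarrow> 0) (at (of_real t) within {w. 0 < Im w})"
  obtains h where "h holomorphic_on UNIV" "\<And>w. 0 < Im w \<Longrightarrow> h w = g w"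
    "\<And>t. Im (h (of_real t)) = 0" "\<And>w. h (cnj w) = cnj (h w)"
proof -
  let ?U = "{w. 0 < Im w}" and ?D = "{w. Im w < 0}"
  define q where "q = (\<lambda>w. exp (\<i> * g w))"
  \<comment> \<open>This is \<open>1 / cnj (q (cnj w))\<close>, the reflection of \<open>q\<close>
    in the unit circle.\<close>
  define q2 where "q2 = (\<lambda>w. exp (\<i> * cnj (g (cnj w))))"
  have holq: "q holomorphic_on ?U" unfolding q_def by (intro holomorphic_intros g)
  have "(cnj \<circ> g \<circ> cnj) holomorphic_on ?D"
    by (intro holomorphic_on_compose_cnj_cnj) (auto intro: holomorphic_on_subset[OF g] simp: open_halfspace_Im_lt)
  then have holq2: "q2 holomorphic_on ?D"
    unfolding q2_def by (intro holomorphic_intros) (simp add: o_def)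
  have nq: "norm (q w) = exp (- Im (g w))" for w by (simp add: q_def)
  have nq2: "norm (q2 (cnj w)) = exp (Im (g w))" for w by (simp add: q2_def)
  have small: "\<exists>e>0. \<forall>w. 0 < Im w \<longrightarrow> dist (of_real t) w < e \<longrightarrow> \<bar>Im (g w)\<bar> < 1" for t
    using tendstoD[OF lim[of t], of 1] by (force simp: eventually_at dist_commute)
  obtain h0 where h0: "h0 holomorphic_on UNIV" "\<And>w. 0 < Im w \<Longrightarrow> h0 w = q w" "\<And>w. Im w < 0 \<Longrightarrow> h0 w = q2 w"
  proof (rule holomorphic_glue_halfplanes[OF holq holq2])
    fix t
    obtain e where e: "e > 0" "\<And>w. 0 < Im w \<Longrightarrow> dist (of_real t) w < e \<Longrightarrow> \<bar>Im (g w)\<bar> < 1"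
      using small by blast
    show "\<exists>e>0. \<exists>M. \<forall>w. 0 < Im w \<longrightarrow> dist (of_real t) w < e \<longrightarrow> norm (q w) \<le> M"
      using e by (intro exI[of _ e] conjI exI[of _ "exp 1"]) (force simp: nq)+
    have "norm (q2 w) \<le> exp 1" if "Im w < 0" "dist (of_real t) w < e" for w
    proof -
      have "dist (of_real t) (cnj w) = dist (of_real t) w"
        by (metis complex_cnj_complex_of_real complex_cnj_diff complex_mod_cnj dist_norm)
      then show ?thesis using e(2)[of "cnj w"] nq2[of "cnj w"] that by simp
    qed
    then show "\<exists>e>0. \<exists>M. \<forall>w. Im w < 0 \<longrightarrow> dist (of_real t) w < e \<longrightarrow> norm (q2 w) \<le> M"
      using e by blast
    have "q w - q2 (cnj w) = exp (\<i> * of_real (Re (g w))) * of_real (exp (- Im (g w)) - exp (Im (g w)))" for w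
    proof -
      have "\<i> * g w = \<i> * of_real (Re (g w)) + of_real (- Im (g w))"
        "\<i> * cnj (g w) = \<i> * of_real (Re (g w)) + of_real (Im (g w))"
        by (simp_all add: complex_eq_iff)
      then show ?thesis unfolding q_def q2_def complex_cnj_cnj
        by (simp only: exp_add exp_of_real right_diff_distrib of_real_diff)
    qed
    then have "norm (q w - q2 (cnj w)) = \<bar>exp (- Im (g w)) - exp (Im (g w))\<bar>" for w
      by (simp only: norm_mult norm_of_real norm_exp_i_times mult_1)
    moreover have "((\<lambda>w. \<bar>exp (- Im (g w)) - exp (Im (g w))\<bar>) \<longlongrightarrow> \<bar>exp (- 0) - exp 0\<bar>) (at (of_real t) within ?U)"
      by (intro tendsto_intros lim)
    ultimately show "((\<lambda>w. q w - q2 (cnj w)) \<longlongrightarrow> 0) (at (of_real t) within ?U)"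
      by (subst tendsto_norm_zero_iff[symmetric]) simp
  qed blast
  have cont_h0: "isCont h0 w" for w
    using holomorphic_on_imp_continuous_on[OF h0(1)] continuous_on_eq_continuous_at[OF open_UNIV] by blast
  have nontriv: "at (complex_of_real t) within ?U \<noteq> bot" for t
    using islimpt_halfplane(1) by (simp add: trivial_limit_within)
  have h0_real: "norm (h0 (of_real t)) = 1" for t
  proof (rule tendsto_unique[OF nontriv])
    show "((\<lambda>w. norm (h0 w)) \<longlongrightarrow> norm (h0 (of_real t))) (at (of_real t) within ?U)"
      using cont_h0[of "of_real t"] by (intro tendsto_norm) (auto simp: isCont_def intro: tendsto_within_subset)
    have "((\<lambda>w. exp (- Im (g w))) \<longlongrightarrow> exp (- 0)) (at (of_real t) within ?U)"
      by (intro tendsto_intros lim)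
    moreover have "\<forall>\<^sub>F w in at (of_real t) within ?U. exp (- Im (g w)) = norm (h0 w)"
      by (auto simp: eventually_at_filter h0 nq)
    ultimately show "((\<lambda>w. norm (h0 w)) \<longlongrightarrow> 1) (at (of_real t) within ?U)"
      by (auto intro: Lim_transform_eventually)
  qed
  \<comment> \<open>Both pieces are exponentials and the modulus on the axis is 1, so
    \<open>h0\<close> has an entire logarithm.\<close>
  have h0_nz: "h0 w \<noteq> 0" for w
  proof -
    consider "0 < Im w" | "Im w < 0" | "w = of_real (Re w)" by (force simp: complex_eq_iff)
    then show ?thesis
      using h0_real[of "Re w"] by cases (auto simp: h0 q_def q2_def)
  qed
  obtain k where k: "k holomorphic_on UNIV" "\<And>w. h0 w = exp (k w)"
    using contractible_imp_holomorphic_log[OF h0(1)] h0_nz by (metis UNIV_I contractible_UNIV)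
  \<comment> \<open>The exponential of \<open>k w - \<i> * g w\<close> is 1 on the half plane;
    differentiating it shows that the exponent has derivative 0.\<close>
  have "\<exists>c. \<forall>w\<in>?U. k w - \<i> * g w = c"
  proof (rule has_field_derivative_zero_constant)
    show "convex ?U" by (simp add: convex_halfspace_Im_gt)
    fix w assume w: "w \<in> ?U"
    let ?d = "deriv k w - \<i> * deriv g w"
    have g': "(g has_field_derivative deriv g w) (at w)"
      using g w by (intro holomorphic_derivI[OF _ open_halfspace_Im_gt]) auto
    have k': "(k has_field_derivative deriv k w) (at w)" using k(1) by (auto intro: holomorphic_derivI)
    have der: "((\<lambda>w. k w - \<i> * g w) has_field_derivative ?d) (at w)"
      by (auto intro!: derivative_eq_intros g' k')
    then have "((\<lambda>w. exp (k w - \<i> * g w)) has_field_derivative exp (k w - \<i> * g w) * ?d) (at w)"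
      by (rule DERIV_fun_exp)
    moreover have "((\<lambda>w. exp (k w - \<i> * g w)) has_field_derivative 0) (at w)"
    proof (rule has_field_derivative_transform_within_open)
      show "((\<lambda>_. 1) has_field_derivative 0) (at w)" by simp
      show "1 = exp (k w - \<i> * g w)" if "w \<in> ?U" for w
        using that h0(2)[of w] k(2)[of w] by (simp add: q_def exp_diff)
    qed (use w open_halfspace_Im_gt in auto)
    ultimately have "exp (k w - \<i> * g w) * ?d = 0" by (rule DERIV_unique)
    then have "?d = 0" by simp
    with der show "((\<lambda>w. k w - \<i> * g w) has_field_derivative 0) (at w within ?U)"
      by (metis DERIV_subset subset_UNIV)
  qed
  then obtain c where c: "\<And>w. 0 < Im w \<Longrightarrow> k w - \<i> * g w = c" by auto
  define h where "h = (\<lambda>w. - \<i> * (k w - c))"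
  have holh: "h holomorphic_on UNIV" unfolding h_def by (intro holomorphic_intros k)
  have h_eq: "h w = g w" if "0 < Im w" for w
  proof -
    have "k w - c = \<i> * g w" using c[OF that] by (simp add: algebra_simps)
    then show ?thesis by (simp add: h_def flip: mult.assoc)
  qed
  have Im_h: "Im (h (of_real t)) = 0" for t
  proof (rule tendsto_unique[OF nontriv])
    have "isCont h (of_real t)"
      using holomorphic_on_imp_continuous_on[OF holh] continuous_on_eq_continuous_at[OF open_UNIV] by blast
    then show "((\<lambda>w. Im (h w)) \<longlongrightarrow> Im (h (of_real t))) (at (of_real t) within ?U)"
      by (intro tendsto_Im) (auto simp: isCont_def intro: tendsto_within_subset)
    show "((\<lambda>w. Im (h w)) \<longlongrightarrow> 0) (at (of_real t) within ?U)"
      by (rule Lim_transform_eventually[OF lim[of t]]) (auto simp: eventually_at_filter h_eq)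
  qed
  \<comment> \<open>On the real axis \<open>h\<close> is real and so agrees with its reflection; the
    identity theorem extends this to the plane.\<close>
  have "h w - cnj (h (cnj w)) = 0" for w
  proof (rule analytic_continuation[where U = "range complex_of_real" and S = UNIV and \<xi> = 0 and f = "\<lambda>w. h w - cnj (h (cnj w))"])
    have "(cnj \<circ> h \<circ> cnj) holomorphic_on UNIV"
      by (intro holomorphic_on_compose_cnj_cnj) (auto intro: holomorphic_on_subset[OF holh])
    then show "(\<lambda>w. h w - cnj (h (cnj w))) holomorphic_on UNIV"
      by (intro holomorphic_intros holh) (simp add: o_def)
    show "h z - cnj (h (cnj z)) = 0" if "z \<in> range complex_of_real" for z
      using that Im_h by (auto simp: complex_eq_iff)
    show "0 islimpt range complex_of_real"
      unfolding islimpt_approachable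
    proof (intro allI impI)
      fix e :: real assume "e > 0"
      then show "\<exists>x'\<in>range complex_of_real. x' \<noteq> 0 \<and> dist x' 0 < e"
        by (intro bexI[of _ "of_real (e / 2)"] rangeI) (simp_all add: norm_divide del: of_real_divide)
    qed
  qed auto
  then have "h (cnj w) = cnj (h w)" for w by (metis complex_cnj_cnj eq_iff_diff_eq_0)
  with holh h_eq Im_h show ?thesis by (rule that)
qed

section \<open>Growth estimates\<close>

text \<open>This is the Schwarz lemma in Cayley coordinates that send \<open>\<i>\<close> and
  \<open>g \<i>\<close> to 0. It bounds \<open>norm (g w - g \<i>)\<close> by
  \<open>2 * Im (g \<i>)\<close> divided by \<open>1 - norm \<zeta>\<close>, where
  \<open>\<zeta>\<close> is the Cayley image of \<open>w\<close>; the denominator is at least half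
  of 1 - |\<zeta>|^2 = 4 Im w / |w + \<i>|^2.\<close>

lemma halfplane_growth:
  assumes g: "g holomorphic_on {w. 0 < Im w}" and pos: "\<And>w. 0 < Im w \<Longrightarrow> 0 < Im (g w)"
    and w: "0 < Im w"
  shows "norm (g w - g \<i>) \<le> Im (g \<i>) * (norm (w + \<i>))\<^sup>2 / Im w"
proof -
  define a where "a = g \<i>"
  have a: "0 < Im a" using pos[of \<i>] by (simp add: a_def)
  have cayley: "norm (z - b) < norm (z - cnj b)" if "0 < Im z" "0 < Im b" for z b
  proof -
    have "(norm (z - cnj b))\<^sup>2 - (norm (z - b))\<^sup>2 = 4 * (Im z * Im b)"
      unfolding cmod_power2 by (simp add: power2_eq_square algebra_simps)
    then have "(norm (z - b))\<^sup>2 < (norm (z - cnj b))\<^sup>2"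
      using mult_pos_pos[OF that] by linarith
    then show ?thesis by (rule power_less_imp_less_base) simp
  qed
  define \<tau> where "\<tau> = (\<lambda>\<zeta>. \<i> * (1 + \<zeta>) / (1 - \<zeta>))"
  have Im_\<tau>: "0 < Im (\<tau> \<zeta>)" if "norm \<zeta> < 1" for \<zeta>
  proof -
    have "1 - \<zeta> \<noteq> 0" using that by auto
    have "(norm \<zeta>)\<^sup>2 < 1" using that by (simp add: power_less_one_iff abs_square_less_1)
    have "Im (\<tau> \<zeta>) = (1 - (norm \<zeta>)\<^sup>2) / (norm (1 - \<zeta>))\<^sup>2"
      unfolding \<tau>_def cmod_power2 by (simp add: Im_divide power2_eq_square algebra_simps)
    then show ?thesis using \<open>(norm \<zeta>)\<^sup>2 < 1\<close> \<open>1 - \<zeta> \<noteq> 0\<close> by simp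
  qed
  define f where "f = (\<lambda>\<zeta>. (g (\<tau> \<zeta>) - a) / (g (\<tau> \<zeta>) - cnj a))"
  have nz: "g (\<tau> \<zeta>) - cnj a \<noteq> 0" if "norm \<zeta> < 1" for \<zeta>
    using pos[OF Im_\<tau>[OF that]] a by (auto simp: complex_eq_iff)
  have hol\<tau>: "\<tau> holomorphic_on ball 0 1"
    unfolding \<tau>_def by (intro holomorphic_intros) auto
  have "(\<lambda>\<zeta>. g (\<tau> \<zeta>)) holomorphic_on ball 0 1"
    using Im_\<tau> by (intro holomorphic_on_compose_gen[OF hol\<tau> g, unfolded o_def]) auto
  then have holf: "f holomorphic_on ball 0 1"
    unfolding f_def using nz by (intro holomorphic_intros) auto
  define \<zeta> where "\<zeta> = (w - \<i>) / (w + \<i>)"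
  have wi: "w + \<i> \<noteq> 0" using w by (auto simp: complex_eq_iff)
  have n\<zeta>: "norm \<zeta> < 1" using cayley[OF w, of \<i>] wi by (simp add: \<zeta>_def norm_divide)
  have \<tau>\<zeta>: "\<tau> \<zeta> = w"
  proof -
    have "1 + \<zeta> = 2 * w / (w + \<i>)" "1 - \<zeta> = 2 * \<i> / (w + \<i>)"
      using wi by (simp_all add: \<zeta>_def field_simps)
    then show ?thesis using wi by (simp add: \<tau>_def)
  qed
  have "norm (f \<zeta>) \<le> norm \<zeta>"
  proof (rule Schwarz_Lemma(1)[OF holf])
    show "f 0 = 0" by (simp add: f_def \<tau>_def a_def)
    show "norm (f z) < 1" if "norm z < 1" for z
      using cayley[OF pos[OF Im_\<tau>[OF that]] a] nz[OF that] by (simp add: f_def norm_divide)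
  qed (rule n\<zeta>)
  then have "norm (g w - a) \<le> norm \<zeta> * norm (g w - cnj a)"
    using nz[OF n\<zeta>] by (simp add: f_def \<tau>\<zeta> norm_divide divide_le_eq)
  also have "norm (g w - cnj a) \<le> norm (g w - a) + 2 * Im a"
  proof -
    have "norm (a - cnj a) = 2 * Im a" using a by (simp add: complex_diff_cnj norm_mult)
    then show ?thesis using norm_triangle_ineq[of "g w - a" "a - cnj a"] by simp
  qed
  finally have "norm (g w - a) \<le> norm \<zeta> * (norm (g w - a) + 2 * Im a)"
    by (simp add: mult_left_mono)
  then have 1: "norm (g w - a) * (1 - norm \<zeta>) \<le> 2 * Im a"
  proof -
    have "norm \<zeta> * (2 * Im a) \<le> 1 * (2 * Im a)" using n\<zeta> a by (intro mult_right_mono) auto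
    moreover have "norm (g w - a) * (1 - norm \<zeta>) = norm (g w - a) - norm \<zeta> * norm (g w - a)"
      by (simp add: algebra_simps)
    ultimately show ?thesis
      using \<open>norm (g w - a) \<le> norm \<zeta> * (norm (g w - a) + 2 * Im a)\<close>
      unfolding distrib_left by linarith
  qed
  have "2 * Im w / (norm (w + \<i>))\<^sup>2 \<le> 1 - norm \<zeta>"
  proof -
    have "(norm (w + \<i>))\<^sup>2 - (norm (w - \<i>))\<^sup>2 = 4 * Im w"
      unfolding cmod_power2 by (simp add: power2_eq_square algebra_simps)
    then have "1 - (norm \<zeta>)\<^sup>2 = 4 * Im w / (norm (w + \<i>))\<^sup>2"
      using wi by (simp add: \<zeta>_def norm_divide power_divide eq_divide_eq left_diff_distrib)
    moreover have "1 - (norm \<zeta>)\<^sup>2 \<le> 2 * (1 - norm \<zeta>)"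
      using zero_le_power2[of "norm \<zeta> - 1"] by (simp add: power2_eq_square algebra_simps)
    ultimately show ?thesis by simp
  qed
  then have "norm (g w - a) * (2 * Im w / (norm (w + \<i>))\<^sup>2) \<le> 2 * Im a"
    using 1 mult_left_mono[of _ _ "norm (g w - a)"] by fastforce
  then show ?thesis using w wi by (simp add: a_def field_simps)
qed

text \<open>Maximum principle for \<open>f(z) (z\<^sup>2 - r\<^sup>2)\<^sup>m\<close>, where \<open>|z\<^sup>2 - r\<^sup>2| = 2 r |Im z|\<close> on \<open>|z| = r\<close>.\<close>
lemma entire_growth_from_halfplane:
  assumes f: "f holomorphic_on UNIV" and sym: "\<And>w. f (cnj w) = cnj (f w)" and m: "m > 0"
    and bound: "\<And>w. 0 < Im w \<Longrightarrow> 1 \<le> norm w \<Longrightarrow> norm (f w) * Im w ^ m \<le> C * norm w ^ (2 * m)"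
    and w: "1 \<le> norm w"
  shows "norm (f w) \<le> C * 8 ^ m * norm w ^ m"
proof -
  \<comment> \<open>With twice the modulus of \<open>w\<close> as radius, |w^2 - r^2| is at least
    r^2 / 2, so the auxiliary factor can be divided out at \<open>w\<close>.\<close>
  define r where "r = 2 * norm w"
  have r: "2 \<le> r" using w by (simp add: r_def)
  have C: "0 \<le> C"
    using order_trans[OF mult_nonneg_nonneg[OF norm_ge_zero, of "Im \<i> ^ m" "f \<i>"] bound[of \<i>]] by simp
  \<comment> \<open>The symmetry covers the lower half plane; on the axis the left side is 0 because
    \<open>m > 0\<close>.\<close>
  have bound': "norm (f z) * \<bar>Im z\<bar> ^ m \<le> C * norm z ^ (2 * m)" if "1 \<le> norm z" for z
  proof -
    consider "0 < Im z" | "Im z < 0" | "Im z = 0" by linarith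
    then show ?thesis
    proof cases
      case 1 then show ?thesis using bound[of z] that by simp
    next
      case 2 then show ?thesis using bound[of "cnj z"] that sym[of z] by simp
    next
      case 3 then show ?thesis using m C by (simp add: power_0_left)
    qed
  qed
  let ?F = "\<lambda>z. f z * (z\<^sup>2 - of_real (r\<^sup>2)) ^ m"
  have "norm (?F w) \<le> 2 ^ m * C * r ^ (3 * m)"
  proof (rule maximum_modulus_frontier[where S = "ball 0 r" and f = ?F])
    show "?F holomorphic_on interior (ball 0 r)" "continuous_on (closure (ball 0 r)) ?F"
      by (intro holomorphic_intros holomorphic_on_imp_continuous_on holomorphic_on_subset[OF f] subset_UNIV)+
    show "w \<in> ball 0 r" using w by (auto simp: r_def)
    show "norm (?F z) \<le> 2 ^ m * C * r ^ (3 * m)" if "z \<in> frontier (ball 0 r)" for z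
    proof -
      have nz: "norm z = r" using that r by simp
      have "z\<^sup>2 - of_real (r\<^sup>2) = z * (z - cnj z)"
        using complex_norm_square[of z] nz by (simp add: power2_eq_square algebra_simps)
      then have "norm (z\<^sup>2 - of_real (r\<^sup>2)) = 2 * r * \<bar>Im z\<bar>"
        using nz by (simp add: norm_mult complex_diff_cnj)
      then have "norm (?F z) = (2 * r) ^ m * (norm (f z) * \<bar>Im z\<bar> ^ m)"
        by (simp add: norm_mult norm_power power_mult_distrib)
      also have "\<dots> \<le> (2 * r) ^ m * (C * r ^ (2 * m))"
        using bound'[of z] nz r by (intro mult_left_mono) auto
      also have "\<dots> = 2 ^ m * C * r ^ (3 * m)"
        by (simp add: power_mult_distrib flip: power_add)
      finally show ?thesis .
    qed
  qed auto
  moreover have "norm (f w) * (r\<^sup>2 / 2) ^ m \<le> norm (?F w)"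
  proof -
    have "r\<^sup>2 / 2 \<le> norm (of_real (r\<^sup>2) :: complex) - norm (w\<^sup>2)"
      by (simp add: r_def norm_power norm_mult power_mult_distrib)
    also have "\<dots> \<le> norm (w\<^sup>2 - of_real (r\<^sup>2))" using norm_triangle_ineq3 norm_minus_commute
      by (metis norm_triangle_ineq2)
    finally show ?thesis by (simp only: norm_mult norm_power) (intro mult_left_mono power_mono; simp)
  qed
  ultimately have "norm (f w) * (r\<^sup>2 / 2) ^ m \<le> 2 ^ m * C * r ^ (3 * m)" by linarith
  also have "\<dots> = (C * 8 ^ m * norm w ^ m) * (r\<^sup>2 / 2) ^ m"
  proof -
    have "2 ^ m * r ^ (3 * m) = (2 * r ^ 3) ^ m" by (simp add: power_mult_distrib power_mult)
    also have "2 * r ^ 3 = 8 * norm w * (r\<^sup>2 / 2)" by (simp add: r_def power2_eq_square power3_eq_cube)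
    finally have "2 ^ m * r ^ (3 * m) = 8 ^ m * norm w ^ m * (r\<^sup>2 / 2) ^ m"
      by (simp only: power_mult_distrib)
    then show ?thesis by (metis (no_types, lifting) mult.assoc mult.commute)
  qed
  finally show ?thesis
    by (rule mult_right_le_imp_le) (use r in simp)
qed

text \<open>Clears the denominator of \<open>halfplane_growth\<close>, which gives the shape that
  \<open>entire_growth_from_halfplane\<close> takes for \<open>m = 1\<close>.\<close>

lemma halfplane_growth_far:
  assumes g: "g holomorphic_on {w. 0 < Im w}" and pos: "\<And>w. 0 < Im w \<Longrightarrow> 0 < Im (g w)"
  obtains C where "C \<ge> 0" "\<And>w. 0 < Im w \<Longrightarrow> 1 \<le> norm w \<Longrightarrow> norm (g w) * Im w \<le> C * norm w ^ 2"
proof -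
  have Imi: "0 < Im (g \<i>)" using pos[of \<i>] by simp
  show ?thesis
  proof (rule that[of "4 * Im (g \<i>) + norm (g \<i>)"])
    fix w assume w: "0 < Im w" "1 \<le> norm w"
    have "norm (w + \<i>) \<le> 2 * norm w" using norm_triangle_ineq[of w \<i>] w(2) by simp
    then have "(norm (w + \<i>))\<^sup>2 \<le> (2 * norm w)\<^sup>2" by (intro power_mono) auto
    then have 1: "Im (g \<i>) * (norm (w + \<i>))\<^sup>2 \<le> Im (g \<i>) * (4 * norm w ^ 2)"
      using Imi by (intro mult_left_mono) (auto simp: power_mult_distrib)
    have "norm (g w - g \<i>) * Im w \<le> Im (g \<i>) * (norm (w + \<i>))\<^sup>2"
      using halfplane_growth[OF g pos w(1)] w(1) by (simp add: le_divide_eq)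
    moreover have "norm (g w) * Im w \<le> (norm (g w - g \<i>) + norm (g \<i>)) * Im w"
      using w(1) norm_triangle_sub[of "g w" "g \<i>"] by (intro mult_right_mono) auto
    moreover have "norm (g \<i>) * Im w \<le> norm (g \<i>) * norm w ^ 2"
    proof (rule mult_left_mono)
      have "Im w \<le> norm w" using abs_Im_le_cmod[of w] by simp
      also have "\<dots> \<le> norm w ^ 2" using w(2) by (intro self_le_power) auto
      finally show "Im w \<le> norm w ^ 2" .
    qed simp
    ultimately show "norm (g w) * Im w \<le> (4 * Im (g \<i>) + norm (g \<i>)) * norm w ^ 2"
      using 1 by (simp add: algebra_simps)
  qed (use Imi in auto)
qed

lemma real_linear_of_growth:
  assumes f: "f holomorphic_on UNIV" and real: "\<And>t. Im (f (of_real t)) = 0"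
    and bd: "\<And>w. 1 \<le> norm w \<Longrightarrow> norm (f w) \<le> B * norm w"
  shows "\<exists>a b::real. \<forall>w. f w = of_real a + of_real b * w"
proof -
  define c where "c = (\<lambda>k. (deriv ^^ k) f 0 / fact k)"
  have f_eq: "f w = c 0 + c 1 * w" for w
    using Liouville_polynomial[OF f, of 1 B 1 w] bd by (simp add: c_def)
  have "Im (c 0) = 0" "Im (c 1) = 0"
    using real[of 0] real[of 1] f_eq[of 0] f_eq[of 1] by auto
  then have "c 0 = of_real (Re (c 0))" "c 1 = of_real (Re (c 1))" by (simp_all add: complex_eq_iff)
  with f_eq show ?thesis by metis
qed

lemma real_quadratic_of_growth:
  assumes f: "f holomorphic_on UNIV" and real: "\<And>t. Im (f (of_real t)) = 0"
    and bd: "\<And>w. 1 \<le> norm w \<Longrightarrow> norm (f w) \<le> B * norm w ^ 2"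
  shows "\<exists>a b c::real. \<forall>w. f w = of_real a + of_real b * w + of_real c * w\<^sup>2"
proof -
  define c where "c = (\<lambda>k. (deriv ^^ k) f 0 / fact k)"
  have f_eq: "f w = c 0 + c 1 * w + c 2 * w\<^sup>2" for w
    using Liouville_polynomial[OF f, of 1 B 2 w] bd by (simp add: c_def numeral_2_eq_2)
  \<comment> \<open>Reality at 0, 1 and -1 separates the three coefficients.\<close>
  have "Im (c 0) = 0" "Im (c 1) = 0" "Im (c 2) = 0"
    using real[of 0] real[of 1] real[of "-1"] f_eq[of 0] f_eq[of 1] f_eq[of "-1"] by auto
  then have "c 0 = of_real (Re (c 0))" "c 1 = of_real (Re (c 1))" "c 2 = of_real (Re (c 2))"
    by (simp_all add: complex_eq_iff)
  with f_eq show ?thesis by metis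
qed

section \<open>Solutions whose coincidence set is closed upwards\<close>

text \<open>The set where the maximum is attained is closed, and it is open by the maximum modulus
  principle for \<open>exp (K z)\<close>, whose modulus is \<open>exp (W z)\<close>. A positive
  maximum keeps this set inside \<open>V\<close>, so it would be a nonempty bounded clopen set in
  the plane.\<close>

lemma weak_maximum_principle:
  fixes W :: "complex \<Rightarrow> real"
  assumes V: "open V" "bounded V" and cont: "continuous_on (closure V) W"
    and local: "\<And>z0. z0 \<in> V \<Longrightarrow> \<exists>r>0. \<exists>K. K holomorphic_on ball z0 r \<and> (\<forall>z\<in>ball z0 r. W z = Re (K z))"
    and le: "\<And>z. z \<in> frontier V \<Longrightarrow> W z \<le> 0" and z: "z \<in> V"
  shows "W z \<le> 0"
proof (rule ccontr)
  assume "\<not> W z \<le> 0"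
  have cpt: "compact (closure V)" using V(2) by (simp add: compact_closure)
  moreover have "closure V \<noteq> {}" using z closure_subset by blast
  ultimately obtain q where q: "q \<in> closure V" "\<And>y. y \<in> closure V \<Longrightarrow> W y \<le> W q"
    using continuous_attains_sup[OF _ _ cont] by blast
  then have pos: "0 < W q" using \<open>\<not> W z \<le> 0\<close> z closure_subset[of V] by fastforce
  define S where "S = {y \<in> closure V. W y = W q}"
  have SV: "S \<subseteq> V"
    using le pos V(1) by (force simp: S_def frontier_def interior_open)
  have "S = closure V \<inter> W -` {W q}" by (auto simp: S_def)
  then have "closed S" using continuous_closed_preimage[OF cont closed_closure closed_singleton] by simp
  moreover have "open S"
  proof (rule openI)
    fix z0 assume z0: "z0 \<in> S"
    obtain r K where r: "r > 0" "K holomorphic_on ball z0 r" "\<And>z. z \<in> ball z0 r \<Longrightarrow> W z = Re (K z)"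
      using local z0 SV by (meson subsetD)
    obtain r' where r': "r' > 0" "ball z0 r' \<subseteq> V" using V(1) z0 SV open_contains_ball by blast
    define B where "B = ball z0 (min r r')"
    have B: "B \<subseteq> ball z0 r" "B \<subseteq> V" "z0 \<in> B" "open B" "connected B"
      using r r' by (auto simp: B_def)
    have "(\<lambda>z. exp (K z)) constant_on B"
    proof (rule maximum_modulus_principle[where \<xi> = z0 and U = B])
      show "(\<lambda>z. exp (K z)) holomorphic_on B"
        by (intro holomorphic_intros holomorphic_on_subset[OF r(2) B(1)])
      show "norm (exp (K z)) \<le> norm (exp (K z0))" if "z \<in> B" for z
      proof -
        have "z \<in> closure V" "W z0 = W q" using that B(2) closure_subset[of V] z0 by (auto simp: S_def)
        then have "W z \<le> W z0" using q(2) by simp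
        then show ?thesis using r(3)[of z] r(3)[of z0] that B(1,3) by (auto simp: subset_iff)
      qed
    qed (use B in auto)
    then have "norm (exp (K z)) = norm (exp (K z0))" if "z \<in> B" for z
      using that B(3) by (metis constant_on_def)
    then have "Re (K z) = Re (K z0)" if "z \<in> B" for z
      using that by simp
    then have "W z = W z0" if "z \<in> B" for z
      using that B(1,3) r(3) by (metis subsetD)
    then have "B \<subseteq> S" using z0 B(2) closure_subset[of V] by (auto simp: S_def)
    then show "\<exists>e>0. ball z0 e \<subseteq> S" using r r' by (auto simp: B_def intro!: exI[of _ "min r r'"])
  qed
  ultimately have "S = {} \<or> S = UNIV" using clopen by blast
  moreover have "q \<in> S" using q by (simp add: S_def)
  ultimately have "bounded (UNIV :: complex set)" using SV V(2) bounded_subset by blast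
  then show False using not_bounded_UNIV by blast
qed

text \<open>\<open>U\<close> is the solution read on \<open>\<complex>\<close>, and \<open>F = 2 (x\<^sub>1 - \<partial>\<^sub>1U) + 2 \<i> \<partial>\<^sub>2U\<close>; in terms of the Schwarz function
  \<open>S = cnj z - 4 \<partial>\<^sub>zU\<close> of the free boundary this is \<open>F = z + S\<close>.\<close>
locale hypograph_solution =
  fixes U :: "complex \<Rightarrow> real" and F :: "complex \<Rightarrow> complex"
  assumes contU: "continuous_on UNIV U" and U_nonneg: "\<And>z. 0 \<le> U z"
    and contF: "continuous_on UNIV F"
    and F_eq: "\<And>z. U z = 0 \<Longrightarrow> F z = of_real (2 * Re z)"
    and Im_F: "\<And>z. Im (F z) \<le> 0"
    and mono: "\<And>x y y'. y \<le> y' \<Longrightarrow> U (Complex x y') \<le> U (Complex x y)"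
    and below: "\<And>z. Im z \<le> 0 \<Longrightarrow> U z = 0 \<longleftrightarrow> z = 0"
    and interior: "interior {z. U z = 0} \<noteq> {}"
    and potential: "\<And>z0. 0 < U z0 \<Longrightarrow> \<exists>r>0. \<exists>K. \<forall>z\<in>ball z0 r.
          (K has_field_derivative F z) (at z) \<and> Re (K z) = (Re z)\<^sup>2 - 2 * U z"
begin

definition "\<Omega> = {z. 0 < U z}"

lemma open_\<Omega>: "open \<Omega>"
  unfolding \<Omega>_def using contU by (intro open_Collect_less) auto

lemma not_\<Omega>: "z \<notin> \<Omega> \<longleftrightarrow> U z = 0"
  using U_nonneg[of z] by (auto simp: \<Omega>_def)

lemma lower_halfplane: "Im z < 0 \<Longrightarrow> z \<in> \<Omega>"
  using below[of z] not_\<Omega>[of z] by auto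

lemma zero_up: "U (Complex x y) = 0 \<Longrightarrow> y \<le> y' \<Longrightarrow> U (Complex x y') = 0"
  using mono[of y y' x] U_nonneg[of "Complex x y'"] by simp

lemma \<Omega>_down: "Complex x y' \<in> \<Omega> \<Longrightarrow> y \<le> y' \<Longrightarrow> Complex x y \<in> \<Omega>"
  using zero_up not_\<Omega> by blast

lemma U_axis: "0 \<le> y \<Longrightarrow> U (Complex 0 y) = 0"
  using zero_up[of 0 0 y] below[of 0] by (simp add: zero_complex.code[symmetric])

lemma local_potential:
  assumes "z0 \<in> \<Omega>"
  shows "\<exists>r>0. \<exists>K. K holomorphic_on ball z0 r \<and> (\<forall>z\<in>ball z0 r. deriv K z = F z) \<and>
    (\<forall>z\<in>ball z0 r. Re (K z) = (Re z)\<^sup>2 - 2 * U z)"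
proof -
  have "0 < U z0" using assms by (simp add: \<Omega>_def)
  from potential[OF this] obtain r K where r: "r > 0" and K: "\<forall>z\<in>ball z0 r.
    (K has_field_derivative F z) (at z) \<and> Re (K z) = (Re z)\<^sup>2 - 2 * U z" by blast
  moreover have "K holomorphic_on ball z0 r"
    using K by (meson holomorphic_on_open open_ball)
  moreover have "\<forall>z\<in>ball z0 r. deriv K z = F z" using K DERIV_imp_deriv by blast
  ultimately show ?thesis by blast
qed

lemma holF: "F holomorphic_on \<Omega>"
proof -
  have "F field_differentiable at z0" if z0: "z0 \<in> \<Omega>" for z0
  proof -
    obtain r K where r: "r > 0" and K: "K holomorphic_on ball z0 r" "\<forall>z\<in>ball z0 r. deriv K z = F z"
      using local_potential[OF z0] by blast
    have "deriv K holomorphic_on ball z0 r" using K(1) holomorphic_deriv open_ball by blast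
    then have "F holomorphic_on ball z0 r" using K(2) by (metis holomorphic_transform)
    then show ?thesis using r holomorphic_on_imp_differentiable_at[OF _ open_ball] centre_in_ball by metis
  qed
  then show ?thesis by (auto simp: holomorphic_on_def intro: field_differentiable_at_within)
qed

text \<open>Compare \<open>U\<close> with the barrier \<open>|z - p|\<^sup>2 / 4\<close>, which has the same Laplacian and vanishes at the
  point \<open>p = (x, h)\<close> where \<open>U\<close> is positive.\<close>
lemma fjord_depth:
  assumes ax: "a < x" "x < b" and zero: "U (Complex a y) = 0" "U (Complex b y) = 0"
    and h: "y < h" "0 < U (Complex x h)" and M: "\<And>s. a \<le> s \<Longrightarrow> s \<le> b \<Longrightarrow> U (Complex s y) \<le> M"
  shows "(h - y)\<^sup>2 \<le> 4 * M"
proof (rule ccontr)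
  assume "\<not> ?thesis"
  then have M4: "M < (h - y)\<^sup>2 / 4" by simp
  define p where "p = Complex x h"
  \<comment> \<open>The box is centred at the height of \<open>p\<close>, so both horizontal sides
    are at distance \<open>h - y\<close> from \<open>p\<close>, where the barrier exceeds
    \<open>M\<close>. On the vertical sides \<open>U\<close> vanishes by monotonicity.\<close>
  define B where "B = {z. a < Re z} \<inter> {z. Re z < b} \<inter> {z. y < Im z} \<inter> {z. Im z < 2 * h - y}"
  define V where "V = \<Omega> \<inter> B"
  define W where "W = (\<lambda>z. U z - (norm (z - p))\<^sup>2 / 4)"
  have "open B" unfolding B_def
    by (intro open_Int open_halfspace_Re_gt open_halfspace_Re_lt open_halfspace_Im_gt open_halfspace_Im_lt)
  then have "open V" unfolding V_def using open_\<Omega> by blast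
  have "B \<subseteq> cbox (Complex a y) (Complex b (2 * h - y))" by (auto simp: B_def in_cbox_complex_iff)
  then have clB: "closure B \<subseteq> cbox (Complex a y) (Complex b (2 * h - y))"
    by (rule closure_minimal) (rule closed_cbox)
  have "bounded V" unfolding V_def using clB bounded_subset[OF bounded_cbox] closure_subset by blast
  have contW: "continuous_on S W" for S
    unfolding W_def by (intro continuous_intros continuous_on_subset[OF contU]) auto
  have "W p \<le> 0"
  proof (rule weak_maximum_principle[OF \<open>open V\<close> \<open>bounded V\<close> contW])
    show "p \<in> V" using assms by (auto simp: V_def B_def p_def \<Omega>_def)
  next
    fix z0 assume "z0 \<in> V"
    then have "z0 \<in> \<Omega>" by (simp add: V_def)
    then obtain r K where r: "r > 0" and holK: "K holomorphic_on ball z0 r"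
      and K: "\<forall>z\<in>ball z0 r. Re (K z) = (Re z)\<^sup>2 - 2 * U z"
      using local_potential by blast
    \<comment> \<open>The term \<open>- K z / 2\<close> has real part \<open>U z\<close> minus half
      the square of \<open>Re z\<close>; the other terms supply the harmonic polynomial (Re z)^2 / 2
      - |z - p|^2 / 4.\<close>
    let ?K = "\<lambda>z. z\<^sup>2 / 4 + z * cnj p / 2 - of_real ((norm p)\<^sup>2 / 4) - K z / 2"
    have "?K holomorphic_on ball z0 r" by (intro holomorphic_intros holK) auto
    moreover have "W z = Re (?K z)" if "z \<in> ball z0 r" for z
    proof -
      have "Re (?K z) = ((Re z)\<^sup>2 - (Im z)\<^sup>2) / 4 + (Re z * Re p + Im z * Im p) / 2
          - ((Re p)\<^sup>2 + (Im p)\<^sup>2) / 4 - ((Re z)\<^sup>2 - 2 * U z) / 2"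
        using K that by (simp add: cmod_power2 Re_power2)
      also have "\<dots> = W z"
        unfolding W_def cmod_power2 by (simp add: power2_eq_square field_simps)
      finally show ?thesis by simp
    qed
    ultimately show "\<exists>r>0. \<exists>K. K holomorphic_on ball z0 r \<and> (\<forall>z\<in>ball z0 r. W z = Re (K z))"
      using r by blast
  next
    fix z assume z: "z \<in> frontier V"
    have "z \<in> closure \<Omega> \<inter> closure B" using z closure_mono[of V \<Omega>] closure_mono[of V B] by (auto simp: frontier_def V_def)
    then have zB: "a \<le> Re z" "Re z \<le> b" "y \<le> Im z" "Im z \<le> 2 * h - y" using clB by (auto simp: in_cbox_complex_iff)
    show "W z \<le> 0"
    proof (cases "U z = 0")
      case True then show ?thesis by (simp add: W_def)
    next
      case False
      have "z \<notin> V" using z \<open>open V\<close> by (simp add: frontier_def interior_open)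
      then have "z \<notin> B" using False not_\<Omega>[of z] by (auto simp: V_def)
      moreover have zc: "z = Complex (Re z) (Im z)" by simp
      moreover have "Re z \<noteq> a" "Re z \<noteq> b" using False zero_up zero zB zc by metis+
      ultimately have "Im z = y \<or> Im z = 2 * h - y" using zB by (auto simp: B_def)
      then have "Im z - h = - (h - y) \<or> Im z - h = h - y" by linarith
      then have "(Im z - h)\<^sup>2 = (h - y)\<^sup>2" by (metis power2_minus)
      then have "(h - y)\<^sup>2 \<le> (norm (z - p))\<^sup>2" by (simp add: cmod_power2 p_def)
      moreover have "U z \<le> M" using mono[OF zB(3), of "Re z"] M[of "Re z"] zB zc by (metis order_trans)
      ultimately show ?thesis using M4 by (simp add: W_def)
    qed
  qed
  then show False using h by (simp add: W_def p_def)
qed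

lemma path_component_vertical:
  assumes "R < \<bar>x\<bar>" "Complex x y \<in> \<Omega>"
  shows "path_component (\<Omega> - cball 0 R) (Complex x y) (Complex x (min y (- R - 1)))"
proof (rule path_component_linepath, rule subsetI)
  fix z assume "z \<in> closed_segment (Complex x y) (Complex x (min y (- R - 1)))"
  then have z: "Re z = x" "Im z \<le> y"
    using closed_segment_same_Re[of "Complex x y" "Complex x (min y (- R - 1))"]
    by (auto simp: closed_segment_eq_real_ivl split: if_splits)
  then have "z = Complex x (Im z)" by (simp add: complex_eq_iff)
  then have "z \<in> \<Omega>" using \<Omega>_down[OF assms(2) z(2)] by simp
  moreover have "R < norm z" using assms(1) z(1) abs_Re_le_cmod[of z] by linarith
  ultimately show "z \<in> \<Omega> - cball 0 R" by simp
qed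

lemma path_component_low:
  assumes "0 \<le> R" "Im z < - R" "Im z' < - R"
  shows "path_component (\<Omega> - cball 0 R) z z'"
proof (rule path_component_linepath, rule subsetI)
  fix w assume "w \<in> closed_segment z z'"
  moreover have "convex {w. Im w < - R}" by (rule convex_halfspace_Im_lt)
  ultimately have "Im w < - R" using assms closed_segment_subset[of z "{w. Im w < - R}" z'] by auto
  then show "w \<in> \<Omega> - cball 0 R" using lower_halfplane[of w] assms(1) abs_Im_le_cmod[of w] by auto
qed

text \<open>Outside the strip of half width \<open>R\<close> one walks straight down, and low points
  are joined inside the lower half plane. A high point of the strip descends by \<open>D\<close> and
  then moves horizontally away from the imaginary axis until it has left the strip. A zero met on
  the way would form, with the zero on the axis, a fjord deeper than \<open>fjord_depth\<close>
  allows.\<close>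

lemma path_component_far:
  assumes R: "0 \<le> R"
  shows "\<exists>R'. \<forall>z\<in>\<Omega>. \<forall>z'\<in>\<Omega>. R' \<le> norm z \<longrightarrow> R' \<le> norm z' \<longrightarrow>
    path_component (\<Omega> - cball 0 R) z z'"
proof -
  let ?S = "\<Omega> - cball 0 R"
  define b where "b = Complex 0 (- R - 1)"
  have "continuous_on {-(R+1)..R+1} (\<lambda>s. U (Complex s 0))"
    by (intro continuous_on_compose2[OF contU] continuous_intros) auto
  then obtain s0 where "\<And>s. - (R + 1) \<le> s \<Longrightarrow> s \<le> R + 1 \<Longrightarrow> U (Complex s 0) \<le> U (Complex s0 0)"
    using continuous_attains_sup[of "{-(R+1)..R+1}" "\<lambda>s. U (Complex s 0)"] R by force
  then obtain M where M: "\<And>s y. - (R + 1) \<le> s \<Longrightarrow> s \<le> R + 1 \<Longrightarrow> 0 \<le> y \<Longrightarrow> U (Complex s y) \<le> M"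
    using mono by (metis order_trans)
  \<comment> \<open>Makes the square of \<open>D\<close> larger than \<open>4 * M\<close>, the bound
    on the squared depth of a fjord.\<close>
  define D where "D = 2 * sqrt (\<bar>M\<bar> + 1)"
  have D: "0 < D" "4 * M < D\<^sup>2" by (auto simp: D_def power_mult_distrib)
  have side: "path_component ?S z b" if "z \<in> \<Omega>" "R < \<bar>Re z\<bar>" for z
    using path_component_trans[OF path_component_vertical[OF that(2), of "Im z"] path_component_low[OF R, of _ b]] that
    by (auto simp: b_def)
  \<comment> \<open>In the strip this radius leaves \<open>R + 1 + D\<close> for
    \<open>\<bar>Im z\<bar>\<close>, so a descent by \<open>D\<close> still ends above height
    \<open>R\<close>.\<close>
  have "path_component ?S z b" if z: "z \<in> \<Omega>" "R + (R + 1 + D) \<le> norm z" for z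
  proof (cases "R < \<bar>Re z\<bar>")
    case True with side z show ?thesis by blast
  next
    case False
    then have far: "R + 1 + D \<le> \<bar>Im z\<bar>" using z(2) cmod_le[of z] by linarith
    show ?thesis
    proof (cases "Im z < 0")
      case True
      then show ?thesis using far D R by (intro path_component_low) (auto simp: b_def)
    next
      case im: False
      define x h y where "x = Re z" and "h = Im z" and "y = h - D"
      have zc: "z = Complex x h" by (simp add: x_def h_def)
      have y: "R < y" "y < h" using far im D by (auto simp: y_def h_def)
      have "x \<noteq> 0" using U_axis[of h] y R z(1) zc by (auto simp: \<Omega>_def)
      define e where "e = sgn x * (R + 1)"
      have e: "\<bar>e\<bar> = R + 1" using R \<open>x \<noteq> 0\<close> by (simp add: e_def abs_mult)
      have horiz: "Complex s y \<in> \<Omega>" if s: "s \<in> closed_segment x e" for s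
      proof (rule ccontr)
        assume "Complex s y \<notin> \<Omega>"
        then have s0: "U (Complex s y) = 0" by (simp add: not_\<Omega>)
        have "s \<noteq> x" using zero_up[OF s0, of h] y z(1) zc by (auto simp: \<Omega>_def)
        have "(h - y)\<^sup>2 \<le> 4 * M"
        proof (cases "0 < x")
          case True
          then have "x < s" "s \<le> R + 1" using s \<open>s \<noteq> x\<close> False
            by (auto simp: e_def x_def closed_segment_eq_real_ivl split: if_splits)
          then show ?thesis
            using z(1) zc y R True M s0 U_axis[of y] by (intro fjord_depth[of 0 x s]) (auto simp: \<Omega>_def)
        next
          case neg: False
          then have "s < x" "- (R + 1) \<le> s" using s \<open>s \<noteq> x\<close> \<open>x \<noteq> 0\<close> False
            by (auto simp: e_def x_def closed_segment_eq_real_ivl split: if_splits)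
          then show ?thesis
            using z(1) zc y R neg \<open>x \<noteq> 0\<close> M s0 U_axis[of y] by (intro fjord_depth[of s x 0]) (auto simp: \<Omega>_def)
        qed
        then show False using D by (simp add: y_def)
      qed
      have "path_component ?S (Complex x h) (Complex x y)"
      proof (rule path_component_linepath, rule subsetI)
        fix w assume "w \<in> closed_segment (Complex x h) (Complex x y)"
        then have w: "w = Complex x (Im w)" "y \<le> Im w" "Im w \<le> h" using y(2)
          by (auto simp: closed_segment_same_Re closed_segment_eq_real_ivl complex_eq_iff split: if_splits)
        then have "w \<in> \<Omega>" using \<Omega>_down[of x h "Im w"] z(1) zc by metis
        then show "w \<in> ?S" using w(2) y(1) abs_Im_le_cmod[of w] by auto
      qed
      moreover have "path_component ?S (Complex x y) (Complex e y)"
      proof (rule path_component_linepath, rule subsetI)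
        fix w assume "w \<in> closed_segment (Complex x y) (Complex e y)"
        then have w: "w = Complex (Re w) y" "Re w \<in> closed_segment x e"
          by (auto simp: closed_segment_same_Im complex_eq_iff)
        then have "w \<in> \<Omega>" using horiz by metis
        moreover have "Im w = y" using w(1) by (metis complex.sel(2))
        ultimately show "w \<in> ?S" using y(1) abs_Im_le_cmod[of w] by auto
      qed
      moreover have "path_component ?S (Complex e y) b"
        using horiz[of e] e by (intro side) auto
      ultimately show ?thesis unfolding zc by (meson path_component_trans)
    qed
  qed
  then have "path_component ?S z z'"
    if "z \<in> \<Omega>" "z' \<in> \<Omega>" "R + (R + 1 + D) \<le> norm z" "R + (R + 1 + D) \<le> norm z'" for z z'
    using that path_component_trans path_component_sym by metis
  then show ?thesis by blast
qed

lemma connected_\<Omega>: "connected \<Omega>"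
proof -
  have "path_component \<Omega> z (-\<i>)" if "z \<in> \<Omega>" for z
  proof (rule path_component_trans)
    let ?z = "Complex (Re z) (min (Im z) (-1))"
    show "path_component \<Omega> z ?z"
    proof (rule path_component_linepath, rule subsetI)
      fix w assume "w \<in> closed_segment z ?z"
      then have "w = Complex (Re z) (Im w)" "Im w \<le> Im z"
        by (auto simp: closed_segment_same_Re closed_segment_eq_real_ivl complex_eq_iff split: if_splits)
      then show "w \<in> \<Omega>" using \<Omega>_down[of "Re z" "Im z" "Im w"] that by (metis complex_surj)
    qed
    show "path_component \<Omega> ?z (-\<i>)"
    proof (rule path_component_linepath, rule subsetI)
      fix w assume "w \<in> closed_segment ?z (-\<i>)"
      then have "Im w < 0"
        using closed_segment_subset[OF _ _ convex_halfspace_Im_lt[of 0], of ?z "-\<i>"]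
        by (auto simp: min_less_iff_disj)
      then show "w \<in> \<Omega>" by (rule lower_halfplane)
    qed
  qed
  then have "path_connected \<Omega>"
    unfolding path_connected_component by (meson path_component_sym path_component_trans)
  then show ?thesis by (rule path_connected_imp_connected)
qed

text \<open>The complement is closed under moving upwards, so each of its components contains
  arbitrarily long vertical segments and is unbounded.\<close>

lemma simply_connected_\<Omega>: "simply_connected \<Omega>"
proof -
  have "\<not> bounded c" if c: "c \<in> components (- \<Omega>)" for c
  proof
    assume "bounded c"
    then obtain B where B: "\<And>z. z \<in> c \<Longrightarrow> norm z \<le> B" by (auto simp: bounded_iff)
    obtain z where z: "z \<in> c" "z \<in> - \<Omega>" using c in_components_nonempty in_components_subset by blast
    let ?y = "max (Im z) (B + 1)"
    let ?s = "closed_segment z (Complex (Re z) ?y)"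
    have "?s \<subseteq> - \<Omega>"
    proof
      fix w assume "w \<in> ?s"
      then have w: "w = Complex (Re z) (Im w)" "Im z \<le> Im w"
        by (auto simp: closed_segment_same_Re closed_segment_eq_real_ivl complex_eq_iff split: if_splits)
      have "Complex (Re z) (Im w) \<notin> \<Omega>" using \<Omega>_down[of "Re z" "Im w" "Im z"] w(2) z(2) by auto
      then show "w \<in> - \<Omega>" using w(1) by (metis ComplI)
    qed
    moreover have "z \<in> ?s" by simp
    ultimately have "?s \<subseteq> c" using components_maximal[OF c, of ?s] z(1) by (metis IntI connected_segment(1) empty_iff)
    then have "Complex (Re z) ?y \<in> c" by (meson ends_in_segment(2) subsetD)
    from B[OF this] abs_Im_le_cmod[of "Complex (Re z) ?y"] show False by simp
  qed
  then show ?thesis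
    using connected_\<Omega> simply_connected_eq_unbounded_complement_components[OF open_\<Omega>] by blast
qed

end

section \<open>The Riemann map and its boundary behaviour\<close>

context hypograph_solution begin

lemma exists_riemann_map:
  "\<exists>f g. f holomorphic_on \<Omega> \<and> g holomorphic_on ball 0 1 \<and>
    (\<forall>z\<in>\<Omega>. f z \<in> ball 0 1 \<and> g (f z) = z) \<and> (\<forall>z\<in>ball 0 1. g z \<in> \<Omega> \<and> f (g z) = z)"
proof -
  have "\<Omega> \<noteq> {}" using lower_halfplane[of "-\<i>"] by auto
  moreover have "\<Omega> \<noteq> UNIV" using below[of 0] not_\<Omega>[of 0] by auto
  ultimately show ?thesis
    using Riemann_mapping_theorem[of \<Omega>] open_\<Omega> simply_connected_\<Omega> by blast
qed

text \<open>If arbitrarily far points had images at distance \<open>d\<close> or more, joining them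
  far away by \<open>path_component_far\<close> would give arcs near the unit circle on which
  \<open>G\<close> is small. Koebe's lemma then yields \<open>G 0 = 0\<close>, but \<open>G\<close>
  has no zeros. So the images of far points satisfy a Cauchy condition.\<close>

lemma riemann_map_limit_at_infinity:
  assumes f: "f holomorphic_on \<Omega>" and g: "g holomorphic_on ball 0 1"
    and f_in: "\<And>z. z \<in> \<Omega> \<Longrightarrow> norm (f z) < 1" and gf: "\<And>z. z \<in> \<Omega> \<Longrightarrow> g (f z) = z"
    and g_in: "\<And>z. norm z < 1 \<Longrightarrow> g z \<in> \<Omega>" and fg: "\<And>z. norm z < 1 \<Longrightarrow> f (g z) = z"
  shows "\<exists>\<zeta>. norm \<zeta> = 1 \<and> (\<forall>d>0. \<exists>R. \<forall>z\<in>\<Omega>. R \<le> norm z \<longrightarrow> dist (f z) \<zeta> < d)"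
proof -
  \<comment> \<open>An interior point of the coincidence set has distance at least
    \<open>\<delta>\<close> from \<open>\<Omega>\<close>; this bounds \<open>G\<close> by 1.\<close>
  obtain p \<delta> where \<delta>: "\<delta> > 0" and p: "ball p \<delta> \<subseteq> {z. U z = 0}"
    using interior by (metis all_not_in_conv mem_interior)
  have far_p: "\<delta> \<le> norm (z - p)" if "z \<in> \<Omega>" for z
    using p that by (force simp: \<Omega>_def dist_norm norm_minus_commute not_le[symmetric])
  define G where "G = (\<lambda>\<zeta>. of_real \<delta> / (g \<zeta> - p))"
  have nz: "g \<zeta> - p \<noteq> 0" if "norm \<zeta> < 1" for \<zeta> using far_p[OF g_in[OF that]] \<delta> by auto
  have holG: "G holomorphic_on ball 0 1"
    unfolding G_def using nz by (intro holomorphic_intros g) auto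
  have G_le: "norm (G \<zeta>) \<le> 1" if "norm \<zeta> < 1" for \<zeta>
    using far_p[OF g_in[OF that]] \<delta> by (simp add: G_def norm_divide divide_le_eq)
  have contf: "continuous_on \<Omega> f" and contg: "continuous_on (ball 0 1) g"
    using f g by (auto intro: holomorphic_on_imp_continuous_on)
  have cauchy: "\<exists>R. \<forall>z\<in>\<Omega>. \<forall>z'\<in>\<Omega>. R \<le> norm z \<longrightarrow> R \<le> norm z' \<longrightarrow> dist (f z) (f z') < d"
    if d: "d > 0" for d
  proof (rule ccontr)
    assume neg: "\<not> ?thesis"
    have "G 0 = 0"
    proof (rule Koebe_arcs_lemma[OF holG G_le d])
      fix r \<epsilon> :: real assume r: "r < 1" and \<epsilon>: "\<epsilon> > 0"
      have "compact (g ` cball 0 r)"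
        by (intro compact_continuous_image continuous_on_subset[OF contg]) (use r in auto)
      then obtain R0 where R0: "\<And>z. norm z \<le> r \<Longrightarrow> norm (g z) \<le> R0"
        using compact_imp_bounded bounded_iff by (metis (no_types, lifting) dist_0_norm image_eqI mem_cball)
      \<comment> \<open>\<open>R0\<close> pushes the image arc out of \<open>cball 0 r\<close>, and
        \<open>\<delta> / \<epsilon> + norm p\<close> makes \<open>norm (G w)\<close> at most
        \<open>\<epsilon>\<close> on it.\<close>
      define R where "R = max 0 (max R0 (\<delta> / \<epsilon> + norm p))"
      obtain R' where R': "\<forall>z\<in>\<Omega>. \<forall>z'\<in>\<Omega>. R' \<le> norm z \<longrightarrow> R' \<le> norm z' \<longrightarrow>
          path_component (\<Omega> - cball 0 R) z z'"
        using path_component_far[of R] by (auto simp: R_def)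
      obtain z z' where z: "z \<in> \<Omega>" "z' \<in> \<Omega>" "R' \<le> norm z" "R' \<le> norm z'" "d \<le> dist (f z) (f z')"
        using neg by (meson not_le)
      then obtain c where c: "path c" "path_image c \<subseteq> \<Omega> - cball 0 R" "pathstart c = z" "pathfinish c = z'"
        using R' unfolding path_component_def by blast
      have "path (f \<circ> c)"
        using c by (intro path_continuous_image continuous_on_subset[OF contf]) auto
      moreover have "path_image (f \<circ> c) \<subseteq> ball 0 1 - cball 0 r"
      proof
        fix w assume "w \<in> path_image (f \<circ> c)"
        then obtain y where y: "y \<in> path_image c" "w = f y" by (auto simp: path_image_compose)
        then have "y \<in> \<Omega>" "R < norm y" using c(2) by auto
        then have "R0 < norm (g w)" "norm w < 1" using gf f_in y by (auto simp: R_def)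
        then show "w \<in> ball 0 1 - cball 0 r" using R0[of w] by auto
      qed
      moreover have "norm (G w) \<le> \<epsilon>" if w: "w \<in> path_image (f \<circ> c)" for w
      proof -
        obtain y where y: "y \<in> path_image c" "w = f y" using w by (auto simp: path_image_compose)
        then have "y \<in> \<Omega>" "R < norm y" using c(2) by auto
        then have "\<delta> / \<epsilon> < norm (y - p)" "G w = of_real \<delta> / (y - p)"
          using gf y norm_triangle_ineq2[of y p] by (auto simp: G_def R_def)
        moreover have "0 < \<delta> / \<epsilon>" using \<delta> \<epsilon> by simp
        ultimately have "0 < norm (y - p)" "\<delta> < \<epsilon> * norm (y - p)" "norm (G w) = \<delta> / norm (y - p)"
          using \<delta> \<epsilon> by (auto simp: norm_divide divide_less_eq mult.commute)
        then show ?thesis by (simp add: divide_le_eq)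
      qed
      moreover have "d \<le> dist (pathstart (f \<circ> c)) (pathfinish (f \<circ> c))"
        using c z by (simp add: pathstart_compose pathfinish_compose)
      ultimately show "\<exists>\<gamma>. path \<gamma> \<and> path_image \<gamma> \<subseteq> ball 0 1 - cball 0 r \<and>
        (\<forall>z\<in>path_image \<gamma>. norm (G z) \<le> \<epsilon>) \<and> d \<le> dist (pathstart \<gamma>) (pathfinish \<gamma>)" by blast
    qed
    then show False using nz[of 0] \<delta> by (simp add: G_def)
  qed
  \<comment> \<open>One sequence going to infinity in the lower half plane identifies the limit; the
    Cauchy condition carries it over to all of \<open>\<Omega>\<close>.\<close>
  define s where "s = (\<lambda>n::nat. - \<i> * of_nat (Suc n))"
  have s: "s n \<in> \<Omega>" "norm (s n) = real (Suc n)" for n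
    using lower_halfplane[of "s n"] by (auto simp: s_def norm_mult simp del: of_nat_Suc)
  have "Cauchy (\<lambda>n. f (s n))"
  proof (rule metric_CauchyI)
    fix d :: real assume "d > 0"
    then obtain R where R: "\<And>z z'. z \<in> \<Omega> \<Longrightarrow> z' \<in> \<Omega> \<Longrightarrow> R \<le> norm z \<Longrightarrow> R \<le> norm z' \<Longrightarrow> dist (f z) (f z') < d"
      using cauchy by blast
    obtain M :: nat where M: "R \<le> real M" using real_arch_simple by blast
    have "dist (f (s m)) (f (s n)) < d" if "M \<le> m" "M \<le> n" for m n
      by (rule R) (use M that s in auto)
    then show "\<exists>M. \<forall>m\<ge>M. \<forall>n\<ge>M. dist (f (s m)) (f (s n)) < d" by blast
  qed
  then obtain \<zeta> where \<zeta>: "(\<lambda>n. f (s n)) \<longlonglongrightarrow> \<zeta>" by (meson Cauchy_convergent_iff convergent_def)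
  have le1: "norm \<zeta> \<le> 1"
    by (rule LIMSEQ_le_const2[OF tendsto_norm[OF \<zeta>]]) (use f_in s in \<open>auto intro: less_imp_le\<close>)
  \<comment> \<open>At an interior limit \<open>g\<close> would be continuous, so the unbounded
    sequence \<open>s\<close> would converge to \<open>g \<zeta>\<close>.\<close>
  have "\<not> norm \<zeta> < 1"
  proof
    assume "norm \<zeta> < 1"
    then have "isCont g \<zeta>" using contg by (simp add: continuous_on_eq_continuous_at)
    then have "(\<lambda>n. g (f (s n))) \<longlonglongrightarrow> g \<zeta>" using \<zeta> by (rule isCont_tendsto_compose)
    then have "(\<lambda>n. s n) \<longlonglongrightarrow> g \<zeta>" using gf s by simp
    then have "Bseq s" by (rule convergentI[THEN convergent_imp_Bseq])
    then obtain K where "\<And>n. norm (s n) \<le> K" by (auto simp: Bseq_def)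
    moreover obtain n :: nat where "K < real n" using reals_Archimedean2 by blast
    ultimately show False using s(2)[of n] by (smt (verit) of_nat_Suc)
  qed
  with le1 have "norm \<zeta> = 1" by simp
  moreover have "\<exists>R. \<forall>z\<in>\<Omega>. R \<le> norm z \<longrightarrow> dist (f z) \<zeta> < d" if "d > 0" for d
  proof -
    obtain R where R: "\<And>z z'. z \<in> \<Omega> \<Longrightarrow> z' \<in> \<Omega> \<Longrightarrow> R \<le> norm z \<Longrightarrow> R \<le> norm z' \<Longrightarrow> dist (f z) (f z') < d / 2"
      using cauchy[of "d / 2"] \<open>d > 0\<close> by auto
    obtain M :: nat where M: "R \<le> real M" using real_arch_simple by blast
    have "dist (f z) \<zeta> < d" if z: "z \<in> \<Omega>" "R \<le> norm z" for z
    proof -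
      have "dist (f z) \<zeta> \<le> d / 2"
      proof (rule LIMSEQ_le_const2)
        show "(\<lambda>n. dist (f z) (f (s n))) \<longlonglongrightarrow> dist (f z) \<zeta>" by (intro tendsto_intros \<zeta>)
        have "dist (f z) (f (s n)) \<le> d / 2" if "M \<le> n" for n
          using R[OF z(1) s(1) z(2), of n] s(2)[of n] M that by simp
        then show "\<exists>N. \<forall>n\<ge>N. dist (f z) (f (s n)) \<le> d / 2" by blast
      qed
      then show ?thesis using \<open>d > 0\<close> by simp
    qed
    then show ?thesis by blast
  qed
  ultimately show ?thesis by blast
qed

text \<open>The last conjunct encodes that \<open>\<Psi>\<close> maps only \<open>\<infinity>\<close> to \<open>\<infinity>\<close>: near a finite boundary point \<open>\<Psi>\<close> is
  bounded and approaches the coincidence set.\<close>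
lemma exists_halfplane_map:
  "\<exists>\<Psi>. \<Psi> holomorphic_on {w. 0 < Im w} \<and> (\<forall>w. 0 < Im w \<longrightarrow> \<Psi> w \<in> \<Omega>) \<and>
    (\<forall>z\<in>\<Omega>. \<exists>w. 0 < Im w \<and> \<Psi> w = z) \<and>
    (\<forall>T t. continuous_on UNIV T \<longrightarrow> (\<forall>z. U z = 0 \<longrightarrow> T z = (0::real)) \<longrightarrow>
        ((\<lambda>w. T (\<Psi> w)) \<longlongrightarrow> 0) (at (of_real t) within {w. 0 < Im w}))"
proof -
  obtain f g where f: "f holomorphic_on \<Omega>" and g: "g holomorphic_on ball 0 1"
    and "\<forall>z\<in>\<Omega>. f z \<in> ball 0 1 \<and> g (f z) = z" "\<forall>z\<in>ball 0 1. g z \<in> \<Omega> \<and> f (g z) = z"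
    using exists_riemann_map by blast
  then have f_in: "\<And>z. z \<in> \<Omega> \<Longrightarrow> norm (f z) < 1" and gf: "\<And>z. z \<in> \<Omega> \<Longrightarrow> g (f z) = z"
    and g_in: "\<And>z. norm z < 1 \<Longrightarrow> g z \<in> \<Omega>" and fg: "\<And>z. norm z < 1 \<Longrightarrow> f (g z) = z"
    by auto
  obtain \<zeta> where \<zeta>: "norm \<zeta> = 1"
    and lim: "\<forall>d>0. \<exists>R. \<forall>z\<in>\<Omega>. R \<le> norm z \<longrightarrow> dist (f z) \<zeta> < d"
    using riemann_map_limit_at_infinity[OF f g f_in gf g_in fg] by blast
  have \<zeta>0: "\<zeta> \<noteq> 0" using \<zeta> by auto
  \<comment> \<open>A Cayley map rotated so that infinity corresponds to \<open>\<zeta>\<close>; no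
    finite point of the closed half plane is sent there.\<close>
  define \<tau> where "\<tau> = (\<lambda>w. \<zeta> * ((w - \<i>) / (w + \<i>)))"
  have wi: "w + \<i> \<noteq> 0" if "0 \<le> Im w" for w using that by (auto simp: complex_eq_iff)
  have dist_i: "(norm (w + \<i>))\<^sup>2 - (norm (w - \<i>))\<^sup>2 = 4 * Im w" for w
    unfolding cmod_power2 by (simp add: power2_eq_square algebra_simps)
  have \<tau>_in: "norm (\<tau> w) < 1" if "0 < Im w" for w
  proof -
    have "(norm (w - \<i>))\<^sup>2 < (norm (w + \<i>))\<^sup>2" using dist_i[of w] that by linarith
    then have "norm (w - \<i>) < norm (w + \<i>)" by (rule power_less_imp_less_base) simp
    then show ?thesis using wi[of w] that by (simp add: \<tau>_def norm_mult norm_divide \<zeta>)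
  qed
  have \<tau>_real: "norm (\<tau> (of_real t)) = 1" for t
  proof -
    have "(norm (of_real t - \<i>))\<^sup>2 = (norm (of_real t + \<i>))\<^sup>2" using dist_i[of "of_real t"] by simp
    then have "norm (of_real t - \<i>) = norm (of_real t + \<i>)" by (rule power2_eq_imp_eq) auto
    then show ?thesis using wi[of "of_real t"] by (simp add: \<tau>_def norm_mult norm_divide \<zeta>)
  qed
  have \<tau>_ne: "\<tau> w \<noteq> \<zeta>" if "0 \<le> Im w" for w
  proof
    assume "\<tau> w = \<zeta>"
    then have "\<zeta> * (w - \<i>) = \<zeta> * (w + \<i>)" using wi[OF that] by (simp add: \<tau>_def divide_eq_eq)
    then show False using \<zeta>0 by (simp add: complex_eq_iff)
  qed
  have hol\<tau>: "\<tau> holomorphic_on {w. 0 < Im w}"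
    unfolding \<tau>_def using wi by (intro holomorphic_intros) auto
  have cont\<tau>: "isCont \<tau> w" if "0 \<le> Im w" for w
    unfolding \<tau>_def using wi[OF that] by (intro continuous_intros) auto
  have \<tau>_onto: "\<exists>w. 0 < Im w \<and> \<tau> w = z" if z: "norm z < 1" for z
  proof -
    define y where "y = z / \<zeta>"
    have y: "norm y < 1" "z = \<zeta> * y" using z \<zeta> \<zeta>0 by (auto simp: y_def norm_divide)
    then have y1: "1 - y \<noteq> 0" by auto
    define w where "w = \<i> * (1 + y) / (1 - y)"
    have "w + \<i> = 2 * \<i> / (1 - y)" "w - \<i> = 2 * \<i> * y / (1 - y)"
      using y1 by (auto simp: w_def field_simps)
    then have "w - \<i> = y * (w + \<i>)" "w + \<i> \<noteq> 0" using y1 by simp_all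
    then have "\<tau> w = z" using y(2) by (simp add: \<tau>_def)
    moreover have "0 < Im w"
    proof -
      have "Im w = (1 - (norm y)\<^sup>2) / (norm (1 - y))\<^sup>2"
        unfolding w_def cmod_power2 by (simp add: Im_divide power2_eq_square algebra_simps)
      moreover have "(norm y)\<^sup>2 < 1" using y(1) by (simp add: abs_square_less_1)
      ultimately show ?thesis using y1 by simp
    qed
    ultimately show ?thesis by blast
  qed
  define \<Psi> where "\<Psi> = (\<lambda>w. g (\<tau> w))"
  show ?thesis
  proof (intro exI[of _ \<Psi>] conjI ballI allI impI)
    show "\<Psi> holomorphic_on {w. 0 < Im w}"
      unfolding \<Psi>_def using \<tau>_in by (intro holomorphic_on_compose_gen[OF hol\<tau> g, unfolded o_def]) auto
    show "\<Psi> w \<in> \<Omega>" if "0 < Im w" for w using \<tau>_in[OF that] g_in by (simp add: \<Psi>_def)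
    show "\<exists>w. 0 < Im w \<and> \<Psi> w = z" if "z \<in> \<Omega>" for z
      using \<tau>_onto[OF f_in[OF that]] gf[OF that] by (auto simp: \<Psi>_def)
    fix T :: "complex \<Rightarrow> real" and t :: real
    assume contT: "continuous_on UNIV T" and T0: "\<forall>z. U z = 0 \<longrightarrow> T z = 0"
    let ?F = "at (of_real t) within {w. 0 < Im w}"
    have \<tau>_lim: "(\<tau> \<longlongrightarrow> \<tau> (of_real t)) ?F"
      using cont\<tau>[of "of_real t"] by (auto simp: isCont_def intro: tendsto_within_subset)
    have evpos: "\<forall>\<^sub>F w in ?F. 0 < Im w" by (simp add: eventually_at_filter)
    \<comment> \<open>Half of the distance: for \<open>w\<close> near \<open>t\<close> the point
      \<open>\<tau> w\<close> stays at least \<open>d\<close> away from \<open>\<zeta>\<close>, so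
      \<open>\<Psi> w\<close> cannot be far out.\<close>
    define d where "d = dist (\<tau> (of_real t)) \<zeta> / 2"
    have d: "d > 0" using \<tau>_ne[of "of_real t"] by (simp add: d_def)
    then obtain R where R: "\<And>z. z \<in> \<Omega> \<Longrightarrow> R \<le> norm z \<Longrightarrow> dist (f z) \<zeta> < d" using lim by blast
    have "\<forall>\<^sub>F w in ?F. dist (\<tau> w) (\<tau> (of_real t)) < d" using tendstoD[OF \<tau>_lim d] .
    with evpos have bounded: "\<forall>\<^sub>F w in ?F. norm (\<Psi> w) < R"
    proof eventually_elim
      case (elim w)
      have "\<not> dist (\<tau> w) \<zeta> < d"
        using elim(2) dist_triangle[of "\<tau> (of_real t)" \<zeta> "\<tau> w"] by (simp add: d_def dist_commute)
      then show ?case using R[of "\<Psi> w"] g_in fg \<tau>_in[OF elim(1)] by (force simp: \<Psi>_def)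
    qed
    show "((\<lambda>w. T (\<Psi> w)) \<longlongrightarrow> 0) ?F"
    proof (rule tendstoI)
      fix \<eta> :: real assume \<eta>: "\<eta> > 0"
      \<comment> \<open>The bounded points where \<open>T\<close> is not small form a compact part
        of \<open>\<Omega>\<close>. Its image under \<open>f\<close> lies in a smaller disc, which
        \<open>\<tau> w\<close> leaves as \<open>w\<close> tends to \<open>t\<close>.\<close>
      define K where "K = cball 0 R \<inter> {z. \<eta> \<le> \<bar>T z\<bar>}"
      have "closed {z. \<eta> \<le> \<bar>T z\<bar>}" using contT by (intro closed_Collect_le continuous_intros)
      then have "compact K" unfolding K_def by (intro compact_Int_closed) auto
      have "K \<subseteq> \<Omega>"
      proof
        fix z assume "z \<in> K"
        then have "T z \<noteq> 0" using \<eta> by (auto simp: K_def)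
        then show "z \<in> \<Omega>" using T0 not_\<Omega> by blast
      qed
      have "compact (f ` K)"
        using \<open>compact K\<close> \<open>K \<subseteq> \<Omega>\<close> f
        by (intro compact_continuous_image) (auto intro: holomorphic_on_imp_continuous_on holomorphic_on_subset)
      have "\<exists>\<rho><1. \<forall>y\<in>f ` K. norm y \<le> \<rho>"
      proof (cases "K = {}")
        case True then show ?thesis by (intro exI[of _ 0]) auto
      next
        case False
        then obtain y where y: "y \<in> f ` K" "\<And>x. x \<in> f ` K \<Longrightarrow> norm x \<le> norm y"
          using continuous_attains_sup[OF \<open>compact (f ` K)\<close>, of norm] by (auto simp: continuous_on_norm_id)
        then have "norm y < 1" using f_in \<open>K \<subseteq> \<Omega>\<close> by blast
        then show ?thesis using y by blast
      qed
      then obtain \<rho> where \<rho>: "\<rho> < 1" "\<And>z. z \<in> K \<Longrightarrow> norm (f z) \<le> \<rho>" by auto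
      have "((\<lambda>w. norm (\<tau> w)) \<longlongrightarrow> 1) ?F" using tendsto_norm[OF \<tau>_lim] by (simp add: \<tau>_real)
      then have "\<forall>\<^sub>F w in ?F. \<rho> < norm (\<tau> w)" using \<rho>(1) by (rule order_tendstoD)
      with evpos bounded show "\<forall>\<^sub>F w in ?F. dist (T (\<Psi> w)) 0 < \<eta>"
      proof eventually_elim
        case (elim w)
        have "f (\<Psi> w) = \<tau> w" using fg \<tau>_in[OF elim(1)] by (simp add: \<Psi>_def)
        then have "\<Psi> w \<notin> K" using \<rho>(2)[of "\<Psi> w"] elim(3) by auto
        then show ?case using elim(2) by (auto simp: K_def)
      qed
    qed
  qed
qed

end

section \<open>Polynomial parametrization and the zero set\<close>

context hypograph_solution begin

text \<open>Rules out a constant \<open>B\<close>. By continuity, a constant value of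
  \<open>F\<close> on \<open>\<Omega>\<close> would persist on the free boundary, where
  \<open>F\<close> is twice the abscissa, and the interior of the coincidence set provides two
  different abscissas.\<close>

lemma F_not_constant: "\<not> (\<forall>z\<in>\<Omega>. F z = of_real k)"
proof
  assume const: "\<forall>z\<in>\<Omega>. F z = of_real k"
  have bdry: "k = 2 * x" if "U (Complex x y) = 0" for x y
  proof -
    have "closed {z. F z = of_real k}" using contF by (intro closed_Collect_eq) auto
    then have cl: "closure \<Omega> \<subseteq> {z. F z = of_real k}" using const by (intro closure_minimal) auto
    let ?c = "\<lambda>s. Complex x s"
    have "connected (range ?c)"
      by (intro connected_continuous_image continuous_intros) auto
    moreover have "range ?c \<inter> \<Omega> \<noteq> {}" using lower_halfplane[of "?c (-1)"] by auto
    moreover have "?c y \<in> range ?c - \<Omega>" using that not_\<Omega> by auto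
    ultimately have "range ?c \<inter> frontier \<Omega> \<noteq> {}" by (intro connected_Int_frontier) auto
    then obtain s where s: "?c s \<in> frontier \<Omega>" by auto
    then have "?c s \<in> closure \<Omega>" "?c s \<notin> \<Omega>" using open_\<Omega> by (auto simp: frontier_def interior_open)
    then have "F (?c s) = of_real k" "U (?c s) = 0" using cl not_\<Omega> by auto
    then have "(of_real k :: complex) = of_real (2 * x)" using F_eq[of "?c s"] by simp
    then show ?thesis by (simp only: of_real_eq_iff)
  qed
  obtain p \<delta> where \<delta>: "\<delta> > 0" and p: "ball p \<delta> \<subseteq> {z. U z = 0}"
    using interior by (metis all_not_in_conv mem_interior)
  have "p \<in> ball p \<delta>" "Complex (Re p + \<delta> / 2) (Im p) \<in> ball p \<delta>"
    using \<delta> by (auto simp: dist_norm cmod_def)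
  then have "U (Complex (Re p) (Im p)) = 0" "U (Complex (Re p + \<delta> / 2) (Im p)) = 0" using subsetD[OF p] by auto
  then have "k = 2 * Re p" "k = 2 * (Re p + \<delta> / 2)" by (blast intro: bdry)+
  then show False using \<delta> by simp
qed

text \<open>\<open>P\<close> and \<open>- F\<close> are mutually inverse between the upper half
  plane and \<open>\<Omega>\<close>. Using \<open>- F\<close> as the parameter removes the affine
  freedom in the choice of \<open>\<Psi>\<close>.\<close>

lemma polynomial_parametrization:
  "\<exists>a b c::real. let P = (\<lambda>v. \<i> * (of_real a + of_real b * v + of_real c * v\<^sup>2) - v / 2) in
    (\<forall>v. 0 < Im v \<longrightarrow> P v \<in> \<Omega> \<and> F (P v) = - v) \<and> (\<forall>z\<in>\<Omega>. Im (F z) < 0 \<and> P (- F z) = z)"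
proof -
  let ?H = "{w. 0 < Im w}"
  obtain \<Psi> where hol\<Psi>: "\<Psi> holomorphic_on ?H" and \<Psi>_in: "\<forall>w. 0 < Im w \<longrightarrow> \<Psi> w \<in> \<Omega>"
    and \<Psi>_onto: "\<forall>z\<in>\<Omega>. \<exists>w. 0 < Im w \<and> \<Psi> w = z"
    and \<Psi>_bdry: "\<forall>T t. continuous_on UNIV T \<longrightarrow> (\<forall>z. U z = 0 \<longrightarrow> T z = (0::real)) \<longrightarrow>
        ((\<lambda>w. T (\<Psi> w)) \<longlongrightarrow> 0) (at (of_real t) within ?H)"
    using exists_halfplane_map by blast
  define B where "B = (\<lambda>w. - F (\<Psi> w))"
  have "(\<lambda>w. F (\<Psi> w)) holomorphic_on ?H"
    using \<Psi>_in by (intro holomorphic_on_compose_gen[OF hol\<Psi> holF, unfolded o_def]) auto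
  then have holB: "B holomorphic_on ?H" unfolding B_def by (intro holomorphic_intros)
  \<comment> \<open>Both functions vanish where \<open>U\<close> does. Composed with
    \<open>\<Psi>\<close> they are the imaginary parts of \<open>B\<close> and
    \<open>Q\<close>.\<close>
  have contT: "continuous_on UNIV (\<lambda>z. - Im (F z))" "continuous_on UNIV (\<lambda>z. - (Re z - Re (F z) / 2))"
    using contF by (intro continuous_intros; simp)+
  have Im_B: "((\<lambda>w. Im (B w)) \<longlongrightarrow> 0) (at (of_real t) within ?H)" for t
    using \<Psi>_bdry[rule_format, OF contT(1), of t] F_eq by (simp add: B_def)
  obtain \<beta> where \<beta>: "\<beta> holomorphic_on UNIV" "\<And>w. 0 < Im w \<Longrightarrow> \<beta> w = B w"
      "\<And>t. Im (\<beta> (of_real t)) = 0" "\<And>w. \<beta> (cnj w) = cnj (\<beta> w)"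
    using entire_extension_of_vanishing_Im[OF holB Im_B] by metis
  \<comment> \<open>Adding \<open>\<i>\<close> turns the weak sign of \<open>Im (B w)\<close> into
    the strict one that the Schwarz lemma requires.\<close>
  have holB': "(\<lambda>w. B w + \<i>) holomorphic_on ?H" by (intro holomorphic_intros holB)
  have B_pos: "0 < Im (B w + \<i>)" for w using Im_F[of "\<Psi> w"] by (simp add: B_def)
  obtain C1 where C1: "C1 \<ge> 0" "\<And>w. 0 < Im w \<Longrightarrow> 1 \<le> norm w \<Longrightarrow> norm (B w + \<i>) * Im w \<le> C1 * norm w ^ 2"
    using halfplane_growth_far[OF holB' B_pos] by blast
  have \<beta>_growth: "norm (\<beta> w) \<le> (C1 + 1) * 8 ^ 1 * norm w ^ 1" if "1 \<le> norm w" for w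
  proof (rule entire_growth_from_halfplane[OF \<beta>(1,4) zero_less_one _ that])
    fix w assume w: "0 < Im w" "1 \<le> norm w"
    have "norm (B w) * Im w \<le> (norm (B w + \<i>) + 1) * Im w"
      using w(1) norm_triangle_ineq4[of "B w + \<i>" \<i>] by (intro mult_right_mono) auto
    also have "\<dots> \<le> C1 * norm w ^ 2 + Im w" using C1(2)[OF w] by (simp add: algebra_simps)
    also have "Im w \<le> norm w ^ 2"
      using abs_Im_le_cmod[of w] w(2) self_le_power[of "norm w" 2] by simp
    finally show "norm (\<beta> w) * Im w ^ 1 \<le> (C1 + 1) * norm w ^ (2 * 1)"
      using \<beta>(2)[OF w(1)] by (simp add: algebra_simps power2_eq_square)
  qed
  obtain \<beta>0 \<alpha> :: real where lin: "\<And>w. \<beta> w = of_real \<beta>0 + of_real \<alpha> * w"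
    using real_linear_of_growth[OF \<beta>(1,3), of "(C1 + 1) * 8"] \<beta>_growth by auto
  have B_lin: "B w = of_real \<beta>0 + of_real \<alpha> * w" if "0 < Im w" for w
    using lin[of w] \<beta>(2)[OF that] by simp
  have "\<alpha> \<noteq> 0"
  proof
    assume "\<alpha> = 0"
    have "F z = of_real (- \<beta>0)" if z: "z \<in> \<Omega>" for z
    proof -
      obtain w where w: "0 < Im w" "\<Psi> w = z" using bspec[OF \<Psi>_onto z] by metis
      have "F z = - B w" using w(2) by (simp add: B_def)
      then show ?thesis using B_lin[OF w(1)] \<open>\<alpha> = 0\<close> by simp
    qed
    then show False using F_not_constant by blast
  qed
  moreover have "0 \<le> \<alpha>" using B_lin[of \<i>] Im_F[of "\<Psi> \<i>"] by (simp add: B_def complex_eq_iff)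
  ultimately have \<alpha>: "0 < \<alpha>" by simp
  \<comment> \<open>Since \<open>\<Omega>\<close> omits the upward imaginary axis,
    \<open>\<i> * \<Psi> w\<close> omits the nonpositive reals. Its principal root has positive real
    part, which the factor \<open>\<i>\<close> turns into positive imaginary part.\<close>
  define r where "r = (\<lambda>w. \<i> * csqrt (\<i> * \<Psi> w))"
  have slit: "\<i> * \<Psi> w \<notin> \<real>\<^sub>\<le>\<^sub>0" if w: "0 < Im w" for w
  proof
    assume "\<i> * \<Psi> w \<in> \<real>\<^sub>\<le>\<^sub>0"
    then have "Re (\<Psi> w) = 0" "0 \<le> Im (\<Psi> w)" by (auto simp: complex_nonpos_Reals_iff)
    then have "U (\<Psi> w) = 0" using U_axis[of "Im (\<Psi> w)"] by (metis complex_surj)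
    then show False using \<Psi>_in w not_\<Omega> by blast
  qed
  have "(\<lambda>w. csqrt (\<i> * \<Psi> w)) holomorphic_on ?H"
    using slit by (intro holomorphic_on_csqrt' holomorphic_intros hol\<Psi>) auto
  then have holr: "r holomorphic_on ?H" unfolding r_def by (rule holomorphic_on_mult[OF holomorphic_on_const])
  have r_pos: "0 < Im (r w)" if w: "0 < Im w" for w
  proof -
    define y where "y = \<i> * \<Psi> w"
    obtain s where s: "s = csqrt y" "y = s\<^sup>2" using power2_csqrt[of y] by metis
    have "\<not> (Re y \<le> 0 \<and> Im y = 0)"
      using slit[OF w] unfolding y_def complex_nonpos_Reals_iff .
    then have "Re s \<noteq> 0" unfolding s(2) by (auto simp: Re_power2 Im_power2)
    then have "0 < Re (csqrt y)" using csqrt_principal[of y] unfolding s(1)[symmetric] by auto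
    then have "0 < Re (csqrt (\<i> * \<Psi> w))" by (simp only: y_def)
    then show ?thesis by (simp add: r_def)
  qed
  have norm_r: "norm (r w) ^ 2 = norm (\<Psi> w)" for w
  proof -
    have "norm (r w) ^ 2 = norm (csqrt (\<i> * \<Psi> w) ^ 2)" by (simp add: r_def norm_mult norm_power)
    then show ?thesis by (simp add: norm_mult)
  qed
  obtain C2 where C2: "C2 \<ge> 0" "\<And>w. 0 < Im w \<Longrightarrow> 1 \<le> norm w \<Longrightarrow> norm (r w) * Im w \<le> C2 * norm w ^ 2"
    using halfplane_growth_far[OF holr r_pos] by blast
  define Q where "Q = (\<lambda>w. - \<i> * (\<Psi> w + B w / 2))"
  have holQ: "Q holomorphic_on ?H" unfolding Q_def by (intro holomorphic_intros hol\<Psi> holB) auto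
  have Im_Q: "((\<lambda>w. Im (Q w)) \<longlongrightarrow> 0) (at (of_real t) within ?H)" for t
    using \<Psi>_bdry[rule_format, OF contT(2), of t] F_eq by (simp add: Q_def B_def)
  obtain q where q: "q holomorphic_on UNIV" "\<And>w. 0 < Im w \<Longrightarrow> q w = Q w"
      "\<And>t. Im (q (of_real t)) = 0" "\<And>w. q (cnj w) = cnj (q w)"
    using entire_extension_of_vanishing_Im[OF holQ Im_Q] by metis
  \<comment> \<open>\<open>C2\<close> enters squared because \<open>norm (\<Psi> w)\<close> is the
    square of \<open>norm (r w)\<close>. The other summand is half of the linear bound for
    \<open>B\<close>, combined with \<open>Im w ^ 2 \<le> norm w ^ 3\<close> to reach degree
    4.\<close>
  define C3 where "C3 = C2\<^sup>2 + (C1 + 1) * 4"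
  have q_growth: "norm (q w) \<le> C3 * 8 ^ 2 * norm w ^ 2" if "1 \<le> norm w" for w
  proof (rule entire_growth_from_halfplane[OF q(1,4) _ _ that])
    fix w assume w: "0 < Im w" "1 \<le> norm w"
    have "norm (Q w) = norm (\<Psi> w + B w / 2)" by (simp add: Q_def norm_mult)
    also have "\<dots> \<le> norm (\<Psi> w) + norm (B w) / 2"
      using norm_triangle_ineq[of "\<Psi> w" "B w / 2"] by (simp add: norm_divide)
    finally have "norm (Q w) * Im w ^ 2 \<le> (norm (\<Psi> w) + norm (B w) / 2) * Im w ^ 2"
      by (rule mult_right_mono) simp
    also have "\<dots> = (norm (r w) * Im w) ^ 2 + norm (B w) * Im w ^ 2 / 2"
      by (simp add: norm_r power_mult_distrib algebra_simps)
    also have "(norm (r w) * Im w) ^ 2 \<le> (C2 * norm w ^ 2) ^ 2"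
      using C2(2)[OF w] w(1) by (intro power_mono) auto
    also have "norm (B w) * Im w ^ 2 \<le> ((C1 + 1) * 8 * norm w) * norm w ^ 3"
    proof (rule mult_mono)
      show "norm (B w) \<le> (C1 + 1) * 8 * norm w" using \<beta>_growth[OF w(2)] \<beta>(2)[OF w(1)] by simp
      have "Im w ^ 2 \<le> norm w ^ 2" using abs_Im_le_cmod[of w] w(1) by (intro power_mono) auto
      also have "\<dots> \<le> norm w ^ 3" using w(2) by (intro power_increasing) auto
      finally show "Im w ^ 2 \<le> norm w ^ 3" .
    qed (use C1(1) in auto)
    finally have "norm (Q w) * Im w ^ 2 \<le> (C2 * norm w ^ 2) ^ 2 + (C1 + 1) * 8 * norm w * norm w ^ 3 / 2"
      by simp
    also have "\<dots> = C3 * norm w ^ (2 * 2)"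
      by (simp add: C3_def field_simps eval_nat_numeral)
    finally show "norm (q w) * Im w ^ 2 \<le> C3 * norm w ^ (2 * 2)"
      using q(2)[OF w(1)] by simp
  qed simp
  obtain a b c :: real where quad: "\<And>w. q w = of_real a + of_real b * w + of_real c * w\<^sup>2"
    using real_quadratic_of_growth[OF q(1,3) q_growth] by metis
  \<comment> \<open>Reparametrize by \<open>v = \<alpha> w + \<beta>0\<close>, so that the parameter becomes \<open>- F\<close>.\<close>
  define a' b' c' where "a' = a - b * \<beta>0 / \<alpha> + c * \<beta>0\<^sup>2 / \<alpha>\<^sup>2" and "b' = b / \<alpha> - 2 * c * \<beta>0 / \<alpha>\<^sup>2"
    and "c' = c / \<alpha>\<^sup>2"
  define P where "P = (\<lambda>v. \<i> * (of_real a' + of_real b' * v + of_real c' * v\<^sup>2) - v / 2)"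
  have P_eq: "P (B w) = \<Psi> w" if w: "0 < Im w" for w
  proof -
    have "of_real a' + of_real b' * B w + of_real c' * (B w)\<^sup>2 = q w"
      unfolding quad B_lin[OF w] a'_def b'_def c'_def using \<alpha>
      by (simp add: field_simps power2_eq_square)
    also have "\<dots> = Q w" by (rule q(2)[OF w])
    finally have "P (B w) = \<i> * Q w - B w / 2" by (simp add: P_def)
    also have "\<dots> = \<Psi> w" by (simp add: Q_def algebra_simps flip: mult.assoc)
    finally show ?thesis .
  qed
  have "P v \<in> \<Omega> \<and> F (P v) = - v" if v: "0 < Im v" for v
  proof -
    define w where "w = (v - of_real \<beta>0) / of_real \<alpha>"
    have w: "0 < Im w" using v \<alpha> by (simp add: w_def Im_divide_of_real)
    have "B w = v" using B_lin[OF w] \<alpha> by (simp add: w_def)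
    then have "P v = \<Psi> w" "F (\<Psi> w) = - v" using P_eq[OF w] by (auto simp: B_def)
    then show ?thesis using \<Psi>_in w by simp
  qed
  moreover have "Im (F z) < 0 \<and> P (- F z) = z" if z: "z \<in> \<Omega>" for z
  proof -
    obtain w where w: "0 < Im w" "\<Psi> w = z" using bspec[OF \<Psi>_onto z] by metis
    have "0 < Im (B w)" using B_lin[OF w(1)] \<alpha> w(1) by simp
    then show ?thesis using P_eq[OF w(1)] w(2) by (simp add: B_def)
  qed
  ultimately show ?thesis unfolding Let_def P_def by blast
qed

text \<open>For real \<open>t\<close> continuity gives
  \<open>F (P (of_real t)) = - of_real t\<close>, which is real, whereas \<open>Im (F z) < 0\<close>
  on \<open>\<Omega>\<close>; so the curve consists of zeros. Conversely, the lowest zero over an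
  abscissa \<open>x\<close> is a limit of points of \<open>\<Omega>\<close> and has \<open>F\<close>
  equal to \<open>2 * x\<close>, so it is the curve point with parameter
  \<open>- 2 * x\<close>.\<close>

theorem zero_set_paraboloid: "\<exists>c>0. \<forall>z. U z = 0 \<longleftrightarrow> c * (Re z)\<^sup>2 \<le> Im z"
proof -
  obtain a b c :: real where P0: "let P = (\<lambda>v. \<i> * (of_real a + of_real b * v + of_real c * v\<^sup>2) - v / 2) in
    (\<forall>v. 0 < Im v \<longrightarrow> P v \<in> \<Omega> \<and> F (P v) = - v) \<and> (\<forall>z\<in>\<Omega>. Im (F z) < 0 \<and> P (- F z) = z)"
    using polynomial_parametrization by blast
  define P where "P = (\<lambda>v. \<i> * (of_real a + of_real b * v + of_real c * v\<^sup>2) - v / 2)"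
  have P1: "P v \<in> \<Omega>" "F (P v) = - v" if "0 < Im v" for v
    using P0 that by (auto simp: P_def Let_def)
  have P2: "Im (F z) < 0" "P (- F z) = z" if "z \<in> \<Omega>" for z
    using P0 that by (auto simp: P_def Let_def)
  have contP: "isCont P v" for v unfolding P_def by (intro continuous_intros) auto
  have contF': "isCont F z" for z using contF continuous_on_eq_continuous_at[OF open_UNIV] by blast
  have P_real: "P (of_real t) = Complex (- t / 2) (a + b * t + c * t\<^sup>2)" for t :: real
    by (simp add: P_def complex_eq_iff power2_eq_square)
  define \<epsilon> where "\<epsilon> = (\<lambda>n::nat. \<i> * of_real (1 / real (Suc n)))"
  have \<epsilon>: "\<epsilon> \<longlonglongrightarrow> 0"
  proof -
    have "(\<lambda>n. \<i> * of_real (1 / real (Suc n))) \<longlonglongrightarrow> \<i> * of_real 0"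
      using LIMSEQ_inverse_real_of_nat by (intro tendsto_intros) (simp add: inverse_eq_divide)
    then show ?thesis by (simp add: \<epsilon>_def)
  qed
  have Im_\<epsilon>: "0 < Im (\<epsilon> n)" for n by (simp add: \<epsilon>_def)
  have on_C: "U (P (of_real t)) = 0" for t
  proof -
    have lim: "(\<lambda>n. of_real t + \<epsilon> n) \<longlonglongrightarrow> of_real t" using tendsto_add[OF tendsto_const \<epsilon>] by simp
    have "(\<lambda>n. F (P (of_real t + \<epsilon> n))) \<longlonglongrightarrow> F (P (of_real t))"
      by (intro isCont_tendsto_compose[OF contF'] isCont_tendsto_compose[OF contP] lim)
    moreover have "F (P (of_real t + \<epsilon> n)) = - (of_real t + \<epsilon> n)" for n
      by (rule P1) (use Im_\<epsilon> in simp)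
    ultimately have "(\<lambda>n. - (of_real t + \<epsilon> n)) \<longlonglongrightarrow> F (P (of_real t))" by simp
    moreover have "(\<lambda>n. - (of_real t + \<epsilon> n)) \<longlonglongrightarrow> - of_real t" by (intro tendsto_minus lim)
    ultimately have "F (P (of_real t)) = - of_real t" by (rule LIMSEQ_unique)
    then have "\<not> Im (F (P (of_real t))) < 0" by simp
    then show ?thesis using P2 not_\<Omega> by blast
  qed
  have bdry: "y = a - 2 * b * x + 4 * c * x\<^sup>2"
    if zero: "U (Complex x y) = 0" and pos: "\<And>y'. y' < y \<Longrightarrow> Complex x y' \<in> \<Omega>" for x y
  proof -
    let ?z = "Complex x y"
    have lim: "(\<lambda>n. ?z - \<epsilon> n) \<longlonglongrightarrow> ?z" using tendsto_diff[OF tendsto_const \<epsilon>] by simp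
    have "?z - \<epsilon> n = Complex x (y - 1 / real (Suc n))" for n
      by (simp add: \<epsilon>_def complex_eq_iff)
    then have in\<Omega>: "?z - \<epsilon> n \<in> \<Omega>" for n using pos by simp
    have "(\<lambda>n. P (- F (?z - \<epsilon> n))) \<longlonglongrightarrow> P (- F ?z)"
      by (intro isCont_tendsto_compose[OF contP] tendsto_minus isCont_tendsto_compose[OF contF'] lim)
    then have "(\<lambda>n. ?z - \<epsilon> n) \<longlonglongrightarrow> P (- F ?z)" using P2(2)[OF in\<Omega>] by simp
    then have "P (- F ?z) = ?z" using lim by (rule LIMSEQ_unique)
    moreover have "- F ?z = of_real (- 2 * x)" using F_eq[OF zero] by simp
    ultimately have "P (of_real (- 2 * x)) = ?z" by simp
    then show ?thesis unfolding P_real by (simp add: power_mult_distrib)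
  qed
  have "a = 0"
    using bdry[of 0 0] U_axis[of 0] lower_halfplane by simp
  \<comment> \<open>For nonzero \<open>t\<close> the curve point is a zero other than the origin, so
    \<open>below\<close> forces positive height.\<close>
  have pos: "0 < b * t + c * t\<^sup>2" if "t \<noteq> 0" for t
  proof (rule ccontr)
    assume "\<not> ?thesis"
    then have "Im (P (of_real t)) \<le> 0" unfolding P_real using \<open>a = 0\<close> by simp
    then have "P (of_real t) = 0" using below on_C by blast
    then show False unfolding P_real using that by (simp add: complex_eq_iff)
  qed
  have "0 < c" using pos[of 1] pos[of "-1"] by simp
  \<comment> \<open>Otherwise \<open>- b / c\<close> is a nonzero root of the quadratic in
    \<open>pos\<close>.\<close>
  have "b = 0"
  proof (rule ccontr)
    assume "b \<noteq> 0"
    then have "0 < b * (- b / c) + c * (- b / c)\<^sup>2" using \<open>0 < c\<close> by (intro pos) simp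
    then show False using \<open>0 < c\<close> by (simp add: power2_eq_square)
  qed
  have "U z = 0 \<longleftrightarrow> 4 * c * (Re z)\<^sup>2 \<le> Im z" for z
  proof
    assume "4 * c * (Re z)\<^sup>2 \<le> Im z"
    moreover have "U (Complex (Re z) (4 * c * (Re z)\<^sup>2)) = 0"
      using on_C[of "- 2 * Re z"] unfolding P_real by (simp add: \<open>a = 0\<close> \<open>b = 0\<close> power_mult_distrib mult_ac)
    ultimately show "U z = 0" using zero_up by (metis complex_surj)
  next
    assume z: "U z = 0"
    define S where "S = {y. U (Complex (Re z) y) = 0}"
    have "closed S" unfolding S_def
      by (intro closed_Collect_eq continuous_on_compose2[OF contU] continuous_intros) auto
    moreover have S_ge: "0 \<le> y" if "y \<in> S" for y
      using that lower_halfplane[of "Complex (Re z) y"] not_\<Omega>[of "Complex (Re z) y"] by (force simp: S_def)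
    then have bdd: "bdd_below S" by (meson bdd_belowI)
    moreover have "Im z \<in> S" using z by (simp add: S_def)
    ultimately have Inf: "Inf S \<in> S" using closed_contains_Inf by blast
    have "Inf S = a - 2 * b * Re z + 4 * c * (Re z)\<^sup>2"
    proof (rule bdry)
      show "U (Complex (Re z) (Inf S)) = 0" using Inf by (simp add: S_def)
      show "Complex (Re z) y' \<in> \<Omega>" if "y' < Inf S" for y'
        using that cInf_lower[OF _ bdd, of y'] not_\<Omega> by (force simp: S_def)
    qed
    moreover have "Inf S \<le> Im z" using \<open>Im z \<in> S\<close> bdd by (rule cInf_lower)
    ultimately show "4 * c * (Re z)\<^sup>2 \<le> Im z" by (simp add: \<open>a = 0\<close> \<open>b = 0\<close>)
  qed
  then show ?thesis using \<open>0 < c\<close> by (intro exI[of _ "4 * c"]) auto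
qed

end

section \<open>Holomorphy of the complex gradient\<close>

text \<open>After the shift the integral is the average of \<open>g\<close> over
  \<open>{b..b + h}\<close> minus the one over \<open>{a..a + h}\<close>. These tend to the endpoint
  values by continuity alone, so \<open>g\<close> need not be differentiable.\<close>

lemma integral_difference_quotient_tendsto:
  fixes g :: "real \<Rightarrow> real"
  assumes g: "continuous_on UNIV g" and ab: "a \<le> b"
  shows "((\<lambda>h. integral {a..b} (\<lambda>s. (g (s + h) - g s) / h)) \<longlongrightarrow> g b - g a) (at_right 0)"
proof -
  define \<Gamma> where "\<Gamma> = (\<lambda>x. integral {a..x} g)"
  have int: "g integrable_on {x..y}" for x y
    by (intro integrable_continuous_real continuous_on_subset[OF g]) auto
  have der: "((\<lambda>h. (\<Gamma> (x + h) - \<Gamma> x) / h) \<longlongrightarrow> g x) (at_right 0)" if "a \<le> x" for x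
  proof -
    have "(\<Gamma> has_real_derivative g x) (at x within {a..x + 1})"
      unfolding \<Gamma>_def by (rule integral_has_real_derivative) (use that g in \<open>auto intro: continuous_on_subset\<close>)
    then have "(\<Gamma> has_real_derivative g x) (at x within {x..x + 1})"
      by (rule DERIV_subset) (use that in auto)
    then have "((\<lambda>y. (\<Gamma> y - \<Gamma> x) / (y - x)) \<longlongrightarrow> g x) (at x within {x..x + 1})"
      by (simp add: has_field_derivative_iff)
    moreover have "filterlim (\<lambda>h. x + h) (at x within {x..x + 1}) (at_right 0)"
      unfolding filterlim_at
      by (auto intro!: tendsto_eq_intros simp: eventually_at_right_field intro: exI[of _ 1])
    ultimately show ?thesis by (auto dest: filterlim_compose)
  qed
  have eq: "integral {a..b} (\<lambda>s. (g (s + h) - g s) / h) = (\<Gamma> (b + h) - \<Gamma> b) / h - (\<Gamma> (a + h) - \<Gamma> a) / h"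
    if h: "0 < h" for h
  proof -
    have "((g \<circ> (+) h) has_integral integral {a + h..b + h} g) {a..b}"
      unfolding has_integral_shift_Icc_real using int by (rule integrable_integral)
    then have 1: "((\<lambda>s. g (s + h)) has_integral integral {a + h..b + h} g) {a..b}"
      by (simp add: o_def add.commute)
    have "((\<lambda>s. (g (s + h) - g s) / h) has_integral (integral {a + h..b + h} g - integral {a..b} g) / h) {a..b}"
      by (intro has_integral_divide has_integral_diff 1 integrable_integral int)
    moreover have "integral {a..a + h} g + integral {a + h..b + h} g = integral {a..b + h} g"
      using h ab by (intro Henstock_Kurzweil_Integration.integral_combine int) auto
    then have "integral {a + h..b + h} g = \<Gamma> (b + h) - \<Gamma> (a + h)" by (simp add: \<Gamma>_def)
    moreover have "\<Gamma> a = 0" by (simp add: \<Gamma>_def)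
    ultimately show ?thesis by (simp add: integral_unique \<Gamma>_def diff_divide_distrib)
  qed
  have "((\<lambda>h. (\<Gamma> (b + h) - \<Gamma> b) / h - (\<Gamma> (a + h) - \<Gamma> a) / h) \<longlongrightarrow> g b - g a) (at_right 0)"
    by (intro tendsto_diff der) (use ab in auto)
  then show ?thesis
    by (rule Lim_transform_eventually) (use eq in \<open>auto simp: eventually_at_right_field intro!: exI[of _ 1]\<close>)
qed

lemma integral_box_difference_quotient_fst:
  fixes v :: "real \<times> real \<Rightarrow> real"
  assumes v: "continuous_on UNIV v" and ab: "a \<le> b"
  shows "((\<lambda>h. integral (cbox (a, c) (b, d)) (\<lambda>x. (v (x + (h, 0)) - v x) / h)) \<longlongrightarrow>
    integral {c..d} (\<lambda>t. v (b, t) - v (a, t))) (at_right 0)"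
proof -
  define g where "g = (\<lambda>s. integral {c..d} (\<lambda>t. v (s, t)))"
  have comp: "continuous_on S (\<lambda>x. v (f x))" if "continuous_on S f" for S :: "'b::topological_space set" and f
    by (rule continuous_on_compose2[OF v that]) auto
  have contg: "continuous_on UNIV g"
    unfolding g_def cbox_interval[symmetric]
    by (rule integral_continuous_on_param) (auto intro!: comp continuous_intros simp: case_prod_unfold)
  have int: "(\<lambda>t. v (s, t)) integrable_on {c..d}" for s
    by (intro integrable_continuous_real comp continuous_intros)
  have "integral (cbox (a, c) (b, d)) (\<lambda>x. (v (x + (h, 0)) - v x) / h) =
      integral {a..b} (\<lambda>s. (g (s + h) - g s) / h)" if "h > 0" for h
  proof -
    have "integral (cbox (a, c) (b, d)) (\<lambda>x. (v (x + (h, 0)) - v x) / h) =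
      integral (cbox a b) (\<lambda>s. integral (cbox c d) (\<lambda>t. (v ((s, t) + (h, 0)) - v (s, t)) / h))"
      by (rule integral_prod_continuous) (use that in \<open>auto intro!: comp continuous_intros\<close>)
    also have "\<dots> = integral {a..b} (\<lambda>s. (g (s + h) - g s) / h)"
      unfolding g_def cbox_interval using int
      by (simp add: Henstock_Kurzweil_Integration.integral_diff)
    finally show ?thesis .
  qed
  moreover have "integral {c..d} (\<lambda>t. v (b, t) - v (a, t)) = g b - g a"
    unfolding g_def using int by (simp add: Henstock_Kurzweil_Integration.integral_diff)
  ultimately show ?thesis
    using integral_difference_quotient_tendsto[OF contg ab]
    by (auto elim!: Lim_transform_eventually simp: eventually_at_right_field intro!: exI[of _ 1])
qed

lemma integral_box_difference_quotient_snd: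
  fixes v :: "real \<times> real \<Rightarrow> real"
  assumes v: "continuous_on UNIV v" and cd: "c \<le> d"
  shows "((\<lambda>h. integral (cbox (a, c) (b, d)) (\<lambda>x. (v (x + (0, h)) - v x) / h)) \<longlongrightarrow>
    integral {a..b} (\<lambda>s. v (s, d) - v (s, c))) (at_right 0)"
proof -
  have comp: "continuous_on S (\<lambda>x. v (f x))" if "continuous_on S f" for S :: "'b::topological_space set" and f
    by (rule continuous_on_compose2[OF v that]) auto
  \<comment> \<open>Swapping the coordinates reduces this to the first direction, at the price of
    exchanging the order of integration.\<close>
  define w where "w = (\<lambda>x. v (snd x, fst x))"
  have "continuous_on UNIV w" unfolding w_def by (intro comp continuous_intros)
  note lim = integral_box_difference_quotient_fst[OF this cd, of a b]
  have "integral (cbox (c, a) (d, b)) (\<lambda>x. (w (x + (h, 0)) - w x) / h) =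
    integral (cbox (a, c) (b, d)) (\<lambda>x. (v (x + (0, h)) - v x) / h)" if "h > 0" for h
  proof -
    have "integral (cbox (a, c) (b, d)) (\<lambda>x. (v (x + (0, h)) - v x) / h) =
      integral (cbox a b) (\<lambda>s. integral (cbox c d) (\<lambda>t. (v ((s, t) + (0, h)) - v (s, t)) / h))"
      by (rule integral_prod_continuous) (use that in \<open>auto intro!: comp continuous_intros\<close>)
    also have "\<dots> = integral (cbox c d) (\<lambda>t. integral (cbox a b) (\<lambda>s. (v ((s, t) + (0, h)) - v (s, t)) / h))"
      by (rule integral_swap_continuous) (use that in \<open>auto intro!: comp continuous_intros simp: case_prod_unfold\<close>)
    also have "\<dots> = integral (cbox (c, a) (d, b)) (\<lambda>x. (w (x + (h, 0)) - w x) / h)"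
    proof (subst integral_prod_continuous)
      show "continuous_on (cbox (c, a) (d, b)) (\<lambda>x. (w (x + (h, 0)) - w x) / h)"
        unfolding w_def using that by (intro continuous_intros comp) auto
    qed (simp add: w_def)
    finally show ?thesis by (rule sym)
  qed
  with lim show ?thesis
    by (auto elim!: Lim_transform_eventually simp: eventually_at_right_field w_def intro!: exI[of _ 1])
qed

text \<open>Gauss' theorem on a rectangle under a Lipschitz bound, where the divergence is only known
  almost everywhere: pass to the limit in difference quotients by dominated convergence.\<close>
lemma rectangle_divergence_theorem:
  fixes v w :: "real \<times> real \<Rightarrow> real"
  assumes v: "continuous_on UNIV v" and w: "continuous_on UNIV w"
    and ab: "a \<le> b" and cd: "c \<le> d"
    and lip: "\<And>x h. x \<in> cbox (a, c) (b, d) \<Longrightarrow> 0 < h \<Longrightarrow> h \<le> 1 \<Longrightarrow>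
        \<bar>v (x + (h, 0)) - v x\<bar> \<le> L * h \<and> \<bar>w (x + (0, h)) - w x\<bar> \<le> L * h"
    and N: "negligible N"
    and der: "\<And>x. x \<in> cbox (a, c) (b, d) - N \<Longrightarrow>
        ((\<lambda>h. (v (x + (h, 0)) - v x) / h + (w (x + (0, h)) - w x) / h) \<longlongrightarrow> D) (at_right 0)"
  shows "integral {c..d} (\<lambda>t. v (b, t) - v (a, t)) + integral {a..b} (\<lambda>s. w (s, d) - w (s, c))
    = D * ((b - a) * (d - c))"
proof -
  let ?B = "cbox (a, c) (b, d)"
  define h :: "nat \<Rightarrow> real" where "h = (\<lambda>n. 1 / real (Suc n))"
  have h: "0 < h n" "h n \<le> 1" for n by (auto simp: h_def divide_simps)
  have hlim: "filterlim h (at_right 0) sequentially"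
    unfolding filterlim_at h_def using LIMSEQ_inverse_real_of_nat by (auto simp: inverse_eq_divide)
  define q where "q = (\<lambda>n x. (v (x + (h n, 0)) - v x) / h n + (w (x + (0, h n)) - w x) / h n)"
  \<comment> \<open>Overwriting the null set by the limit value gives convergence everywhere without
    changing the integrals.\<close>
  define q' where "q' = (\<lambda>n x. if x \<in> N then D else q n x)"
  have contv: "continuous_on ?B (\<lambda>x. (v (x + (h n, 0)) - v x) / h n)" for n
    using h(1)[of n] by (intro continuous_intros continuous_on_compose2[OF v] continuous_on_subset[OF v]) auto
  have contw: "continuous_on ?B (\<lambda>x. (w (x + (0, h n)) - w x) / h n)" for n
    using h(1)[of n] by (intro continuous_intros continuous_on_compose2[OF w] continuous_on_subset[OF w]) auto
  have intq: "q n integrable_on ?B" for n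
    unfolding q_def by (intro integrable_add integrable_continuous contv contw)
  have q'_int: "q' n integrable_on ?B" for n
    by (rule integrable_spike[OF intq N]) (auto simp: q'_def)
  have q'_eq: "integral ?B (q' n) = integral ?B (q n)" for n
    by (rule integral_spike[OF N]) (auto simp: q'_def)
  have "(\<lambda>n. integral ?B (q' n)) \<longlonglongrightarrow> integral ?B (\<lambda>x. D)"
  proof (rule dominated_convergence(2)[OF q'_int, where h = "\<lambda>x. 2 * \<bar>L\<bar> + \<bar>D\<bar>"])
    show "norm (q' n x) \<le> 2 * \<bar>L\<bar> + \<bar>D\<bar>" if "x \<in> ?B" for n x
    proof (cases "x \<in> N")
      case False
      have "\<bar>(v (x + (h n, 0)) - v x) / h n\<bar> \<le> L" "\<bar>(w (x + (0, h n)) - w x) / h n\<bar> \<le> L"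
        using lip[OF that h] h(1)[of n] by (auto simp: abs_divide divide_le_eq)
      then show ?thesis using False unfolding q'_def q_def real_norm_def if_not_P[OF False] by linarith
    qed (simp add: q'_def)
    show "(\<lambda>n. q' n x) \<longlonglongrightarrow> D" if "x \<in> ?B" for x
      using filterlim_compose[OF der hlim, of x] that by (cases "x \<in> N") (auto simp: q'_def q_def)
  qed auto
  moreover have "(\<lambda>n. integral ?B (q n)) \<longlonglongrightarrow>
      integral {c..d} (\<lambda>t. v (b, t) - v (a, t)) + integral {a..b} (\<lambda>s. w (s, d) - w (s, c))"
  proof -
    have "integral ?B (q n) = integral ?B (\<lambda>x. (v (x + (h n, 0)) - v x) / h n)
        + integral ?B (\<lambda>x. (w (x + (0, h n)) - w x) / h n)" for n
      unfolding q_def by (intro Henstock_Kurzweil_Integration.integral_add integrable_continuous contv contw)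
    then show ?thesis
      by (simp only:) (intro tendsto_add filterlim_compose[OF integral_box_difference_quotient_fst[OF v ab] hlim]
            filterlim_compose[OF integral_box_difference_quotient_snd[OF w cd] hlim])
  qed
  ultimately have "integral {c..d} (\<lambda>t. v (b, t) - v (a, t)) + integral {a..b} (\<lambda>s. w (s, d) - w (s, c))
      = integral ?B (\<lambda>x. D)"
    unfolding q'_eq by (rule LIMSEQ_unique[rotated])
  also have "\<dots> = D * ((b - a) * (d - c))"
    using ab cd by (simp add: content_Pair mult.commute)
  finally show ?thesis .
qed

section \<open>From the equation almost everywhere to a holomorphic potential\<close>

lemma has_derivative_grad:
  assumes "u differentiable (at x)"
  shows "(u has_derivative (\<lambda>h. fst h * fst (grad u x) + snd h * snd (grad u x))) (at x)"
proof -
  let ?D = "frechet_derivative u (at x)"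
  have D: "(u has_derivative ?D) (at x)" using assms frechet_derivative_works by blast
  then interpret bounded_linear ?D by (rule has_derivative_bounded_linear)
  have "?D h = fst h * fst (grad u x) + snd h * snd (grad u x)" for h
  proof -
    have "h = fst h *\<^sub>R (1, 0) + snd h *\<^sub>R (0, 1)" by (simp add: prod_eq_iff)
    then have "?D h = fst h *\<^sub>R ?D (1, 0) + snd h *\<^sub>R ?D (0, 1)" by (metis add scaleR)
    then show ?thesis by (simp add: grad_def)
  qed
  then have "?D = (\<lambda>h. fst h * fst (grad u x) + snd h * snd (grad u x))" by blast
  with D show ?thesis by simp
qed

lemma C11_loc_continuous_grad:
  assumes "C11_loc u"
  shows "continuous_on UNIV (grad u)"
proof -
  have "isCont (grad u) x" for x
  proof -
    obtain L where L: "\<And>y z. y \<in> cball x 1 \<Longrightarrow> z \<in> cball x 1 \<Longrightarrow> dist (grad u y) (grad u z) \<le> L * dist y z"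
      using assms unfolding C11_loc_def by (meson compact_cball)
    have "((\<lambda>y. dist (grad u y) (grad u x)) \<longlongrightarrow> 0) (at x)"
    proof (rule tendsto_sandwich[of "\<lambda>_. 0"])
      show "\<forall>\<^sub>F y in at x. dist (grad u y) (grad u x) \<le> L * dist y x"
        using L[of _ x] by (auto simp: eventually_at dist_commute intro!: exI[of _ 1])
      show "((\<lambda>y. L * dist y x) \<longlongrightarrow> 0) (at x)" by (auto intro!: tendsto_eq_intros)
    qed auto
    then show ?thesis unfolding isCont_def by (subst tendsto_dist_iff)
  qed
  then show ?thesis by (simp add: continuous_at_imp_continuous_on)
qed

lemma difference_quotient_at_right:
  fixes f :: "'a::real_normed_vector \<Rightarrow> 'b::real_normed_vector"
  assumes "(f has_derivative D) (at x)"
  shows "((\<lambda>h. (f (x + h *\<^sub>R e) - f x) /\<^sub>R h) \<longlongrightarrow> D e) (at_right 0)"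
proof -
  have "((\<lambda>h. x + h *\<^sub>R e) has_vector_derivative e) (at 0 within {0<..})"
    by (auto intro!: derivative_eq_intros simp: has_vector_derivative_def)
  then have "((f \<circ> (\<lambda>h. x + h *\<^sub>R e)) has_vector_derivative D e) (at 0 within {0<..})"
    using assms by (intro vector_derivative_diff_chain_within) (auto intro: has_derivative_at_withinI)
  then have small: "\<forall>\<^sub>F h in at_right 0. norm (f (x + h *\<^sub>R e) - f x - h *\<^sub>R D e) \<le> d * \<bar>h\<bar>"
    if "d > 0" for d
    using that by (simp add: has_vector_derivative_def has_derivative_within_alt2 o_def)
  show ?thesis
  proof (rule tendstoI)
    fix d :: real assume d: "d > 0"
    then have "\<forall>\<^sub>F h in at_right 0. norm (f (x + h *\<^sub>R e) - f x - h *\<^sub>R D e) \<le> d / 2 * \<bar>h\<bar>"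
      by (intro small) simp
    moreover have "\<forall>\<^sub>F h::real in at_right 0. 0 < h" by (simp add: eventually_at_right_less)
    ultimately show "\<forall>\<^sub>F h in at_right 0. dist ((f (x + h *\<^sub>R e) - f x) /\<^sub>R h) (D e) < d"
    proof eventually_elim
      case (elim h)
      have "(f (x + h *\<^sub>R e) - f x) /\<^sub>R h - D e = (f (x + h *\<^sub>R e) - f x - h *\<^sub>R D e) /\<^sub>R h"
        using elim(2) by (simp add: scaleR_diff_right)
      then have "dist ((f (x + h *\<^sub>R e) - f x) /\<^sub>R h) (D e) = norm (f (x + h *\<^sub>R e) - f x - h *\<^sub>R D e) / h"
        using elim(2) by (simp add: dist_norm divide_inverse_commute)
      also have "\<dots> \<le> d / 2" using elim by (simp add: divide_le_eq)
      finally show ?case using d by simp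
    qed
  qed
qed

text \<open>The equation excludes a null set and cannot be used pointwise. Integrated over a
  rectangle inside the positivity set, it becomes an identity with no exceptional points.\<close>

lemma global_solution_rectangle_identity:
  assumes u: "global_solution u" and ab: "a \<le> b" and cd: "c \<le> d"
    and pos: "\<And>x. x \<in> cbox (a, c) (b, d) \<Longrightarrow> 0 < u x"
  shows "integral {c..d} (\<lambda>t. fst (grad u (b, t)) - fst (grad u (a, t))) +
    integral {a..b} (\<lambda>s. snd (grad u (s, d)) - snd (grad u (s, c))) = (b - a) * (d - c)"
proof -
  have C11: "C11_loc u" using u by (simp add: global_solution_def)
  have cont: "continuous_on UNIV (grad u)" by (rule C11_loc_continuous_grad[OF C11])
  \<comment> \<open>The rectangle is enlarged by 1 so that the Lipschitz bound covers points shifted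
    by \<open>h \<le> 1\<close>.\<close>
  obtain L where L: "\<And>y z. y \<in> cbox (a, c) (b + 1, d + 1) \<Longrightarrow> z \<in> cbox (a, c) (b + 1, d + 1) \<Longrightarrow>
      dist (grad u y) (grad u z) \<le> L * dist y z"
    using C11 unfolding C11_loc_def by (meson compact_cbox)
  have "AE x in lebesgue. grad u differentiable (at x) \<and> laplacian u x = (if u x > 0 then 1 else 0)"
    using u by (simp add: global_solution_def)
  then obtain N where N: "N \<in> null_sets lebesgue"
    and good: "\<And>x. x \<notin> N \<Longrightarrow> grad u differentiable (at x) \<and> laplacian u x = (if u x > 0 then 1 else 0)"
    unfolding eventually_ae_filter by auto
  have "integral {c..d} (\<lambda>t. fst (grad u (b, t)) - fst (grad u (a, t))) +
    integral {a..b} (\<lambda>s. snd (grad u (s, d)) - snd (grad u (s, c))) = 1 * ((b - a) * (d - c))"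
  proof (rule rectangle_divergence_theorem[OF _ _ ab cd])
    show "continuous_on UNIV (\<lambda>x. fst (grad u x))" "continuous_on UNIV (\<lambda>x. snd (grad u x))"
      by (intro continuous_intros cont)+
    show "negligible N" using N by (simp add: negligible_iff_null_sets)
    show "\<bar>fst (grad u (x + (h, 0))) - fst (grad u x)\<bar> \<le> L * h \<and>
          \<bar>snd (grad u (x + (0, h))) - snd (grad u x)\<bar> \<le> L * h"
      if x: "x \<in> cbox (a, c) (b, d)" and h: "0 < h" "h \<le> 1" for x h
    proof -
      have "x \<in> cbox (a, c) (b + 1, d + 1)" "x + (h, 0) \<in> cbox (a, c) (b + 1, d + 1)"
        "x + (0, h) \<in> cbox (a, c) (b + 1, d + 1)"
        using x h by (cases x; auto simp: cbox_Pair_iff)+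
      then have "dist (grad u (x + (h, 0))) (grad u x) \<le> L * h" "dist (grad u (x + (0, h))) (grad u x) \<le> L * h"
        using L[of "x + (h, 0)" x] L[of "x + (0, h)" x] h by (auto simp: dist_norm norm_Pair)
      then show ?thesis
        using dist_fst_le[of "grad u (x + (h, 0))" "grad u x"] dist_snd_le[of "grad u (x + (0, h))" "grad u x"]
        by (auto simp: dist_real_def)
    qed
    show "((\<lambda>h. (fst (grad u (x + (h, 0))) - fst (grad u x)) / h +
        (snd (grad u (x + (0, h))) - snd (grad u x)) / h) \<longlongrightarrow> 1) (at_right 0)"
      if x: "x \<in> cbox (a, c) (b, d) - N" for x
    proof -
      let ?D = "frechet_derivative (grad u) (at x)"
      have D: "(grad u has_derivative ?D) (at x)" and "fst (?D (1, 0)) + snd (?D (0, 1)) = 1"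
        using good[of x] x pos[of x] frechet_derivative_works by (auto simp: laplacian_def)
      moreover have "((\<lambda>h. fst ((grad u (x + h *\<^sub>R (1, 0)) - grad u x) /\<^sub>R h) +
          snd ((grad u (x + h *\<^sub>R (0, 1)) - grad u x) /\<^sub>R h)) \<longlongrightarrow> fst (?D (1, 0)) + snd (?D (0, 1))) (at_right 0)"
        by (intro tendsto_intros difference_quotient_at_right[OF D])
      ultimately show ?thesis by (simp add: divide_inverse mult.commute)
    qed
  qed
  then show ?thesis by simp
qed

text \<open>The function \<open>K\<close> below is the harmonic conjugate of \<open>x\<^sup>2 - 2 u\<close> on a rectangle, obtained by
  integrating along the two L-shaped paths from a corner.\<close>
lemma global_solution_conjugate:
  assumes u: "global_solution u" and pos: "\<And>z. z \<in> cbox (x1, y1) (x2, y2) \<Longrightarrow> 0 < u z"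
  shows "\<exists>K. \<forall>x\<in>{x1<..<x2}. \<forall>y\<in>{y1<..<y2}.
    (K has_derivative (\<lambda>h. fst h * (2 * snd (grad u (x, y))) + snd h * (2 * (x - fst (grad u (x, y)))))) (at (x, y))"
proof -
  define p q where "p = (\<lambda>z. fst (grad u z))" and "q = (\<lambda>z. snd (grad u z))"
  have "continuous_on UNIV (grad u)"
    using u by (intro C11_loc_continuous_grad) (simp add: global_solution_def)
  then have contp: "continuous_on UNIV p" and contq: "continuous_on UNIV q"
    unfolding p_def q_def by (intro continuous_intros; simp)+
  have compp: "continuous_on S (\<lambda>x. p (f x))" if "continuous_on S f" for S :: "'b::topological_space set" and f
    by (rule continuous_on_compose2[OF contp that]) auto
  have compq: "continuous_on S (\<lambda>x. q (f x))" if "continuous_on S f" for S :: "'b::topological_space set" and f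
    by (rule continuous_on_compose2[OF contq that]) auto
  have intp: "(\<lambda>t. p (x, t)) integrable_on {a..b}" and intq: "(\<lambda>s. q (s, x)) integrable_on {a..b}" for a b x
    by (intro integrable_continuous_real compp compq continuous_intros)+
  define k where "k = (\<lambda>x y. integral {x1..x} (\<lambda>s. 2 * q (s, y1)) + integral {y1..y} (\<lambda>t. 2 * (x - p (x, t))))"
  \<comment> \<open>The rectangle identity is path independence: this is \<open>k\<close> along the
    other L-shaped path. The definition exposes the derivative in \<open>y\<close>, this formula the
    one in \<open>x\<close>.\<close>
  have k_eq: "k x y = 2 * x1 * (y - y1) - integral {y1..y} (\<lambda>t. 2 * p (x1, t)) + integral {x1..x} (\<lambda>s. 2 * q (s, y))"
    if "x1 \<le> x" "x \<le> x2" "y1 \<le> y" "y \<le> y2" for x y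
  proof -
    have "integral {y1..y} (\<lambda>t. p (x, t) - p (x1, t)) + integral {x1..x} (\<lambda>s. q (s, y) - q (s, y1)) = (x - x1) * (y - y1)"
      unfolding p_def q_def
      by (rule global_solution_rectangle_identity[OF u that(1,3)]) (use that in \<open>auto intro!: pos simp: cbox_Pair_iff\<close>)
    then have "integral {y1..y} (\<lambda>t. p (x, t)) - integral {y1..y} (\<lambda>t. p (x1, t)) +
        (integral {x1..x} (\<lambda>s. q (s, y)) - integral {x1..x} (\<lambda>s. q (s, y1))) = (x - x1) * (y - y1)"
      by (simp add: Henstock_Kurzweil_Integration.integral_diff intp intq)
    moreover have "integral {y1..y} (\<lambda>t. x - p (x, t)) = x * (y - y1) - integral {y1..y} (\<lambda>t. p (x, t))"
      using that by (subst Henstock_Kurzweil_Integration.integral_diff) (auto simp: intp)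
    ultimately show ?thesis unfolding k_def integral_mult_right by (simp add: algebra_simps)
  qed
  let ?X = "{x1<..<x2}" and ?Y = "{y1<..<y2}"
  have kx: "((\<lambda>x. k x y) has_derivative (\<lambda>h. h * (2 * q (x, y)))) (at x within ?X)" if x: "x \<in> ?X" and y: "y \<in> ?Y" for x y
  proof -
    have "((\<lambda>x. integral {x1..x} (\<lambda>s. 2 * q (s, y))) has_real_derivative 2 * q (x, y)) (at x within {x1..x2})"
      using x by (intro integral_has_real_derivative continuous_intros compq) auto
    then have "((\<lambda>x. integral {x1..x} (\<lambda>s. 2 * q (s, y))) has_real_derivative 2 * q (x, y)) (at x within ?X)"
      by (rule DERIV_subset) auto
    from DERIV_add[OF DERIV_const this]
    have "((\<lambda>x. 2 * x1 * (y - y1) - integral {y1..y} (\<lambda>t. 2 * p (x1, t)) + integral {x1..x} (\<lambda>s. 2 * q (s, y)))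
        has_real_derivative 2 * q (x, y)) (at x within ?X)" by simp
    then have "((\<lambda>x. k x y) has_real_derivative 2 * q (x, y)) (at x within ?X)"
      by (rule has_field_derivative_transform_within[OF _ zero_less_one x]) (use y in \<open>auto simp: k_eq\<close>)
    then show ?thesis by (simp add: has_field_derivative_def mult_commute_abs)
  qed
  \<comment> \<open>The bounded linear form is the one in which continuity of this partial
    derivative yields joint differentiability.\<close>
  have ky: "((\<lambda>y. k x y) has_derivative blinfun_apply (blinfun_mult_right (2 * (x - p (x, y))))) (at y within ?Y)"
    if x: "x \<in> ?X" and y: "y \<in> ?Y" for x y
  proof -
    have "((\<lambda>y. integral {y1..y} (\<lambda>t. 2 * (x - p (x, t)))) has_real_derivative 2 * (x - p (x, y))) (at y within {y1..y2})"
      using y by (intro integral_has_real_derivative continuous_intros compp) auto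
    then have "((\<lambda>y. integral {y1..y} (\<lambda>t. 2 * (x - p (x, t)))) has_real_derivative 2 * (x - p (x, y))) (at y within ?Y)"
      by (rule DERIV_subset) auto
    from DERIV_add[OF DERIV_const this]
    have "(k x has_real_derivative 2 * (x - p (x, y))) (at y within ?Y)" by (simp add: k_def)
    then show ?thesis by (simp add: has_field_derivative_def)
  qed
  have "((\<lambda>(x, y). k x y) has_derivative (\<lambda>h. fst h * (2 * q (x, y)) + snd h * (2 * (x - p (x, y))))) (at (x, y))"
    if x: "x \<in> ?X" and y: "y \<in> ?Y" for x y
  proof -
    have "continuous_on (?X \<times> ?Y) (\<lambda>(x, y). blinfun_mult_right (2 * (x - p (x, y))))"
      unfolding case_prod_unfold
      by (intro bounded_linear.continuous_on[OF bounded_linear_blinfun_mult_right] continuous_intros compp)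
    then have "continuous (at (x, y) within ?X \<times> ?Y) (\<lambda>(x, y). blinfun_mult_right (2 * (x - p (x, y))))"
      using x y by (simp add: continuous_on_eq_continuous_within)
    from has_derivative_partialsI[OF kx[OF x y] ky this y]
    have "((\<lambda>(x, y). k x y) has_derivative (\<lambda>(tx, ty). tx * (2 * q (x, y)) + blinfun_apply (blinfun_mult_right (2 * (x - p (x, y)))) ty))
       (at (x, y) within ?X \<times> ?Y)" by simp
    moreover have "at (x, y) within ?X \<times> ?Y = at (x, y)"
      using x y by (intro at_within_open open_Times) auto
    ultimately show ?thesis by (simp add: case_prod_unfold mult.commute)
  qed
  then show ?thesis unfolding p_def q_def by blast
qed

text \<open>The real part x1^2 - 2 u has gradient (2 (x1 - u_1), - 2 u_2), its conjugate has
  gradient (2 u_2, 2 (x1 - u_1)). These are the Cauchy-Riemann equations, and they involve first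
  derivatives of \<open>u\<close> only.\<close>

lemma global_solution_potential:
  assumes u: "global_solution u" and pos: "0 < u (Re z0, Im z0)"
  shows "\<exists>r>0. \<exists>K. \<forall>z\<in>ball z0 r.
    (K has_field_derivative Complex (2 * (Re z - fst (grad u (Re z, Im z)))) (2 * snd (grad u (Re z, Im z)))) (at z)
    \<and> Re (K z) = (Re z)\<^sup>2 - 2 * u (Re z, Im z)"
proof -
  have diff: "u differentiable (at x)" for x
    using u unfolding global_solution_def C11_loc_def by blast
  then have "continuous_on UNIV u"
    by (simp add: continuous_at_imp_continuous_on differentiable_imp_continuous_within)
  then have "open {x. 0 < u x}" by (intro open_Collect_less) auto
  then obtain \<rho> where \<rho>: "\<rho> > 0" "ball (Re z0, Im z0) \<rho> \<subseteq> {x. 0 < u x}"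
    using pos open_contains_ball by (metis mem_Collect_eq)
  \<comment> \<open>Points of the square with half side \<open>\<rho> / 3\<close> are at most
    \<open>2 * \<rho> / 3\<close> from the centre, inside the ball.\<close>
  define \<delta> where "\<delta> = \<rho> / 3"
  have \<delta>: "\<delta> > 0" using \<rho> by (simp add: \<delta>_def)
  define x1 x2 y1 y2 where "x1 = Re z0 - \<delta>" and "x2 = Re z0 + \<delta>" and "y1 = Im z0 - \<delta>" and "y2 = Im z0 + \<delta>"
  have "0 < u z" if z: "z \<in> cbox (x1, y1) (x2, y2)" for z
  proof -
    have "dist (Re z0, Im z0) z \<le> \<bar>Re z0 - fst z\<bar> + \<bar>Im z0 - snd z\<bar>"
      by (cases z) (simp add: dist_norm norm_Pair sqrt_sum_squares_le_sum_abs)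
    also have "\<dots> \<le> \<delta> + \<delta>"
      using z by (cases z) (auto simp: cbox_Pair_iff x1_def x2_def y1_def y2_def)
    also have "\<dots> < \<rho>" using \<rho>(1) by (simp add: \<delta>_def)
    finally show ?thesis using \<rho>(2) by auto
  qed
  from global_solution_conjugate[OF u this] obtain k where k:
    "\<forall>x\<in>{x1<..<x2}. \<forall>y\<in>{y1<..<y2}. (k has_derivative
      (\<lambda>h. fst h * (2 * snd (grad u (x, y))) + snd h * (2 * (x - fst (grad u (x, y)))))) (at (x, y))"
    by blast
  define K where "K = (\<lambda>z. of_real ((Re z)\<^sup>2 - 2 * u (Re z, Im z)) + \<i> * of_real (k (Re z, Im z)))"
  have "(K has_field_derivative Complex (2 * (Re z - fst (grad u (Re z, Im z)))) (2 * snd (grad u (Re z, Im z)))) (at z)"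
    if z: "z \<in> ball z0 \<delta>" for z
  proof -
    define a b where "a = fst (grad u (Re z, Im z))" and "b = snd (grad u (Re z, Im z))"
    have "\<bar>Re z - Re z0\<bar> < \<delta>" "\<bar>Im z - Im z0\<bar> < \<delta>"
      using z abs_Re_le_cmod[of "z - z0"] abs_Im_le_cmod[of "z - z0"] by (auto simp: dist_norm norm_minus_commute)
    then have "Re z \<in> {x1<..<x2}" "Im z \<in> {y1<..<y2}" by (auto simp: x1_def x2_def y1_def y2_def)
    with k have k': "(k has_derivative (\<lambda>h. fst h * (2 * b) + snd h * (2 * (Re z - a)))) (at (Re z, Im z))"
      by (simp add: a_def b_def)
    have u': "(u has_derivative (\<lambda>h. fst h * a + snd h * b)) (at (Re z, Im z))"
      unfolding a_def b_def by (rule has_derivative_grad[OF diff])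
    have pr: "((\<lambda>z. (Re z, Im z)) has_derivative (\<lambda>h. (Re h, Im h))) (at z)"
      by (intro derivative_intros)
    have "((\<lambda>z. k (Re z, Im z)) has_derivative (\<lambda>h. Re h * (2 * b) + Im h * (2 * (Re z - a)))) (at z)"
      using has_derivative_compose[OF pr k'] by simp
    moreover have "((\<lambda>z. u (Re z, Im z)) has_derivative (\<lambda>h. Re h * a + Im h * b)) (at z)"
      using has_derivative_compose[OF pr u'] by simp
    ultimately have "(K has_derivative (\<lambda>h. of_real (2 * Re z * Re h - 2 * (Re h * a + Im h * b)) +
        \<i> * of_real (Re h * (2 * b) + Im h * (2 * (Re z - a))))) (at z)"
      unfolding K_def by (auto intro!: derivative_eq_intros simp: mult_ac)
    moreover have "(\<lambda>h. of_real (2 * Re z * Re h - 2 * (Re h * a + Im h * b)) +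
        \<i> * of_real (Re h * (2 * b) + Im h * (2 * (Re z - a)))) = (*) (Complex (2 * (Re z - a)) (2 * b))"
      by (auto simp: fun_eq_iff complex_eq_iff algebra_simps)
    ultimately show ?thesis by (simp only: has_field_derivative_def a_def b_def)
  qed
  moreover have "Re (K z) = (Re z)\<^sup>2 - 2 * u (Re z, Im z)" for z by (simp add: K_def)
  ultimately show ?thesis using \<delta> by blast
qed

section \<open>Transfer to the real plane\<close>

theorem theorem1p3:
  fixes u :: "real \<times> real \<Rightarrow> real"
  assumes "global_solution u" and "x2_monotone u"
  shows "\<exists>\<gamma>>0. {x. u x = 0} =
           {(y1, y2). 0 \<le> y2 \<and> - sqrt (\<gamma> * y2) \<le> y1 \<and> y1 \<le> sqrt (\<gamma> * y2)}"
proof -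
  have diff: "u differentiable (at x)" for x
    using assms(1) unfolding global_solution_def C11_loc_def by blast
  have nonneg: "0 \<le> u x" for x using assms(1) unfolding global_solution_def by blast
  have cont_grad: "continuous_on UNIV (grad u)"
    using assms(1) by (intro C11_loc_continuous_grad) (simp add: global_solution_def)
  have contu: "continuous_on UNIV u"
    using diff by (simp add: continuous_at_imp_continuous_on differentiable_imp_continuous_within)
  have anti: "\<And>x. snd (grad u x) \<le> 0"
    and low: "{x. u x = 0} \<inter> {x. snd x \<le> 0} = {0}" and int: "interior {x. u x = 0} \<noteq> {}"
    using assms(2) unfolding x2_monotone_def by blast+
  define U where "U = (\<lambda>z. u (Re z, Im z))"
  define F where "F = (\<lambda>z. Complex (2 * (Re z - fst (grad u (Re z, Im z)))) (2 * snd (grad u (Re z, Im z))))"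
  interpret hypograph_solution U F
  proof
    show "continuous_on UNIV U"
      unfolding U_def by (intro continuous_on_compose2[OF contu] continuous_intros) auto
    have "continuous_on UNIV (\<lambda>z. grad u (Re z, Im z))"
      by (intro continuous_on_compose2[OF cont_grad] continuous_intros) auto
    then show "continuous_on UNIV F"
      unfolding F_def Complex_eq by (intro continuous_intros)
    show "0 \<le> U z" for z by (simp add: U_def nonneg)
    show "F z = of_real (2 * Re z)" if "U z = 0" for z
    proof -
      let ?x = "(Re z, Im z)"
      \<comment> \<open>A zero of the nonnegative function \<open>u\<close> is a global minimum, so
        the gradient vanishes there.\<close>
      have "(\<lambda>h. fst h * fst (grad u ?x) + snd h * snd (grad u ?x)) = (\<lambda>h. 0)"
        using that nonneg by (intro differential_zero_maxmin[OF _ open_UNIV has_derivative_grad[OF diff]]) (auto simp: U_def)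
      from fun_cong[OF this, of "(1, 0)"] fun_cong[OF this, of "(0, 1)"]
      have "fst (grad u ?x) = 0" "snd (grad u ?x) = 0" by simp_all
      then show ?thesis by (simp add: F_def complex_eq_iff)
    qed
    show "Im (F z) \<le> 0" for z using anti by (simp add: F_def)
    show "U (Complex x y') \<le> U (Complex x y)" if "y \<le> y'" for x y y'
    proof -
      have "((\<lambda>t. u (x, t)) has_real_derivative snd (grad u (x, t))) (at t)" for t
      proof -
        have "((\<lambda>t. (x, t)) has_derivative (\<lambda>h. (0, h))) (at t)" by (intro derivative_intros)
        from has_derivative_compose[OF this has_derivative_grad[OF diff]]
        show ?thesis by (simp add: has_field_derivative_def mult_commute_abs)
      qed
      then have "u (x, y') \<le> u (x, y)"
        using anti that by (intro DERIV_nonpos_imp_nonincreasing[of y y' "\<lambda>t. u (x, t)"]) blast+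
      then show ?thesis by (simp add: U_def)
    qed
    show "U z = 0 \<longleftrightarrow> z = 0" if "Im z \<le> 0" for z
    proof -
      have "U z = 0 \<longleftrightarrow> (Re z, Im z) \<in> {x. u x = 0} \<inter> {x. snd x \<le> 0}"
        using that by (simp add: U_def)
      also have "\<dots> \<longleftrightarrow> z = 0" unfolding low by (simp add: zero_prod_def complex_eq_iff)
      finally show ?thesis .
    qed
    let ?S = "(\<lambda>z. (Re z, Im z)) -` interior {x. u x = 0}"
    have "open ?S" by (intro open_vimage continuous_intros) auto
    moreover have "?S \<subseteq> {z. U z = 0}" using interior_subset by (auto simp: U_def)
    moreover obtain x y where "(x, y) \<in> interior {x. u x = 0}" using int by auto
    then have "Complex x y \<in> ?S" by simp
    ultimately show "interior {z. U z = 0} \<noteq> {}" using interior_maximal by blast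
    show "\<exists>r>0. \<exists>K. \<forall>z\<in>ball z0 r. (K has_field_derivative F z) (at z) \<and> Re (K z) = (Re z)\<^sup>2 - 2 * U z"
      if "0 < U z0" for z0
      unfolding F_def U_def by (rule global_solution_potential[OF assms(1)]) (use that in \<open>simp add: U_def\<close>)
  qed
  obtain c where c: "c > 0" "\<And>z. U z = 0 \<longleftrightarrow> c * (Re z)\<^sup>2 \<le> Im z"
    using zero_set_paraboloid by blast
  \<comment> \<open>Solving the inequality from \<open>zero_set_paraboloid\<close> for
    \<open>x\<close> gives the constant \<open>\<gamma> = 1 / c\<close>.\<close>
  have "u (x, y) = 0 \<longleftrightarrow> 0 \<le> y \<and> - sqrt (1 / c * y) \<le> x \<and> x \<le> sqrt (1 / c * y)" for x y
  proof -
    have "u (x, y) = 0 \<longleftrightarrow> x\<^sup>2 \<le> 1 / c * y"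
      using c(2)[of "Complex x y"] c(1) by (simp add: U_def field_simps)
    also have "\<dots> \<longleftrightarrow> 0 \<le> y \<and> \<bar>x\<bar> \<le> sqrt (1 / c * y)"
    proof
      assume *: "x\<^sup>2 \<le> 1 / c * y"
      then have "0 \<le> 1 / c * y" using zero_le_power2[of x] by linarith
      then have "0 \<le> y" using c(1) by (simp add: zero_le_divide_iff)
      moreover have "\<bar>x\<bar> \<le> sqrt (1 / c * y)" using * by (intro real_le_rsqrt) simp
      ultimately show "0 \<le> y \<and> \<bar>x\<bar> \<le> sqrt (1 / c * y)" by blast
    next
      assume *: "0 \<le> y \<and> \<bar>x\<bar> \<le> sqrt (1 / c * y)"
      then have "\<bar>x\<bar>\<^sup>2 \<le> (sqrt (1 / c * y))\<^sup>2" by (intro power_mono) auto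
      also have "\<dots> = 1 / c * y" using * c(1) by (intro real_sqrt_pow2) simp
      finally show "x\<^sup>2 \<le> 1 / c * y" by simp
    qed
    also have "\<dots> \<longleftrightarrow> 0 \<le> y \<and> - sqrt (1 / c * y) \<le> x \<and> x \<le> sqrt (1 / c * y)"
      by (auto simp: abs_le_iff)
    finally show ?thesis .
  qed
  then have "{x. u x = 0} = {(y1, y2). 0 \<le> y2 \<and> - sqrt (1 / c * y2) \<le> y1 \<and> y1 \<le> sqrt (1 / c * y2)}"
    by auto
  then show ?thesis using c(1) by (intro exI[of _ "1 / c"]) simp
qed

end
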